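(* Let $(G,H_0,\mathcal{L}_0)$ be any cut-and-project scheme. Every modulation of a weighted model set in $(G,H_0,\mathcal{L}_0)$ is a deformed weighted model set in the extended cut-and-project scheme $(G,H,\mathcal{L})$ of $(G,H_0,\mathcal{L}_0)$. If $G=\mathbb{R}^d$, then the class of deformed weighted model sets (in all cut-and-project schemes $(\mathbb{R}^d,H,\mathcal{L})$) coincides with the class of modulations of weighted model sets (in all cut-and-project schemes $(\mathbb{R}^d,H,\mathcal{L})$).
   Context: LCAG means locally compact (Hausdorff) abelian group. A cut-and-project scheme (CPS) $(G,H,\mathcal{L})$ consists of LCAGs $G,H$ and a lattice (co-compact discrete subgroup) $\mathcal{L}\subset G\times H$ such that the projection $\pi^G:G\times H\to G$ is one-to-one on $\mathcal{L}$ and $\pi^H(\mathcal{L})$ is dense in $H$. With $L=\pi^G(\mathcal{L})$, for $x\in L$ let $x^\star\in H$ be the unique element with $(x,x^\star)\in\mathcal{L}$ (star map). A deformed weighted model set in $(G,H,\mathcal{L})$ is a measure of the form $\nu=\sum_{\ell\in L}f(\ell^\star)\,\delta_{\ell+p(\ell^\star)}$ with $f\in C_c(H)$ (continuous, compactly supported, complex valued) and $p\in C(H,G)$ (continuous). It is called a weighted model set if $p\equiv0$. Extended CPS: let $G_{\mathsf b}$ be the Bohr compactification of $G$ and $i_{\mathsf b}:G\to G_{\mathsf b}$ the canonical injective homomorphism with dense range. Given a CPS $(G,H_0,\mathcal{L}_0)$ with $L_0=\pi^G(\mathcal{L}_0)$ and star map $\star_0:L_0\to H_0$, put $\ell^\star=(\ell^{\star_0},i_{\mathsf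 b}(\ell))\in H_0\times G_{\mathsf b}$ for $\ell\in L_0$, $\mathcal{L}=\{(\ell,\ell^\star):\ell\in L_0\}$, and let $H$ be the closure of $\{\ell^\star:\ell\in L_0\}$ in $H_0\times G_{\mathsf b}$. Then $(G,H,\mathcal{L})$ is a CPS, called the extended CPS of $(G,H_0,\mathcal{L}_0)$. $C_{\mathsf u}(G,K)$ denotes the uniformly continuous functions with relatively compact range from $G$ to an LCAG $K$, with the topology of uniform convergence, and $C_{\mathsf u}(G)=C_{\mathsf u}(G,\mathbb{C})$. $h\in C_{\mathsf u}(G,K)$ is almost periodic if its set of translates $\{h(\cdot-t):t\in G\}$ has compact closure in $C_{\mathsf u}(G,K)$. A modulation of a (complex Radon) measure $\nu$ on $G$ is a measure $\nu^{w,g}$ given by $\nu^{w,g}(\varphi)=\int w(x)\varphi(x+g(x))\,\mathrm{d}\nu(x)$ for $\varphi\in C_c(G)$, where $w\in C_{\mathsf u}(G)$ and $g\in C_{\mathsf u}(G,G)$ are almost periodic. *)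

theory Defs
  imports "HOL-Analysis.Analysis" "HOL-Algebra.Group" "HOL-Algebra.Coset"
begin

no_notation eq_closure_of (\<open>closure'_of\<index>\<close>)

section \<open>Locally compact abelian groups\<close>

text \<open>Groups are carrier-based, since internal groups of cut-and-project schemes arise as closed
  subgroups and are quantified over. The group operation, written additively in informal
  mathematics, is the multiplication of the underlying monoid record.\<close>

record 'a tgroup = "'a monoid" +
  topo :: "'a topology"

locale lcag = comm_group G for G :: "('a, 'm) tgroup_scheme" (structure) +
  assumes topspace_topo: "topspace (topo G) = carrier G"
    and continuous_mult:
      "continuous_map (prod_topology (topo G) (topo G)) (topo G) (\<lambda>(x, y). x \<otimes> y)"
    and continuous_inv: "continuous_map (topo G) (topo G) (\<lambda>x. inv x)"
    and Hausdorff: "Hausdorff_space (topo G)"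
    and locally_compact: "locally_compact_space (topo G)"

definition additive_tgroup :: "'a::topological_ab_group_add tgroup" where
  "additive_tgroup = \<lparr>carrier = UNIV, mult = (+), one = 0, topo = euclidean\<rparr>"

lemma lcag_additive_tgroup: "lcag (additive_tgroup :: 'a::euclidean_space tgroup)"
proof -
  let ?A = "additive_tgroup :: 'a tgroup"
  interpret comm_group ?A
  proof (rule comm_groupI)
    fix x :: 'a
    have "- x \<otimes>\<^bsub>?A\<^esub> x = \<one>\<^bsub>?A\<^esub>" by (simp add: additive_tgroup_def)
    then show "\<exists>y\<in>carrier ?A. y \<otimes>\<^bsub>?A\<^esub> x = \<one>\<^bsub>?A\<^esub>"
      by (intro bexI[of _ "- x"]) (auto simp: additive_tgroup_def)
  qed (simp_all add: additive_tgroup_def add_ac)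
  have inv: "inv\<^bsub>?A\<^esub> x = - x" for x
    by (rule inv_equality) (auto simp: additive_tgroup_def)
  show ?thesis
  proof
    show "continuous_map (prod_topology (topo ?A) (topo ?A)) (topo ?A) (\<lambda>(x, y). x \<otimes>\<^bsub>?A\<^esub> y)"
      by (auto simp: additive_tgroup_def case_prod_beta intro!: continuous_intros)
    show "continuous_map (topo ?A) (topo ?A) (\<lambda>x. inv\<^bsub>?A\<^esub> x)"
      unfolding inv by (auto simp: additive_tgroup_def intro!: continuous_intros)
    show "locally_compact_space (topo ?A)"
      by (simp add: additive_tgroup_def locally_compact_space_euclidean)
  qed (auto simp: additive_tgroup_def)
qed

definition prod_tgroup :: "'a tgroup \<Rightarrow> 'b tgroup \<Rightarrow> ('a \<times> 'b) tgroup" where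
  "prod_tgroup A B = \<lparr>carrier = carrier (A \<times>\<times> B), mult = mult (A \<times>\<times> B), one = one (A \<times>\<times> B),
     topo = prod_topology (topo A) (topo B)\<rparr>"

definition sub_tgroup :: "'a tgroup \<Rightarrow> 'a set \<Rightarrow> 'a tgroup" where
  "sub_tgroup A S = A\<lparr>carrier := S, topo := subtopology (topo A) S\<rparr>"

definition quotient_topology :: "'a topology \<Rightarrow> ('a \<Rightarrow> 'b) \<Rightarrow> 'b topology" where
  "quotient_topology X q =
     topology (\<lambda>U. U \<subseteq> q ` topspace X \<and> openin X {x \<in> topspace X. q x \<in> U})"

lemma openin_quotient_topology:
  "openin (quotient_topology X q) U \<longleftrightarrow>
     U \<subseteq> q ` topspace X \<and> openin X {x \<in> topspace X. q x \<in> U}"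
proof -
  have "istopology (\<lambda>U. U \<subseteq> q ` topspace X \<and> openin X {x \<in> topspace X. q x \<in> U})"
    unfolding istopology_def
  proof (intro conjI allI impI)
    fix S T
    assume S: "S \<subseteq> q ` topspace X \<and> openin X {x \<in> topspace X. q x \<in> S}"
      and T: "T \<subseteq> q ` topspace X \<and> openin X {x \<in> topspace X. q x \<in> T}"
    show "S \<inter> T \<subseteq> q ` topspace X" using S by blast
    have "{x \<in> topspace X. q x \<in> S \<inter> T} =
        {x \<in> topspace X. q x \<in> S} \<inter> {x \<in> topspace X. q x \<in> T}" by auto
    then show "openin X {x \<in> topspace X. q x \<in> S \<inter> T}"
      using S T by (simp add: openin_Int)
  next
    fix \<K>
    assume K: "\<forall>K\<in>\<K>. K \<subseteq> q ` topspace X \<and> openin X {x \<in> topspace X. q x \<in> K}"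
    then show "\<Union>\<K> \<subseteq> q ` topspace X" by blast
    have "{x \<in> topspace X. q x \<in> \<Union>\<K>} = (\<Union>K\<in>\<K>. {x \<in> topspace X. q x \<in> K})" by auto
    then show "openin X {x \<in> topspace X. q x \<in> \<Union>\<K>}"
      using K by auto
  qed
  then show ?thesis by (simp add: quotient_topology_def)
qed

lemma quotient_map_quotient_topology: "quotient_map X (quotient_topology X q) q"
proof -
  have "openin (quotient_topology X q) (q ` topspace X)"
  proof -
    have "{x \<in> topspace X. q x \<in> q ` topspace X} = topspace X" by blast
    then show ?thesis by (simp add: openin_quotient_topology)
  qed
  then have "topspace (quotient_topology X q) = q ` topspace X"
    by (metis openin_quotient_topology openin_subset openin_topspace subset_antisym)
  then show ?thesis by (auto simp: quotient_map_def openin_quotient_topology)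
qed

definition lattice_in :: "'a set \<Rightarrow> 'a tgroup \<Rightarrow> bool" where
  "lattice_in \<L> A \<longleftrightarrow> subgroup \<L> A \<and> subtopology (topo A) \<L> = discrete_topology \<L> \<and>
     compact_space (quotient_topology (topo A) (\<lambda>x. \<L> #>\<^bsub>A\<^esub> x))"

section \<open>Cut-and-project schemes\<close>

definition cps :: "'g tgroup \<Rightarrow> 'h tgroup \<Rightarrow> ('g \<times> 'h) set \<Rightarrow> bool" where
  "cps G H \<L> \<longleftrightarrow> lcag G \<and> lcag H \<and> lattice_in \<L> (prod_tgroup G H) \<and> inj_on fst \<L> \<and>
     topo H closure_of (snd ` \<L>) = carrier H"

definition star :: "('g \<times> 'h) set \<Rightarrow> 'g \<Rightarrow> 'h" where
  "star \<L> x = (THE y. (x, y) \<in> \<L>)"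

section \<open>Measures\<close>

text \<open>Test functions vanish off a compact subset of the carrier, hence also off the carrier.\<close>

definition Cc :: "'a tgroup \<Rightarrow> ('a \<Rightarrow> complex) set" where
  "Cc A = {\<phi>. continuous_map (topo A) euclidean \<phi> \<and>
     (\<exists>K. compactin (topo A) K \<and> (\<forall>x. x \<notin> K \<longrightarrow> \<phi> x = 0))}"

text \<open>A complex Radon measure is identified with its integral, a linear functional on the test
  functions, continuous for the inductive limit topology. Functionals are \<^const>\<open>undefined\<close> off the
  test functions, so that equality of functionals is equality of measures.\<close>

definition radon_measure :: "'a tgroup \<Rightarrow> (('a \<Rightarrow> complex) \<Rightarrow> complex) \<Rightarrow> bool" where
  "radon_measure A \<nu> \<longleftrightarrow> \<nu> \<in> extensional (Cc A) \<and>
     (\<forall>\<phi>\<in>Cc A. \<forall>\<psi>\<in>Cc A. \<nu> (\<lambda>x. \<phi> x + \<psi> x) = \<nu> \<phi> + \<nu> \<psi>) \<and>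
     (\<forall>c. \<forall>\<phi>\<in>Cc A. \<nu> (\<lambda>x. c * \<phi> x) = c * \<nu> \<phi>) \<and>
     (\<forall>K. compactin (topo A) K \<longrightarrow>
       (\<exists>C. \<forall>\<phi>\<in>Cc A. \<forall>M. (\<forall>x. x \<notin> K \<longrightarrow> \<phi> x = 0) \<and> (\<forall>x. norm (\<phi> x) \<le> M) \<longrightarrow>
         norm (\<nu> \<phi>) \<le> C * M))"

text \<open>The measure whose mass at \<open>l + p(l\<^sup>\<star>)\<close> is \<open>f(l\<^sup>\<star>)\<close>, summed over \<open>l\<close>. In a cut-and-project
  scheme, for \<open>f\<close> with compact support and \<open>p\<close> continuous, only finitely many terms of the sum
  are nonzero for each test function.\<close>

definition deformed_comb ::
  "'g tgroup \<Rightarrow> ('g \<times> 'h) set \<Rightarrow> ('h \<Rightarrow> complex) \<Rightarrow> ('h \<Rightarrow> 'g) \<Rightarrow> ('g \<Rightarrow> complex) \<Rightarrow> complex" where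
  "deformed_comb G \<L> f p =
     (\<lambda>\<phi>\<in>Cc G. \<Sum>\<^sub>\<infinity>l\<in>fst ` \<L>. f (star \<L> l) * \<phi> (l \<otimes>\<^bsub>G\<^esub> p (star \<L> l)))"

definition deformed_weighted_model_set ::
  "'g tgroup \<Rightarrow> 'h tgroup \<Rightarrow> ('g \<times> 'h) set \<Rightarrow> (('g \<Rightarrow> complex) \<Rightarrow> complex) \<Rightarrow> bool" where
  "deformed_weighted_model_set G H \<L> \<nu> \<longleftrightarrow> cps G H \<L> \<and> radon_measure G \<nu> \<and>
     (\<exists>f\<in>Cc H. \<exists>p. continuous_map (topo H) (topo G) p \<and> \<nu> = deformed_comb G \<L> f p)"

definition weighted_model_set ::
  "'g tgroup \<Rightarrow> 'h tgroup \<Rightarrow> ('g \<times> 'h) set \<Rightarrow> (('g \<Rightarrow> complex) \<Rightarrow> complex) \<Rightarrow> bool" where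
  "weighted_model_set G H \<L> \<nu> \<longleftrightarrow> cps G H \<L> \<and> radon_measure G \<nu> \<and>
     (\<exists>f\<in>Cc H. \<nu> = deformed_comb G \<L> f (\<lambda>_. \<one>\<^bsub>G\<^esub>))"

section \<open>Almost periodic functions and modulations\<close>

definition Cu :: "'g tgroup \<Rightarrow> 'k tgroup \<Rightarrow> ('g \<Rightarrow> 'k) set" where
  "Cu G K = {h \<in> carrier G \<rightarrow>\<^sub>E carrier K.
     (\<forall>V. openin (topo K) V \<and> \<one>\<^bsub>K\<^esub> \<in> V \<longrightarrow>
       (\<exists>U. openin (topo G) U \<and> \<one>\<^bsub>G\<^esub> \<in> U \<and>
         (\<forall>x\<in>carrier G. \<forall>y\<in>carrier G.
            x \<otimes>\<^bsub>G\<^esub> inv\<^bsub>G\<^esub> y \<in> U \<longrightarrow> h x \<otimes>\<^bsub>K\<^esub> inv\<^bsub>K\<^esub> (h y) \<in> V))) \<and>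
     compactin (topo K) (topo K closure_of (h ` carrier G))}"

definition uniform_topology :: "'g tgroup \<Rightarrow> 'k tgroup \<Rightarrow> ('g \<Rightarrow> 'k) topology" where
  "uniform_topology G K = topology (\<lambda>\<U>. \<U> \<subseteq> Cu G K \<and>
     (\<forall>h\<in>\<U>. \<exists>V. openin (topo K) V \<and> \<one>\<^bsub>K\<^esub> \<in> V \<and>
       {k \<in> Cu G K. \<forall>x\<in>carrier G. k x \<otimes>\<^bsub>K\<^esub> inv\<^bsub>K\<^esub> (h x) \<in> V} \<subseteq> \<U>))"

lemma openin_uniform_topology:
  "openin (uniform_topology G K) \<U> \<longleftrightarrow> \<U> \<subseteq> Cu G K \<and>
     (\<forall>h\<in>\<U>. \<exists>V. openin (topo K) V \<and> \<one>\<^bsub>K\<^esub> \<in> V \<and>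
       {k \<in> Cu G K. \<forall>x\<in>carrier G. k x \<otimes>\<^bsub>K\<^esub> inv\<^bsub>K\<^esub> (h x) \<in> V} \<subseteq> \<U>)"
proof -
  let ?N = "\<lambda>h V. {k \<in> Cu G K. \<forall>x\<in>carrier G. k x \<otimes>\<^bsub>K\<^esub> inv\<^bsub>K\<^esub> (h x) \<in> V}"
  let ?P = "\<lambda>\<U>. \<U> \<subseteq> Cu G K \<and>
    (\<forall>h\<in>\<U>. \<exists>V. openin (topo K) V \<and> \<one>\<^bsub>K\<^esub> \<in> V \<and> ?N h V \<subseteq> \<U>)"
  have "istopology ?P"
    unfolding istopology_def
  proof (intro conjI allI impI ballI)
    fix S T assume S: "?P S" and T: "?P T"
    show "S \<inter> T \<subseteq> Cu G K" using S by blast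
    fix h assume h: "h \<in> S \<inter> T"
    obtain V where V: "openin (topo K) V" "\<one>\<^bsub>K\<^esub> \<in> V" "?N h V \<subseteq> S" using S h by blast
    obtain W where W: "openin (topo K) W" "\<one>\<^bsub>K\<^esub> \<in> W" "?N h W \<subseteq> T" using T h by blast
    show "\<exists>V. openin (topo K) V \<and> \<one>\<^bsub>K\<^esub> \<in> V \<and> ?N h V \<subseteq> S \<inter> T"
    proof (intro exI[of _ "V \<inter> W"] conjI)
      show "openin (topo K) (V \<inter> W)" using V(1) W(1) by (rule openin_Int)
      show "\<one>\<^bsub>K\<^esub> \<in> V \<inter> W" using V(2) W(2) by (rule IntI)
      have "?N h (V \<inter> W) \<subseteq> ?N h V \<inter> ?N h W" by auto
      then show "?N h (V \<inter> W) \<subseteq> S \<inter> T" using V(3) W(3) by (meson Int_mono subset_trans)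
    qed
  next
    fix \<K> assume K: "\<forall>S\<in>\<K>. ?P S"
    then show "\<Union>\<K> \<subseteq> Cu G K" by blast
    fix h assume "h \<in> \<Union>\<K>"
    then obtain S where S: "S \<in> \<K>" "h \<in> S" by blast
    have "?P S" using K S(1) by (rule bspec)
    then obtain V where V: "openin (topo K) V" "\<one>\<^bsub>K\<^esub> \<in> V" "?N h V \<subseteq> S"
      using S(2) by meson
    have "?N h V \<subseteq> \<Union>\<K>" using V(3) Union_upper[OF S(1)] by (rule subset_trans)
    with V(1,2) show "\<exists>V. openin (topo K) V \<and> \<one>\<^bsub>K\<^esub> \<in> V \<and> ?N h V \<subseteq> \<Union>\<K>"
      by meson
  qed
  then show ?thesis by (simp add: uniform_topology_def)
qed

definition translate :: "'g tgroup \<Rightarrow> 'g \<Rightarrow> ('g \<Rightarrow> 'k) \<Rightarrow> 'g \<Rightarrow> 'k" where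
  "translate G t h = (\<lambda>x\<in>carrier G. h (x \<otimes>\<^bsub>G\<^esub> inv\<^bsub>G\<^esub> t))"

definition almost_periodic :: "'g tgroup \<Rightarrow> 'k tgroup \<Rightarrow> ('g \<Rightarrow> 'k) \<Rightarrow> bool" where
  "almost_periodic G K h \<longleftrightarrow> h \<in> Cu G K \<and>
     compactin (uniform_topology G K)
       (uniform_topology G K closure_of ((\<lambda>t. translate G t h) ` carrier G))"

text \<open>The integrand is again a test function, because \<open>g\<close> has relatively compact range.\<close>

definition modulate ::
  "'g tgroup \<Rightarrow> ('g \<Rightarrow> complex) \<Rightarrow> ('g \<Rightarrow> 'g) \<Rightarrow> (('g \<Rightarrow> complex) \<Rightarrow> complex) \<Rightarrow>
     ('g \<Rightarrow> complex) \<Rightarrow> complex" where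
  "modulate G w g \<nu> =
     (\<lambda>\<phi>\<in>Cc G. \<nu> (\<lambda>x. if x \<in> carrier G then w x * \<phi> (x \<otimes>\<^bsub>G\<^esub> g x) else 0))"

definition is_modulation ::
  "'g tgroup \<Rightarrow> (('g \<Rightarrow> complex) \<Rightarrow> complex) \<Rightarrow> (('g \<Rightarrow> complex) \<Rightarrow> complex) \<Rightarrow> bool" where
  "is_modulation G \<nu> \<mu> \<longleftrightarrow> radon_measure G \<nu> \<and>
     (\<exists>w g. almost_periodic G additive_tgroup w \<and> almost_periodic G G g \<and>
       \<mu> = modulate G w g \<nu>)"

section \<open>Bohr compactification and extended cut-and-project schemes\<close>

text \<open>The Bohr compactification is given by its universal property, which determines it up to
  unique isomorphism. In the universal property it suffices to consider compact groups
  \<open>K\<close> in which \<open>G\<close> has dense image under \<open>h\<close>. Such groups can be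
  realised on sets of subsets of \<open>G\<close>: as \<open>K\<close> is Hausdorff, a point \<open>k\<close> is
  determined by the family of the sets \<open>h\<^sup>-\<^sup>1(V)\<close>, where \<open>V\<close> ranges over the open neighbourhoods of
  \<open>k\<close>. Hence the bound on the type of \<open>K\<close> is no loss, and a Bohr compactification exists
  on the type \<^typ>\<open>'g set set\<close>. For locally compact abelian \<open>G\<close>, characters separate points, so
  that \<open>i\<close> is injective.\<close>

definition bohr_compactification :: "'g tgroup \<Rightarrow> 'b tgroup \<Rightarrow> ('g \<Rightarrow> 'b) \<Rightarrow> bool" where
  "bohr_compactification G B i \<longleftrightarrow>
     lcag B \<and> compact_space (topo B) \<and>
     i \<in> hom G B \<and> continuous_map (topo G) (topo B) i \<and>
     topo B closure_of (i ` carrier G) = carrier B \<and>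
     (\<forall>(K :: 'g set set tgroup) h.
        lcag K \<and> compact_space (topo K) \<and> h \<in> hom G K \<and> continuous_map (topo G) (topo K) h \<longrightarrow>
        (\<exists>h'\<in>hom B K. continuous_map (topo B) (topo K) h' \<and> (\<forall>x\<in>carrier G. h' (i x) = h x)))"

definition extended_star :: "('g \<times> 'h) set \<Rightarrow> ('g \<Rightarrow> 'b) \<Rightarrow> 'g \<Rightarrow> 'h \<times> 'b" where
  "extended_star \<L>\<^sub>0 i l = (star \<L>\<^sub>0 l, i l)"

definition extended_lattice :: "('g \<times> 'h) set \<Rightarrow> ('g \<Rightarrow> 'b) \<Rightarrow> ('g \<times> 'h \<times> 'b) set" where
  "extended_lattice \<L>\<^sub>0 i = {(l, extended_star \<L>\<^sub>0 i l) |l. l \<in> fst ` \<L>\<^sub>0}"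

definition extended_internal ::
  "'h tgroup \<Rightarrow> ('g \<times> 'h) set \<Rightarrow> 'b tgroup \<Rightarrow> ('g \<Rightarrow> 'b) \<Rightarrow> ('h \<times> 'b) tgroup" where
  "extended_internal H\<^sub>0 \<L>\<^sub>0 B i = sub_tgroup (prod_tgroup H\<^sub>0 B)
     (topo (prod_tgroup H\<^sub>0 B) closure_of (extended_star \<L>\<^sub>0 i ` fst ` \<L>\<^sub>0))"

section \<open>The classes over all cut-and-project schemes\<close>

text \<open>The type argument is the type on which the internal groups are carried.\<close>

definition deformed_class ::
  "'h itself \<Rightarrow> 'g tgroup \<Rightarrow> (('g \<Rightarrow> complex) \<Rightarrow> complex) set" where
  "deformed_class _ G =
     {\<nu>. \<exists>(H :: 'h tgroup) \<L>. deformed_weighted_model_set G H \<L> \<nu>}"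

definition modulation_class ::
  "'h itself \<Rightarrow> 'g tgroup \<Rightarrow> (('g \<Rightarrow> complex) \<Rightarrow> complex) set" where
  "modulation_class _ G =
     {\<mu>. \<exists>(H :: 'h tgroup) \<L> \<nu>. weighted_model_set G H \<L> \<nu> \<and> is_modulation G \<nu> \<mu>}"

end

theory Submission
  imports Defs
begin

text \<open>A modulation of \<open>\<Sum> f(l\<^sup>\<star>) \<delta>\<^sub>l\<close> by \<open>w\<close> and \<open>g\<close> is \<open>\<Sum> f(l\<^sup>\<star>) w(l) \<delta>\<close> with the point masses moved to
  \<open>l + g(l)\<close>. It is a deformed model set as soon as \<open>w(l)\<close> and \<open>g(l)\<close> are continuous functions of
  \<open>l\<^sup>\<star>\<close>, and the extended scheme is made for that purpose: its internal group records \<open>i(l)\<close> in a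
  compactification \<open>i : G \<rightarrow> B\<close>, and an almost periodic function is the pullback of a continuous
  function on \<open>B\<close>. For the latter, the closure of the translates of an almost periodic \<open>h\<close> (its hull)
  is a compact abelian group in which \<open>G\<close> has dense image, and evaluation at the neutral element
  recovers \<open>h\<close> (\<open>almost_periodic_compactification\<close>); the universal property of the Bohr
  compactification maps \<open>B\<close> to the hull (\<open>almost_periodic_extends_to_Bohr\<close>). The rest of the first
  claim, \<open>cps_extended\<close> and \<open>modulation_deformed_in_extension\<close>, applies to every compact group \<open>B\<close>
  with a continuous homomorphism from \<open>G\<close> along which \<open>w\<close> and \<open>g\<close> are pullbacks of continuous
  functions. So for the equality of the two classes the product of the hulls of \<open>w\<close> and \<open>g\<close> can take
  the place of the Bohr compactification.

  Conversely, let a deformation \<open>p : H \<rightarrow> \<real>\<^sup>d\<close> and a weight \<open>f\<close> supported by a compact set \<open>K\<close> be given.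
  The torus \<open>T = (\<real>\<^sup>d \<times> H) / \<L>\<close> is compact, and \<open>K\<close> embeds into it by \<open>h \<mapsto> (0, -h) + \<L>\<close> because
  \<open>\<pi>\<^sup>G\<close> is one-to-one on \<open>\<L>\<close>. By Tietze's theorem, applied to the coordinates of \<open>p\<close>, there is a
  continuous \<open>P : T \<rightarrow> \<real>\<^sup>d\<close> that agrees with \<open>p\<close> on the copy of \<open>K\<close> (\<open>periodic_extension\<close>). Then
  \<open>g(x) = P((x, 0) + \<L>)\<close> is almost periodic (\<open>almost_periodic_of_periodic\<close>), and \<open>g(l) = p(l\<^sup>\<star>)\<close>
  whenever \<open>l\<^sup>\<star> \<in> K\<close>, since \<open>(l, 0)\<close> and \<open>(0, -l\<^sup>\<star>)\<close> differ by an element of \<open>\<L>\<close>. So \<open>\<Sum> f(l\<^sup>\<star>) \<delta>\<^sub>l\<close>,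
  modulated by \<open>1\<close> and \<open>g\<close>, is the given deformed model set (\<open>deformed_is_modulation\<close>).

  Finally, a point of a Hausdorff space with a dense image of \<open>S\<close> can be named by a set of subsets
  of \<open>S\<close>. This puts every internal group, and every hull, on the type of sets of subsets of \<open>G\<close>.\<close>

section \<open>Continuity and neighbourhoods in topological groups\<close>

lemma (in group) cancel_inv:
  assumes "x \<in> carrier G" "y \<in> carrier G"
  shows "x \<otimes> (inv x \<otimes> y) = y" "inv x \<otimes> (x \<otimes> y) = y"
  using assms by (simp_all flip: m_assoc)

context lcag
begin

lemma topology_mult:
  assumes "continuous_map X (topo G) f" "continuous_map X (topo G) g"
  shows "continuous_map X (topo G) (\<lambda>x. f x \<otimes> g x)"
  using continuous_map_compose[OF continuous_map_pairedI[OF assms] continuous_mult]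
  by (simp add: o_def)

lemma topology_inv:
  assumes "continuous_map X (topo G) f"
  shows "continuous_map X (topo G) (\<lambda>x. inv (f x))"
  using continuous_map_compose[OF assms continuous_inv] by (simp add: o_def)

lemma topology_const: "c \<in> carrier G \<Longrightarrow> continuous_map X (topo G) (\<lambda>_. c)"
  by (simp add: topspace_topo)

lemma topology_id: "continuous_map (topo G) (topo G) (\<lambda>x. x)"
  using continuous_map_id[of "topo G"] by (simp add: id_def)

lemmas topology_intros = topology_mult topology_inv topology_const topology_id

lemma openin_subset_carrier: "openin (topo G) U \<Longrightarrow> U \<subseteq> carrier G"
  using openin_subset topspace_topo by blast

lemma compactin_subset_carrier: "compactin (topo G) K \<Longrightarrow> K \<subseteq> carrier G"
  using compactin_subset_topspace topspace_topo by blast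

lemma openin_preimage:
  assumes "continuous_map (topo G) (topo G) f" "openin (topo G) U"
  shows "openin (topo G) {x \<in> carrier G. f x \<in> U}"
  using openin_continuous_map_preimage[OF assms] by (simp add: topspace_topo)

lemma neighbourhood_halving:
  assumes V: "openin (topo G) V" "\<one> \<in> V"
  obtains W where "openin (topo G) W" "\<one> \<in> W" "\<And>x. x \<in> W \<Longrightarrow> inv x \<in> W"
    "\<And>x y. x \<in> W \<Longrightarrow> y \<in> W \<Longrightarrow> x \<otimes> y \<in> V"
proof -
  let ?P = "{z \<in> topspace (prod_topology (topo G) (topo G)). (\<lambda>(x, y). x \<otimes> y) z \<in> V}"
  have "openin (prod_topology (topo G) (topo G)) ?P"
    by (rule openin_continuous_map_preimage[OF continuous_mult V(1)])
  moreover have "(\<one>, \<one>) \<in> ?P" using V by (simp add: topspace_topo)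
  ultimately obtain S T where ST: "openin (topo G) S" "openin (topo G) T" "\<one> \<in> S" "\<one> \<in> T"
    "S \<times> T \<subseteq> ?P"
    unfolding openin_prod_topology_alt by meson
  define R where "R = S \<inter> T"
  define W where "W = R \<inter> {x \<in> carrier G. inv x \<in> R}"
  have R: "openin (topo G) R" "\<one> \<in> R" using ST by (auto simp: R_def)
  show ?thesis
  proof
    show "openin (topo G) W" unfolding W_def
      by (intro openin_Int R openin_preimage topology_intros)
    show "\<one> \<in> W" using R by (simp add: W_def)
    show "inv x \<in> W" if "x \<in> W" for x using that by (auto simp: W_def)
    show "x \<otimes> y \<in> V" if "x \<in> W" "y \<in> W" for x y
      using that ST(5) by (auto simp: W_def R_def)
  qed
qed

lemma compactin_mult:
  assumes "compactin (topo G) K" "compactin (topo G) L"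
  shows "compactin (topo G) ((\<lambda>(x, y). x \<otimes> y) ` (K \<times> L))"
  by (intro image_compactin[OF _ continuous_mult]) (simp add: compactin_Times assms)

lemma compactin_inv:
  assumes "compactin (topo G) K"
  shows "compactin (topo G) ((\<lambda>x. inv x) ` K)"
  by (rule image_compactin[OF assms continuous_inv])

lemma separate_in_neighbourhood:
  assumes "x \<in> carrier G" "y \<in> carrier G" "x \<noteq> y"
  obtains V where "openin (topo G) V" "\<one> \<in> V" "x \<otimes> inv y \<notin> V"
proof
  have "closedin (topo G) {x \<otimes> inv y}"
    using assms by (intro closedin_Hausdorff_singleton Hausdorff) (simp add: topspace_topo)
  then show "openin (topo G) (carrier G - {x \<otimes> inv y})"
    using openin_diff topspace_topo by (metis openin_topspace)
  have "x \<otimes> inv y \<noteq> \<one>" using assms by (metis inv_solve_right' l_one one_closed)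
  then show "\<one> \<in> carrier G - {x \<otimes> inv y}" by auto
qed auto

lemma subgroup_closure:
  assumes "subgroup S G"
  shows "subgroup (topo G closure_of S) G"
proof
  have S: "S \<subseteq> carrier G" using assms by (rule subgroup.subset)
  show "topo G closure_of S \<subseteq> carrier G"
    using closure_of_subset_topspace topspace_topo by metis
  show "\<one> \<in> topo G closure_of S"
    using closure_of_subset[of S "topo G"] S subgroup.one_closed[OF assms]
    by (auto simp: topspace_topo)
  show "x \<otimes> y \<in> topo G closure_of S"
    if "x \<in> topo G closure_of S" "y \<in> topo G closure_of S" for x y
  proof -
    have "(x, y) \<in> prod_topology (topo G) (topo G) closure_of (S \<times> S)"
      using that by (simp add: closure_of_Times)
    then have "(\<lambda>(x, y). x \<otimes> y) (x, y) \<in>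
        topo G closure_of ((\<lambda>(x, y). x \<otimes> y) ` (S \<times> S))"
      using continuous_map_image_closure_subset[OF continuous_mult, of "S \<times> S"] by blast
    moreover have "(\<lambda>(x, y). x \<otimes> y) ` (S \<times> S) \<subseteq> S"
      using subgroup.m_closed[OF assms] by auto
    ultimately show ?thesis using closure_of_mono by fastforce
  qed
  show "inv x \<in> topo G closure_of S" if "x \<in> topo G closure_of S" for x
  proof -
    have "inv x \<in> topo G closure_of ((\<lambda>x. inv x) ` S)"
      using continuous_map_image_closure_subset[OF continuous_inv, of S] that by blast
    moreover have "(\<lambda>x. inv x) ` S \<subseteq> S" using subgroup.m_inv_closed[OF assms] by auto
    ultimately show ?thesis using closure_of_mono by fastforce
  qed
qed

end

lemma prod_tgroup_simps [simp]:
  "carrier (prod_tgroup A B) = carrier A \<times> carrier B"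
  "\<one>\<^bsub>prod_tgroup A B\<^esub> = (\<one>\<^bsub>A\<^esub>, \<one>\<^bsub>B\<^esub>)"
  "(a, b) \<otimes>\<^bsub>prod_tgroup A B\<^esub> (a', b') = (a \<otimes>\<^bsub>A\<^esub> a', b \<otimes>\<^bsub>B\<^esub> b')"
  "topo (prod_tgroup A B) = prod_topology (topo A) (topo B)"
  by (simp_all add: prod_tgroup_def)

lemma comm_group_prod_tgroup:
  assumes "comm_group A" "comm_group B"
  shows "comm_group (prod_tgroup A B)"
proof -
  interpret A: comm_group A by fact
  interpret B: comm_group B by fact
  show ?thesis
  proof (rule comm_groupI)
    fix x assume "x \<in> carrier (prod_tgroup A B)"
    then show "\<exists>y\<in>carrier (prod_tgroup A B). y \<otimes>\<^bsub>prod_tgroup A B\<^esub> x = \<one>\<^bsub>prod_tgroup A B\<^esub>"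
      by (intro bexI[of _ "(inv\<^bsub>A\<^esub> fst x, inv\<^bsub>B\<^esub> snd x)"]) auto
  qed (auto simp: A.m_ac B.m_ac)
qed

lemma inv_prod_tgroup:
  assumes "comm_group A" "comm_group B" "a \<in> carrier A" "b \<in> carrier B"
  shows "inv\<^bsub>prod_tgroup A B\<^esub> (a, b) = (inv\<^bsub>A\<^esub> a, inv\<^bsub>B\<^esub> b)"
proof -
  interpret A: comm_group A by fact
  interpret B: comm_group B by fact
  interpret P: comm_group "prod_tgroup A B" using assms by (intro comm_group_prod_tgroup)
  show ?thesis using assms by (intro P.inv_equality) auto
qed

lemma lcag_prod_tgroup:
  assumes "lcag A" "lcag B"
  shows "lcag (prod_tgroup A B)"
proof -
  interpret A: lcag A by fact
  interpret B: lcag B by fact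
  interpret P: comm_group "prod_tgroup A B" by (intro comm_group_prod_tgroup) unfold_locales
  let ?T = "prod_topology (topo A) (topo B)"
  have 1: "continuous_map ?T (topo A) fst" "continuous_map ?T (topo B) snd"
    by (simp_all add: continuous_map_fst continuous_map_snd)
  have 2: "continuous_map (prod_topology ?T ?T) (topo A) (\<lambda>z. fst (fst z))"
    "continuous_map (prod_topology ?T ?T) (topo A) (\<lambda>z. fst (snd z))"
    "continuous_map (prod_topology ?T ?T) (topo B) (\<lambda>z. snd (fst z))"
    "continuous_map (prod_topology ?T ?T) (topo B) (\<lambda>z. snd (snd z))"
    using continuous_map_compose[OF continuous_map_fst 1(1), of ?T]
      continuous_map_compose[OF continuous_map_snd 1(1), of ?T]
      continuous_map_compose[OF continuous_map_fst 1(2), of ?T]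
      continuous_map_compose[OF continuous_map_snd 1(2), of ?T]
    by (simp_all add: o_def)
  show ?thesis
  proof
    show "topspace (topo (prod_tgroup A B)) = carrier (prod_tgroup A B)"
      by (simp add: A.topspace_topo B.topspace_topo)
    have "continuous_map (prod_topology ?T ?T) ?T
        (\<lambda>z. (fst (fst z) \<otimes>\<^bsub>A\<^esub> fst (snd z), snd (fst z) \<otimes>\<^bsub>B\<^esub> snd (snd z)))"
      by (intro continuous_map_pairedI A.topology_mult B.topology_mult 2)
    then show "continuous_map (prod_topology (topo (prod_tgroup A B)) (topo (prod_tgroup A B)))
        (topo (prod_tgroup A B)) (\<lambda>(x, y). x \<otimes>\<^bsub>prod_tgroup A B\<^esub> y)"
      by (simp add: case_prod_beta' prod_tgroup_def DirProd_def)
    have "continuous_map ?T ?T (\<lambda>z. (inv\<^bsub>A\<^esub> fst z, inv\<^bsub>B\<^esub> snd z))"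
      by (intro continuous_map_pairedI A.topology_inv B.topology_inv 1)
    then have "continuous_map ?T ?T (\<lambda>z. inv\<^bsub>prod_tgroup A B\<^esub> z)"
      by (rule continuous_map_eq)
        (auto simp: inv_prod_tgroup A.comm_group_axioms B.comm_group_axioms
            A.topspace_topo B.topspace_topo)
    then show "continuous_map (topo (prod_tgroup A B)) (topo (prod_tgroup A B))
        (\<lambda>z. inv\<^bsub>prod_tgroup A B\<^esub> z)"
      by simp
    show "Hausdorff_space (topo (prod_tgroup A B))"
      by (simp add: Hausdorff_space_prod_topology A.Hausdorff B.Hausdorff)
    show "locally_compact_space (topo (prod_tgroup A B))"
      by (simp add: locally_compact_space_prod_topology A.locally_compact B.locally_compact)
  qed
qed

lemma sub_tgroup_simps [simp]:
  "carrier (sub_tgroup A S) = S"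
  "\<one>\<^bsub>sub_tgroup A S\<^esub> = \<one>\<^bsub>A\<^esub>"
  "x \<otimes>\<^bsub>sub_tgroup A S\<^esub> y = x \<otimes>\<^bsub>A\<^esub> y"
  "topo (sub_tgroup A S) = subtopology (topo A) S"
  by (simp_all add: sub_tgroup_def)

lemma lcag_sub_tgroup:
  assumes "lcag A" and sub: "subgroup S A" and S: "closedin (topo A) S"
  shows "lcag (sub_tgroup A S)"
proof -
  interpret A: lcag A by fact
  have SA: "S \<subseteq> carrier A" using sub by (rule subgroup.subset)
  interpret comm_group "sub_tgroup A S"
  proof (rule comm_groupI)
    fix x assume x: "x \<in> carrier (sub_tgroup A S)"
    then show "\<exists>y\<in>carrier (sub_tgroup A S). y \<otimes>\<^bsub>sub_tgroup A S\<^esub> x = \<one>\<^bsub>sub_tgroup A S\<^esub>"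
      using SA by (intro bexI[of _ "inv\<^bsub>A\<^esub> x"]) (auto simp: subgroup.m_inv_closed[OF sub])
  qed (use SA in \<open>auto simp: subgroup.m_closed[OF sub] subgroup.one_closed[OF sub] A.m_ac
        subset_iff\<close>)
  have inv: "inv\<^bsub>sub_tgroup A S\<^esub> x = inv\<^bsub>A\<^esub> x" if "x \<in> S" for x
    using that SA by (intro inv_equality) (auto simp: subgroup.m_inv_closed[OF sub])
  have top: "topspace (subtopology (topo A) S) = S"
    using SA by (auto simp: A.topspace_topo)
  show ?thesis
  proof
    show "continuous_map (prod_topology (topo (sub_tgroup A S)) (topo (sub_tgroup A S)))
        (topo (sub_tgroup A S)) (\<lambda>(x, y). x \<otimes>\<^bsub>sub_tgroup A S\<^esub> y)"
      using continuous_map_from_subtopology[OF A.continuous_mult, of "S \<times> S"] SA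
      by (auto simp: continuous_map_in_subtopology A.topspace_topo
          subgroup.m_closed[OF sub] simp flip: subtopology_Times)
    have "continuous_map (subtopology (topo A) S) (subtopology (topo A) S) (\<lambda>x. inv\<^bsub>A\<^esub> x)"
      using continuous_map_from_subtopology[OF A.continuous_inv, of "S"]
      by (auto simp: continuous_map_in_subtopology subgroup.m_inv_closed[OF sub])
    then show "continuous_map (topo (sub_tgroup A S)) (topo (sub_tgroup A S))
        (\<lambda>x. inv\<^bsub>sub_tgroup A S\<^esub> x)"
      by (simp, rule continuous_map_eq) (auto simp: inv)
    show "Hausdorff_space (topo (sub_tgroup A S))"
      by (simp add: Hausdorff_space_subtopology A.Hausdorff)
    show "locally_compact_space (topo (sub_tgroup A S))"
      by (simp add: locally_compact_space_closed_subset A.locally_compact S)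
  qed (use top in simp)
qed

section \<open>Lattices\<close>

text \<open>Two points of a discrete subgroup that are close to each other are equal; hence the subgroup
  has no accumulation point.\<close>

lemma (in lcag) discrete_subgroup_closed:
  assumes L: "subgroup L G" and U: "openin (topo G) U" "\<one> \<in> U" "U \<inter> L \<subseteq> {\<one>}"
  shows "closedin (topo G) L"
proof -
  have LG: "L \<subseteq> carrier G" using L by (rule subgroup.subset)
  obtain W where W: "openin (topo G) W" "\<one> \<in> W" "\<And>x. x \<in> W \<Longrightarrow> inv x \<in> W"
    "\<And>x y. x \<in> W \<Longrightarrow> y \<in> W \<Longrightarrow> x \<otimes> y \<in> U"
    using neighbourhood_halving[OF U(1,2)] by metis
  have WG: "W \<subseteq> carrier G" using W(1) by (rule openin_subset_carrier)
  have "x \<in> L" if x: "x \<in> topo G closure_of L" for x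
  proof (rule ccontr)
    assume "x \<notin> L"
    have xG: "x \<in> carrier G" using x by (simp add: in_closure_of topspace_topo)
    define N where "N = {y \<in> carrier G. inv x \<otimes> y \<in> W}"
    have N: "openin (topo G) N" unfolding N_def
      using xG by (intro openin_preimage topology_intros W) auto
    have "x \<in> N" using xG W by (simp add: N_def)
    have meets: "\<exists>y\<in>L. y \<in> T" if "x \<in> T" "openin (topo G) T" for T
      using x that by (auto simp: in_closure_of)
    obtain l where l: "l \<in> L" "l \<in> N" using meets[OF \<open>x \<in> N\<close> N] by blast
    have "openin (topo G) (N - {l})"
      using N l LG by (intro openin_diff closedin_Hausdorff_singleton Hausdorff)
        (auto simp: topspace_topo)
    moreover have "x \<in> N - {l}" using \<open>x \<in> N\<close> \<open>x \<notin> L\<close> l by auto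
    ultimately obtain k where k: "k \<in> L" "k \<in> N" "k \<noteq> l"
      using meets[of "N - {l}"] by auto
    have kl: "k \<in> carrier G" "l \<in> carrier G" using k l LG by auto
    have "inv (inv x \<otimes> l) \<otimes> (inv x \<otimes> k) \<in> U" 
      using k l by (intro W(4)[OF W(3)]) (simp_all add: N_def)
    moreover have "inv (inv x \<otimes> l) \<otimes> (inv x \<otimes> k) = inv l \<otimes> k"
      using kl xG by (simp add: inv_mult_group m_assoc cancel_inv)
    moreover have "inv l \<otimes> k \<in> L"
      using k l by (simp add: subgroup.m_closed[OF L] subgroup.m_inv_closed[OF L])
    ultimately have "inv l \<otimes> k = \<one>" using U(3) by auto
    then show False using kl k(3) by (metis inv_closed inv_equality inv_inv)
  qed
  then have "topo G closure_of L = L"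
    using closure_of_subset[of L "topo G"] LG by (auto simp: topspace_topo)
  then show ?thesis by (simp add: closure_of_eq)
qed

lemma (in lcag) discrete_subgroup_iff:
  assumes L: "subgroup L G"
  shows "subtopology (topo G) L = discrete_topology L \<longleftrightarrow>
    (\<exists>U. openin (topo G) U \<and> \<one> \<in> U \<and> U \<inter> L \<subseteq> {\<one>})"
proof
  have LG: "L \<subseteq> carrier G" using L by (rule subgroup.subset)
  {
    assume "subtopology (topo G) L = discrete_topology L"
    moreover have "\<one> \<in> L" by (rule subgroup.one_closed[OF L])
    ultimately have "openin (subtopology (topo G) L) {\<one>}" by simp
    then show "\<exists>U. openin (topo G) U \<and> \<one> \<in> U \<and> U \<inter> L \<subseteq> {\<one>}"
      by (auto simp: openin_subtopology)
  next
    assume "\<exists>U. openin (topo G) U \<and> \<one> \<in> U \<and> U \<inter> L \<subseteq> {\<one>}"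
    then obtain U where U: "openin (topo G) U" "\<one> \<in> U" "U \<inter> L \<subseteq> {\<one>}" by blast
    have "openin (subtopology (topo G) L) {l}" if l: "l \<in> L" for l
    proof -
      have lG: "l \<in> carrier G" using l LG by auto
      have "openin (topo G) {y \<in> carrier G. inv l \<otimes> y \<in> U}"
        using lG by (intro openin_preimage topology_intros U) auto
      moreover have "{l} = {y \<in> carrier G. inv l \<otimes> y \<in> U} \<inter> L"
      proof -
        have "y = l" if y: "y \<in> L" "inv l \<otimes> y \<in> U" for y
        proof -
          have "inv l \<otimes> y \<in> L"
            using y l by (simp add: subgroup.m_closed[OF L] subgroup.m_inv_closed[OF L])
          then have "inv l \<otimes> y = \<one>" using U(3) y by auto
          then show ?thesis using lG y LG by (metis inv_closed inv_equality inv_inv subsetD)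
        qed
        then show ?thesis using l lG U by auto
      qed
      ultimately show ?thesis unfolding openin_subtopology by blast
    qed
    then show "subtopology (topo G) L = discrete_topology L"
      using LG by (subst eq_commute, subst discrete_topology_unique) (auto simp: topspace_topo)
  }
qed


lemma (in group) coset_eq_iff:
  assumes L: "subgroup L G" and "x \<in> carrier G" "y \<in> carrier G"
  shows "L #> x = L #> y \<longleftrightarrow> x \<otimes> inv y \<in> L"
proof
  assume "L #> x = L #> y"
  then obtain l where "l \<in> L" "x = l \<otimes> y"
    using rcos_self[OF assms(2) L] by (auto simp: r_coset_def)
  then show "x \<otimes> inv y \<in> L" using assms subgroup.mem_carrier[OF L] by (simp add: m_assoc)
next
  assume "x \<otimes> inv y \<in> L"
  then have "x \<otimes> inv y \<otimes> y \<in> L #> y" by (auto simp: r_coset_def)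
  then have "x \<in> L #> y" using assms by (simp add: m_assoc)
  then show "L #> x = L #> y" using repr_independence[OF _ assms(3) L] by simp
qed

lemma openin_coset_image:
  assumes A: "lcag A" and L: "subgroup L A" and U: "openin (topo A) U"
  shows "openin (quotient_topology (topo A) (\<lambda>x. L #>\<^bsub>A\<^esub> x)) ((\<lambda>x. L #>\<^bsub>A\<^esub> x) ` U)"
proof -
  interpret A: lcag A by fact
  let ?q = "\<lambda>x. L #>\<^bsub>A\<^esub> x"
  have LA: "L \<subseteq> carrier A" using L by (rule subgroup.subset)
  have UA: "U \<subseteq> carrier A" using U by (rule A.openin_subset_carrier)
  have "{x \<in> carrier A. ?q x \<in> ?q ` U} = (\<Union>l\<in>L. {x \<in> carrier A. l \<otimes>\<^bsub>A\<^esub> x \<in> U})"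
  proof (intro equalityI subsetI)
    fix x assume "x \<in> {x \<in> carrier A. ?q x \<in> ?q ` U}"
    then obtain u where u: "x \<in> carrier A" "u \<in> U" "?q u = ?q x" by auto
    then have "u \<in> ?q x" using A.rcos_self[OF _ L, of u] UA by auto
    then obtain l where "l \<in> L" "u = l \<otimes>\<^bsub>A\<^esub> x" by (auto simp: r_coset_def)
    then show "x \<in> (\<Union>l\<in>L. {x \<in> carrier A. l \<otimes>\<^bsub>A\<^esub> x \<in> U})" using u by blast
  next
    fix x assume "x \<in> (\<Union>l\<in>L. {x \<in> carrier A. l \<otimes>\<^bsub>A\<^esub> x \<in> U})"
    then obtain l where l: "x \<in> carrier A" "l \<in> L" "l \<otimes>\<^bsub>A\<^esub> x \<in> U" by auto
    then have "l \<otimes>\<^bsub>A\<^esub> x \<in> ?q x" by (auto simp: r_coset_def)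
    then have "?q x = ?q (l \<otimes>\<^bsub>A\<^esub> x)" using l by (intro A.repr_independence L)
    then show "x \<in> {x \<in> carrier A. ?q x \<in> ?q ` U}" using l by blast
  qed
  moreover have "openin (topo A) (\<Union>l\<in>L. {x \<in> carrier A. l \<otimes>\<^bsub>A\<^esub> x \<in> U})"
    using LA by (intro openin_Union) (auto intro!: A.openin_preimage A.topology_intros U)
  ultimately show ?thesis
    using UA by (auto simp: openin_quotient_topology A.topspace_topo)
qed

text \<open>The quotient map is open, so a cover of the compact quotient by images of relatively compact
  open sets has a finite subcover; this is how local compactness yields a compact set of
  representatives.\<close>

lemma compact_quotient_iff:
  fixes A :: "'a tgroup"
  assumes A: "lcag A" and L: "subgroup L A"
  shows "compact_space (quotient_topology (topo A) (\<lambda>x. L #>\<^bsub>A\<^esub> x)) \<longleftrightarrow>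
    (\<exists>C. compactin (topo A) C \<and> (\<forall>x\<in>carrier A. \<exists>l\<in>L. \<exists>c\<in>C. x = l \<otimes>\<^bsub>A\<^esub> c))"
proof
  interpret A: lcag A by fact
  let ?q = "\<lambda>x. L #>\<^bsub>A\<^esub> x"
  let ?Q = "quotient_topology (topo A) ?q"
  have LA: "L \<subseteq> carrier A" using L by (rule subgroup.subset)
  have q: "quotient_map (topo A) ?Q ?q" by (rule quotient_map_quotient_topology)
  have Q: "topspace ?Q = ?q ` carrier A"
    using quotient_imp_surjective_map[OF q] by (simp add: A.topspace_topo)
  {
    assume "\<exists>C. compactin (topo A) C \<and> (\<forall>x\<in>carrier A. \<exists>l\<in>L. \<exists>c\<in>C. x = l \<otimes>\<^bsub>A\<^esub> c)"
    then obtain C where C: "compactin (topo A) C"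
      "\<And>x. x \<in> carrier A \<Longrightarrow> \<exists>l\<in>L. \<exists>c\<in>C. x = l \<otimes>\<^bsub>A\<^esub> c"
      by blast
    have CA: "C \<subseteq> carrier A" using C(1) by (rule A.compactin_subset_carrier)
    have "?q x \<in> ?q ` C" if x: "x \<in> carrier A" for x
    proof -
      obtain l c where lc: "l \<in> L" "c \<in> C" "x = l \<otimes>\<^bsub>A\<^esub> c" using C(2)[OF x] by blast
      then have "x \<in> ?q c" by (auto simp: r_coset_def)
      then have "?q c = ?q x" using CA lc by (intro A.repr_independence L) auto
      then show ?thesis using lc by blast
    qed
    then have "?q ` carrier A \<subseteq> ?q ` C" by (rule image_subsetI)
    then have "topspace ?Q = ?q ` C" unfolding Q using image_mono[OF CA] by (rule equalityI)
    moreover have "compactin ?Q (?q ` C)"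
      by (rule image_compactin[OF C(1) quotient_imp_continuous_map[OF q]])
    ultimately show "compact_space ?Q" by (simp add: compact_space_def)
  next
    assume compact: "compact_space ?Q"
    define \<U> where "\<U> = {U. openin (topo A) U \<and> (\<exists>K. compactin (topo A) K \<and> U \<subseteq> K)}"
    have "openin ?Q (?q ` U)" if "U \<in> \<U>" for U
      using that unfolding \<U>_def by (auto intro: openin_coset_image[OF A L])
    moreover have "topspace ?Q \<subseteq> \<Union> ((\<lambda>U. ?q ` U) ` \<U>)"
    proof
      fix y assume "y \<in> topspace ?Q"
      then obtain x where x: "x \<in> carrier A" "y = ?q x" using Q by auto
      then obtain U K where "openin (topo A) U" "compactin (topo A) K" "x \<in> U" "U \<subseteq> K"
        using A.locally_compact unfolding locally_compact_space_def A.topspace_topo by meson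
      then show "y \<in> \<Union> ((\<lambda>U. ?q ` U) ` \<U>)" using x unfolding \<U>_def by blast
    qed
    ultimately obtain \<F> where \<F>: "finite \<F>" "\<F> \<subseteq> (\<lambda>U. ?q ` U) ` \<U>" "topspace ?Q \<subseteq> \<Union>\<F>"
      using compact unfolding compact_space_alt by (metis (no_types, lifting) imageE)
    obtain \<V> where \<V>: "finite \<V>" "\<V> \<subseteq> \<U>" "\<F> = (\<lambda>U. ?q ` U) ` \<V>"
      using finite_subset_image[OF \<F>(1,2)] by blast
    have "\<forall>U\<in>\<V>. \<exists>K. compactin (topo A) K \<and> U \<subseteq> K" using \<V> unfolding \<U>_def by blast
    then obtain k where k: "\<And>U. U \<in> \<V> \<Longrightarrow> compactin (topo A) (k U) \<and> U \<subseteq> k U" by metis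
    have "\<exists>l\<in>L. \<exists>c\<in>\<Union> (k ` \<V>). x = l \<otimes>\<^bsub>A\<^esub> c" if x: "x \<in> carrier A" for x
    proof -
      have "?q x \<in> topspace ?Q" using x Q by blast
      then obtain U c where U: "U \<in> \<V>" "c \<in> U" "?q x = ?q c" using \<F>(3) \<V>(3) by blast
      have "x \<in> ?q c" using A.rcos_self[OF x L] U by simp
      then obtain l where "l \<in> L" "x = l \<otimes>\<^bsub>A\<^esub> c" by (auto simp: r_coset_def)
      then show ?thesis using U k by blast
    qed
    moreover have "compactin (topo A) (\<Union> (k ` \<V>))"
      using \<V>(1) k by (intro compactin_Union) auto
    ultimately show "\<exists>C. compactin (topo A) C \<and>
        (\<forall>x\<in>carrier A. \<exists>l\<in>L. \<exists>c\<in>C. x = l \<otimes>\<^bsub>A\<^esub> c)" by blast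
  }
qed

text \<open>A criterion in terms of one neighbourhood and one compact set of representatives, which is easy to
  transfer from one group to another.\<close>

lemma lattice_in_iff:
  assumes "lcag A"
  shows "lattice_in L A \<longleftrightarrow> subgroup L A \<and>
    (\<exists>U. openin (topo A) U \<and> \<one>\<^bsub>A\<^esub> \<in> U \<and> U \<inter> L \<subseteq> {\<one>\<^bsub>A\<^esub>}) \<and>
    (\<exists>C. compactin (topo A) C \<and> (\<forall>x\<in>carrier A. \<exists>l\<in>L. \<exists>c\<in>C. x = l \<otimes>\<^bsub>A\<^esub> c))"
  unfolding lattice_in_def
  using lcag.discrete_subgroup_iff[OF assms, of L] compact_quotient_iff[OF assms, of L] by blast

lemma lattice_closed:
  assumes "lcag A" "lattice_in L A"
  shows "closedin (topo A) L"
  using assms lcag.discrete_subgroup_closed[OF assms(1)] by (auto simp: lattice_in_iff)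

lemma finite_lattice_Int_compact:
  assumes A: "lcag A" and L: "lattice_in L A" and C: "compactin (topo A) C"
  shows "finite (L \<inter> C)"
proof -
  have "compactin (topo A) (C \<inter> L)" by (rule compact_Int_closedin[OF C lattice_closed[OF A L]])
  then have "compactin (subtopology (topo A) L) (C \<inter> L)" by (simp add: compactin_subtopology)
  then show ?thesis
    using L by (simp add: lattice_in_def compactin_discrete_topology Int_commute)
qed

text \<open>The graph \<open>x y\<^sup>-\<^sup>1 \<in> L\<close> of the orbit relation is closed, and an open quotient map by a closed
  relation separates points.\<close>

lemma Hausdorff_quotient:
  assumes A: "lcag A" and L: "subgroup L A" and closed: "closedin (topo A) L"
  shows "Hausdorff_space (quotient_topology (topo A) (\<lambda>x. L #>\<^bsub>A\<^esub> x))"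
  unfolding Hausdorff_space_def
proof (intro allI impI)
  interpret A: lcag A by fact
  let ?q = "\<lambda>x. L #>\<^bsub>A\<^esub> x"
  let ?Q = "quotient_topology (topo A) ?q"
  let ?T = "prod_topology (topo A) (topo A)"
  have Q: "topspace ?Q = ?q ` carrier A"
    using quotient_imp_surjective_map[OF quotient_map_quotient_topology] A.topspace_topo by metis
  fix a b assume ab: "a \<in> topspace ?Q \<and> b \<in> topspace ?Q \<and> a \<noteq> b"
  then obtain x y where xy: "x \<in> carrier A" "y \<in> carrier A" "a = ?q x" "b = ?q y"
    using Q by auto
  define R where "R = {z \<in> topspace ?T. fst z \<otimes>\<^bsub>A\<^esub> inv\<^bsub>A\<^esub> snd z \<in> carrier A - L}"
  have "continuous_map ?T (topo A) (\<lambda>z. fst z \<otimes>\<^bsub>A\<^esub> inv\<^bsub>A\<^esub> snd z)"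
    by (intro A.topology_intros continuous_map_fst continuous_map_snd)
  moreover have "openin (topo A) (carrier A - L)"
    using closed A.topspace_topo by (metis openin_diff openin_topspace)
  ultimately have "openin ?T R" unfolding R_def by (rule openin_continuous_map_preimage)
  have sep: "s \<otimes>\<^bsub>A\<^esub> inv\<^bsub>A\<^esub> t \<notin> L \<longleftrightarrow> ?q s \<noteq> ?q t" if "s \<in> carrier A" "t \<in> carrier A" for s t
    using A.coset_eq_iff[OF L] that by blast
  have "(x, y) \<in> R" using xy ab sep[of x y] by (simp add: R_def A.topspace_topo)
  then obtain M N where MN: "openin (topo A) M" "openin (topo A) N" "x \<in> M" "y \<in> N" "M \<times> N \<subseteq> R"
    using \<open>openin ?T R\<close> unfolding openin_prod_topology_alt by meson
  have "?q s \<noteq> ?q t" if "s \<in> M" "t \<in> N" for s t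
  proof -
    have "(s, t) \<in> R" using MN(5) that by blast
    then show ?thesis using sep[of s t] by (simp add: R_def A.topspace_topo)
  qed
  then have "disjnt (?q ` M) (?q ` N)" unfolding disjnt_def by blast
  then show "\<exists>U V. openin ?Q U \<and> openin ?Q V \<and> a \<in> U \<and> b \<in> V \<and> disjnt U V"
    using MN xy openin_coset_image[OF A L MN(1)] openin_coset_image[OF A L MN(2)] by blast
qed


section \<open>Deformed weighted model sets\<close>

lemma cpsD:
  assumes "cps G H L"
  shows "lcag G" "lcag H" "lcag (prod_tgroup G H)" "lattice_in L (prod_tgroup G H)"
    "subgroup L (prod_tgroup G H)" "inj_on fst L" "topo H closure_of (snd ` L) = carrier H"
  using assms by (auto simp: cps_def lattice_in_def lcag_prod_tgroup)

lemma star_eq: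
  assumes "inj_on fst L" "(l, h) \<in> L"
  shows "star L l = h"
  unfolding star_def
proof (rule the_equality)
  show "y = h" if "(l, y) \<in> L" for y using inj_onD[OF assms(1) _ that assms(2)] by simp
qed fact

lemma star_mem:
  assumes "inj_on fst L" "l \<in> fst ` L"
  shows "(l, star L l) \<in> L"
  using assms star_eq by fastforce

lemma cps_star_closed:
  assumes "cps G H L" "l \<in> fst ` L"
  shows "l \<in> carrier G" "star L l \<in> carrier H"
  using star_mem[OF cpsD(6)[OF assms(1)] assms(2)] subgroup.subset[OF cpsD(5)[OF assms(1)]]
  by auto

lemma continuous_map_complex_mult:
  fixes f g :: "'a \<Rightarrow> complex"
  assumes "continuous_map X euclidean f" "continuous_map X euclidean g"
  shows "continuous_map X euclidean (\<lambda>x. f x * g x)"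
  using assms by (simp add: continuous_map_atin tendsto_mult)

lemma Cc_support_Un:
  assumes "\<phi> \<in> Cc A" "\<psi> \<in> Cc A"
  obtains K where "compactin (topo A) K" "\<And>x. x \<notin> K \<Longrightarrow> \<phi> x = 0" "\<And>x. x \<notin> K \<Longrightarrow> \<psi> x = 0"
proof -
  obtain K1 K2 where "compactin (topo A) K1" "\<forall>x. x \<notin> K1 \<longrightarrow> \<phi> x = 0"
    "compactin (topo A) K2" "\<forall>x. x \<notin> K2 \<longrightarrow> \<psi> x = 0"
    using assms by (auto simp: Cc_def)
  then show ?thesis by (intro that[of "K1 \<union> K2"]) (auto intro: compactin_Un)
qed

lemma Cc_add:
  assumes "\<phi> \<in> Cc A" "\<psi> \<in> Cc A"
  shows "(\<lambda>x. \<phi> x + \<psi> x) \<in> Cc A"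
proof -
  obtain K where "compactin (topo A) K" "\<And>x. x \<notin> K \<Longrightarrow> \<phi> x = 0" "\<And>x. x \<notin> K \<Longrightarrow> \<psi> x = 0"
    using Cc_support_Un[OF assms] by metis
  then show ?thesis using assms by (auto simp: Cc_def intro!: continuous_map_add exI[of _ K])
qed

lemma Cc_scale:
  assumes "\<phi> \<in> Cc A"
  shows "(\<lambda>x. c * \<phi> x) \<in> Cc A"
  using assms by (auto simp: Cc_def intro!: continuous_map_complex_mult)

text \<open>A point \<open>l\<close> that contributes satisfies \<open>l\<^sup>\<star> \<in> K\<close> and \<open>l \<in> C - p(K)\<close>, which confines
  \<open>(l, l\<^sup>\<star>)\<close> to a compact set. The finite set of these points does not depend on the test function
  carried by \<open>C\<close>; this uniformity is what makes the comb a Radon measure.\<close>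

lemma deformed_comb_finite_sum:
  assumes cps: "cps G H L" and p: "continuous_map (topo H) (topo G) p"
    and K: "compactin (topo H) K" "\<forall>h. h \<notin> K \<longrightarrow> f h = 0" and C: "compactin (topo G) C"
  shows "\<exists>F. \<forall>\<phi>\<in>Cc G. (\<forall>x. x \<notin> C \<longrightarrow> \<phi> x = 0) \<longrightarrow>
    deformed_comb G L f p \<phi> = (\<Sum>l\<in>F. f (star L l) * \<phi> (l \<otimes>\<^bsub>G\<^esub> p (star L l)))"
proof -
  interpret G: lcag G using cpsD[OF cps] by blast
  interpret H: lcag H using cpsD[OF cps] by blast
  define D where "D = (\<lambda>(x, y). x \<otimes>\<^bsub>G\<^esub> y) ` (C \<times> (\<lambda>x. inv\<^bsub>G\<^esub> x) ` p ` K)"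
  have "compactin (topo G) D" unfolding D_def
    by (intro G.compactin_mult G.compactin_inv image_compactin[OF K(1) p] C)
  then have "compactin (topo (prod_tgroup G H)) (D \<times> K)" by (simp add: compactin_Times K)
  then have fin: "finite (L \<inter> (D \<times> K))"
    by (rule finite_lattice_Int_compact[OF cpsD(3,4)[OF cps]])
  define F where "F = fst ` (L \<inter> (D \<times> K))"
  have F: "finite F" "F \<subseteq> fst ` L" using fin by (auto simp: F_def)
  show ?thesis
  proof (intro exI[of _ F] ballI impI)
    fix \<phi> assume \<phi>: "\<phi> \<in> Cc G" "\<forall>x. x \<notin> C \<longrightarrow> \<phi> x = 0"
    have "f (star L l) * \<phi> (l \<otimes>\<^bsub>G\<^esub> p (star L l)) = 0" if l: "l \<in> fst ` L - F" for l
    proof (rule ccontr)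
      assume "\<not> ?thesis"
      then have star: "star L l \<in> K" and "l \<otimes>\<^bsub>G\<^esub> p (star L l) \<in> C"
        using K(2) \<phi>(2) by auto
      moreover have lL: "(l, star L l) \<in> L" using star_mem[OF cpsD(6)[OF cps]] l by blast
      have lG: "l \<in> carrier G" using cps_star_closed(1)[OF cps] l by blast
      have pG: "p (star L l) \<in> carrier G"
        using p star K(1) H.compactin_subset_carrier
        by (metis G.topspace_topo H.topspace_topo continuous_map_image_subset_topspace image_subset_iff
            subsetD)
      have "l = l \<otimes>\<^bsub>G\<^esub> p (star L l) \<otimes>\<^bsub>G\<^esub> inv\<^bsub>G\<^esub> p (star L l)"
        using lG pG by (simp add: G.m_assoc)
      ultimately have "l \<in> D" unfolding D_def
        by (intro image_eqI[of _ _ "(l \<otimes>\<^bsub>G\<^esub> p (star L l), inv\<^bsub>G\<^esub> p (star L l))"]) simp_all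
      then show False using l lL star by (force simp: F_def)
    qed
    then have "(\<Sum>\<^sub>\<infinity>l\<in>fst ` L. f (star L l) * \<phi> (l \<otimes>\<^bsub>G\<^esub> p (star L l))) =
        (\<Sum>\<^sub>\<infinity>l\<in>F. f (star L l) * \<phi> (l \<otimes>\<^bsub>G\<^esub> p (star L l)))"
      using F(2) by (intro infsum_cong_neutral) auto
    then show "deformed_comb G L f p \<phi> = (\<Sum>l\<in>F. f (star L l) * \<phi> (l \<otimes>\<^bsub>G\<^esub> p (star L l)))"
      using \<phi> F(1) by (simp add: deformed_comb_def)
  qed
qed

lemma radon_measure_deformed_comb:
  assumes cps: "cps G H L" and f: "f \<in> Cc H" and p: "continuous_map (topo H) (topo G) p"
  shows "radon_measure G (deformed_comb G L f p)"
  unfolding radon_measure_def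
proof (intro conjI ballI allI impI)
  obtain K where K: "compactin (topo H) K" "\<forall>h. h \<notin> K \<longrightarrow> f h = 0"
    using f by (auto simp: Cc_def)
  note rep = deformed_comb_finite_sum[OF cps p K]
  show "deformed_comb G L f p \<in> extensional (Cc G)" by (simp add: deformed_comb_def)
  fix \<phi> assume \<phi>: "\<phi> \<in> Cc G"
  show "deformed_comb G L f p (\<lambda>x. \<phi> x + \<psi> x) = deformed_comb G L f p \<phi> + deformed_comb G L f p \<psi>"
    if \<psi>: "\<psi> \<in> Cc G" for \<psi>
  proof -
    obtain C where C: "compactin (topo G) C" "\<And>x. x \<notin> C \<Longrightarrow> \<phi> x = 0" "\<And>x. x \<notin> C \<Longrightarrow> \<psi> x = 0"
      using Cc_support_Un[OF \<phi> \<psi>] by metis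
    obtain F where F: "\<forall>\<phi>\<in>Cc G. (\<forall>x. x \<notin> C \<longrightarrow> \<phi> x = 0) \<longrightarrow>
        deformed_comb G L f p \<phi> = (\<Sum>l\<in>F. f (star L l) * \<phi> (l \<otimes>\<^bsub>G\<^esub> p (star L l)))"
      using rep[OF C(1)] by blast
    show ?thesis
      using F[rule_format, OF \<phi>] F[rule_format, OF \<psi>] F[rule_format, OF Cc_add[OF \<phi> \<psi>]]
      by (simp add: C distrib_left sum.distrib)
  qed
  show "deformed_comb G L f p (\<lambda>x. c * \<phi> x) = c * deformed_comb G L f p \<phi>" for c
  proof -
    obtain C where C: "compactin (topo G) C" "\<And>x. x \<notin> C \<Longrightarrow> \<phi> x = 0"
      using Cc_support_Un[OF \<phi> \<phi>] by metis
    obtain F where F: "\<forall>\<phi>\<in>Cc G. (\<forall>x. x \<notin> C \<longrightarrow> \<phi> x = 0) \<longrightarrow>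
        deformed_comb G L f p \<phi> = (\<Sum>l\<in>F. f (star L l) * \<phi> (l \<otimes>\<^bsub>G\<^esub> p (star L l)))"
      using rep[OF C(1)] by blast
    show ?thesis
      using F[rule_format, OF \<phi>] F[rule_format, OF Cc_scale[OF \<phi>]]
      by (simp add: C sum_distrib_left mult.left_commute)
  qed
next
  obtain K where K: "compactin (topo H) K" "\<forall>h. h \<notin> K \<longrightarrow> f h = 0"
    using f by (auto simp: Cc_def)
  fix C assume "compactin (topo G) C"
  then obtain F where F: "\<forall>\<phi>\<in>Cc G. (\<forall>x. x \<notin> C \<longrightarrow> \<phi> x = 0) \<longrightarrow>
      deformed_comb G L f p \<phi> = (\<Sum>l\<in>F. f (star L l) * \<phi> (l \<otimes>\<^bsub>G\<^esub> p (star L l)))"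
    using deformed_comb_finite_sum[OF cps p K] by blast
  show "\<exists>D. \<forall>\<phi>\<in>Cc G. \<forall>M. (\<forall>x. x \<notin> C \<longrightarrow> \<phi> x = 0) \<and> (\<forall>x. norm (\<phi> x) \<le> M) \<longrightarrow>
      norm (deformed_comb G L f p \<phi>) \<le> D * M"
  proof (intro exI[of _ "\<Sum>l\<in>F. norm (f (star L l))"] ballI allI impI)
    fix \<phi> M
    assume \<phi>: "\<phi> \<in> Cc G" "(\<forall>x. x \<notin> C \<longrightarrow> \<phi> x = 0) \<and> (\<forall>x. norm (\<phi> x) \<le> M)"
    then have M: "\<And>x. norm (\<phi> x) \<le> M" by blast
    have "norm (deformed_comb G L f p \<phi>) =
        norm (\<Sum>l\<in>F. f (star L l) * \<phi> (l \<otimes>\<^bsub>G\<^esub> p (star L l)))"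
      using F \<phi> by simp
    also have "\<dots> \<le> (\<Sum>l\<in>F. norm (f (star L l)) * M)"
      by (intro sum_norm_le) (simp add: norm_mult mult_left_mono M)
    finally show "norm (deformed_comb G L f p \<phi>) \<le> (\<Sum>l\<in>F. norm (f (star L l))) * M"
      by (simp add: sum_distrib_right)
  qed
qed

section \<open>Modulating a weighted model set\<close>

text \<open>The support of the integrand moves by the inverse of the values of \<open>g\<close>, hence stays in a
  compact set.\<close>

lemma modulated_test_function:
  assumes G: "lcag G" and w: "continuous_map (topo G) euclidean w"
    and g: "continuous_map (topo G) (topo G) g" "compactin (topo G) D" "g ` carrier G \<subseteq> D"
    and \<phi>: "\<phi> \<in> Cc G"
  shows "(\<lambda>x. if x \<in> carrier G then w x * \<phi> (x \<otimes>\<^bsub>G\<^esub> g x) else 0) \<in> Cc G"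
proof -
  interpret G: lcag G by fact
  obtain K where K: "compactin (topo G) K" "\<And>x. x \<notin> K \<Longrightarrow> \<phi> x = 0"
    using \<phi> by (auto simp: Cc_def)
  have DG: "D \<subseteq> carrier G" using g(2) by (rule G.compactin_subset_carrier)
  let ?E = "(\<lambda>(x, y). x \<otimes>\<^bsub>G\<^esub> y) ` (K \<times> (\<lambda>x. inv\<^bsub>G\<^esub> x) ` D)"
  have "continuous_map (topo G) euclidean \<phi>" using \<phi> by (simp add: Cc_def)
  then have "continuous_map (topo G) euclidean (\<lambda>x. \<phi> (x \<otimes>\<^bsub>G\<^esub> g x))"
    using continuous_map_compose[OF G.topology_mult[OF G.topology_id g(1)]] by (simp add: o_def)
  then have "continuous_map (topo G) euclidean (\<lambda>x. w x * \<phi> (x \<otimes>\<^bsub>G\<^esub> g x))"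
    by (rule continuous_map_complex_mult[OF w])
  then have "continuous_map (topo G) euclidean
      (\<lambda>x. if x \<in> carrier G then w x * \<phi> (x \<otimes>\<^bsub>G\<^esub> g x) else 0)"
    by (rule continuous_map_eq) (simp add: G.topspace_topo)
  moreover have "compactin (topo G) ?E" by (intro G.compactin_mult G.compactin_inv K g)
  moreover have "x \<in> ?E" if x: "x \<in> carrier G" "\<phi> (x \<otimes>\<^bsub>G\<^esub> g x) \<noteq> 0" for x
  proof -
    have "x \<otimes>\<^bsub>G\<^esub> g x \<in> K" "g x \<in> D" using x K g by auto
    moreover have "x = x \<otimes>\<^bsub>G\<^esub> g x \<otimes>\<^bsub>G\<^esub> inv\<^bsub>G\<^esub> g x"
      using x \<open>g x \<in> D\<close> DG by (simp add: G.m_assoc subset_iff)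
    ultimately show ?thesis
      by (intro image_eqI[of _ _ "(x \<otimes>\<^bsub>G\<^esub> g x, inv\<^bsub>G\<^esub> g x)"]) simp_all
  qed
  ultimately show ?thesis unfolding Cc_def by (auto intro!: exI[of _ ?E])
qed

lemma modulate_weighted_comb:
  assumes cps: "cps G H L" and w: "continuous_map (topo G) euclidean w"
    and g: "continuous_map (topo G) (topo G) g" "compactin (topo G) D" "g ` carrier G \<subseteq> D"
  shows "modulate G w g (deformed_comb G L f (\<lambda>_. \<one>\<^bsub>G\<^esub>)) =
    (\<lambda>\<phi>\<in>Cc G. \<Sum>\<^sub>\<infinity>l\<in>fst ` L. f (star L l) * (w l * \<phi> (l \<otimes>\<^bsub>G\<^esub> g l)))"
proof -
  interpret G: lcag G using cpsD[OF cps] by blast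
  show ?thesis unfolding modulate_def
  proof (rule restrict_ext)
    fix \<phi> assume "\<phi> \<in> Cc G"
    then have "(\<lambda>x. if x \<in> carrier G then w x * \<phi> (x \<otimes>\<^bsub>G\<^esub> g x) else 0) \<in> Cc G"
      by (rule modulated_test_function[OF G.lcag_axioms w g])
    then show "deformed_comb G L f (\<lambda>_. \<one>\<^bsub>G\<^esub>)
          (\<lambda>x. if x \<in> carrier G then w x * \<phi> (x \<otimes>\<^bsub>G\<^esub> g x) else 0) =
        (\<Sum>\<^sub>\<infinity>l\<in>fst ` L. f (star L l) * (w l * \<phi> (l \<otimes>\<^bsub>G\<^esub> g l)))"
      by (simp add: deformed_comb_def cps_star_closed[OF cps] cong: infsum_cong)
  qed
qed

section \<open>Extended cut-and-project schemes\<close>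

lemma closure_star_subgroup:
  assumes cps: "cps G H L" and B: "lcag B" and i: "i \<in> hom G B"
  shows "subgroup (topo (prod_tgroup H B) closure_of (extended_star L i ` fst ` L)) (prod_tgroup H B)"
proof -
  interpret G: lcag G using cpsD[OF cps] by blast
  interpret H: lcag H using cpsD[OF cps] by blast
  interpret B: lcag B by fact
  interpret P: lcag "prod_tgroup G H" using cpsD[OF cps] by blast
  interpret Q: lcag "prod_tgroup H B" by (intro lcag_prod_tgroup) unfold_locales
  have "(\<lambda>z. (snd z, i (fst z))) \<in> hom (prod_tgroup G H) (prod_tgroup H B)"
    using i by (auto simp: hom_def)
  then interpret group_hom "prod_tgroup G H" "prod_tgroup H B" "\<lambda>z. (snd z, i (fst z))"
    by unfold_locales
  have "extended_star L i ` fst ` L = (\<lambda>z. (snd z, i (fst z))) ` L"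
    using star_eq[OF cpsD(6)[OF cps]] by (force simp: extended_star_def image_iff)
  then have "subgroup (extended_star L i ` fst ` L) (prod_tgroup H B)"
    using subgroup_img_is_subgroup[OF cpsD(5)[OF cps]] by simp
  then show ?thesis by (rule Q.subgroup_closure)
qed

lemma fst_extended_lattice: "fst ` extended_lattice L i = fst ` L"
  by (force simp: extended_lattice_def)

lemma inj_on_fst_extended_lattice: "inj_on fst (extended_lattice L i)"
  by (auto simp: extended_lattice_def inj_on_def)

lemma star_extended_lattice: "l \<in> fst ` L \<Longrightarrow> star (extended_lattice L i) l = extended_star L i l"
  by (intro star_eq inj_on_fst_extended_lattice) (auto simp: extended_lattice_def)

text \<open>Discreteness is inherited because \<open>(l, l\<^sup>\<star>)\<close> is read off from \<open>(l, l\<^sup>\<star>, i(l))\<close>. Compactness of \<open>B\<close>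
  gives co-compactness: a compact set \<open>C\<^sub>1 \<times> C\<^sub>2\<close> of representatives
  for the given lattice is enlarged to \<open>C\<^sub>1 \<times> (C\<^sub>2 \<times> B)\<close>, and the representative of a point of the
  closed subgroup stays in it, being a translate by an element of that subgroup.\<close>

theorem cps_extended:
  assumes cps: "cps G H L" and B: "lcag B" "compact_space (topo B)" and i: "i \<in> hom G B"
  shows "cps G (extended_internal H L B i) (extended_lattice L i)"
proof -
  interpret G: lcag G using cpsD[OF cps] by blast
  interpret H: lcag H using cpsD[OF cps] by blast
  interpret B: lcag B by fact
  interpret P: lcag "prod_tgroup G H" using cpsD[OF cps] by blast
  interpret Q: lcag "prod_tgroup H B" by (intro lcag_prod_tgroup) unfold_locales
  interpret i: group_hom G B i using i by unfold_locales
  define S where "S = extended_star L i ` fst ` L"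
  define E where "E = topo (prod_tgroup H B) closure_of S"
  let ?X = "extended_internal H L B i"
  let ?L = "extended_lattice L i"
  have X: "?X = sub_tgroup (prod_tgroup H B) E" by (simp add: extended_internal_def E_def S_def)
  have E: "subgroup E (prod_tgroup H B)"
    unfolding E_def S_def by (rule closure_star_subgroup[OF cps B(1) i])
  have EQ: "E \<subseteq> carrier H \<times> carrier B" using subgroup.subset[OF E] by simp
  have closed: "closedin (topo (prod_tgroup H B)) E" by (simp add: E_def)
  interpret X: lcag ?X unfolding X by (rule lcag_sub_tgroup[OF Q.lcag_axioms E closed])
  interpret Y: lcag "prod_tgroup G ?X" by (intro lcag_prod_tgroup) unfold_locales
  have LP: "L \<subseteq> carrier G \<times> carrier H" using subgroup.subset[OF cpsD(5)[OF cps]] by simp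
  have mem_L: "(l, h, b) \<in> ?L \<longleftrightarrow> (l, h) \<in> L \<and> b = i l" for l h b
    using star_eq[OF cpsD(6)[OF cps]] star_mem[OF cpsD(6)[OF cps]]
    by (force simp: extended_lattice_def extended_star_def)
  have S: "snd ` ?L = S" by (force simp: S_def extended_lattice_def)
  have "S \<subseteq> topspace (topo (prod_tgroup H B))"
    using S mem_L LP i.hom_closed by (fastforce simp: H.topspace_topo B.topspace_topo)
  then have SE: "S \<subseteq> E" unfolding E_def by (rule closure_of_subset)
  have L_closed: "(h, i l) \<in> E" if "(l, h) \<in> L" for l h
    using that SE S mem_L[of l h "i l"] by force
  have inv_E: "inv\<^bsub>?X\<^esub> (h, b) = (inv\<^bsub>H\<^esub> h, inv\<^bsub>B\<^esub> b)" if "(h, b) \<in> E" for h b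
  proof (rule X.inv_equality)
    have "(inv\<^bsub>H\<^esub> h, inv\<^bsub>B\<^esub> b) = inv\<^bsub>prod_tgroup H B\<^esub> (h, b)"
      using that EQ inv_prod_tgroup[OF H.comm_group_axioms B.comm_group_axioms] by auto
    then show "(inv\<^bsub>H\<^esub> h, inv\<^bsub>B\<^esub> b) \<in> carrier ?X"
      using subgroup.m_inv_closed[OF E that] by (simp add: X)
    show "(inv\<^bsub>H\<^esub> h, inv\<^bsub>B\<^esub> b) \<otimes>\<^bsub>?X\<^esub> (h, b) = \<one>\<^bsub>?X\<^esub>" using that EQ by (auto simp: X)
  qed (use that in \<open>simp add: X\<close>)
  have sub: "subgroup ?L (prod_tgroup G ?X)"
  proof (rule Y.subgroupI)
    show "?L \<subseteq> carrier (prod_tgroup G ?X)" using mem_L L_closed LP by (auto simp: X)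
    have "(\<one>\<^bsub>G\<^esub>, \<one>\<^bsub>H\<^esub>) \<in> L" using subgroup.one_closed[OF cpsD(5)[OF cps]] by simp
    then show "?L \<noteq> {}" using mem_L by blast
  next
    fix a assume "a \<in> ?L"
    then obtain l h where a: "a = (l, h, i l)" "(l, h) \<in> L" by (metis mem_L prod.exhaust)
    then have lh: "l \<in> carrier G" "h \<in> carrier H" using LP by auto
    have "inv\<^bsub>prod_tgroup G ?X\<^esub> a = (inv\<^bsub>G\<^esub> l, inv\<^bsub>H\<^esub> h, i (inv\<^bsub>G\<^esub> l))"
      using a L_closed[OF a(2)] lh
        inv_prod_tgroup[OF G.comm_group_axioms X.comm_group_axioms, of l "(h, i l)"]
      by (simp add: inv_E) (simp add: X)
    moreover have "(inv\<^bsub>G\<^esub> l, inv\<^bsub>H\<^esub> h) \<in> L"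
      using subgroup.m_inv_closed[OF cpsD(5)[OF cps] a(2)] lh
        inv_prod_tgroup[OF G.comm_group_axioms H.comm_group_axioms] by simp
    ultimately show "inv\<^bsub>prod_tgroup G ?X\<^esub> a \<in> ?L" by (simp add: mem_L)
    fix b assume "b \<in> ?L"
    then obtain m k where b: "b = (m, k, i m)" "(m, k) \<in> L" by (metis mem_L prod.exhaust)
    then have "m \<in> carrier G" using LP by auto
    moreover have "(l \<otimes>\<^bsub>G\<^esub> m, h \<otimes>\<^bsub>H\<^esub> k) \<in> L"
      using subgroup.m_closed[OF cpsD(5)[OF cps] a(2) b(2)] by simp
    ultimately show "a \<otimes>\<^bsub>prod_tgroup G ?X\<^esub> b \<in> ?L" using a b lh by (simp add: mem_L X)
  qed
  have T: "topo (prod_tgroup G ?X) = prod_topology (topo G) (subtopology (prod_topology (topo H) (topo B)) E)"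
    by (simp add: X)
  have "\<exists>U. openin (topo (prod_tgroup G ?X)) U \<and> \<one>\<^bsub>prod_tgroup G ?X\<^esub> \<in> U \<and>
      U \<inter> ?L \<subseteq> {\<one>\<^bsub>prod_tgroup G ?X\<^esub>}"
  proof -
    obtain U where U: "openin (topo (prod_tgroup G H)) U" "\<one>\<^bsub>prod_tgroup G H\<^esub> \<in> U"
      "U \<inter> L \<subseteq> {\<one>\<^bsub>prod_tgroup G H\<^esub>}"
      using cpsD(4)[OF cps] unfolding lattice_in_iff[OF cpsD(3)[OF cps]] by blast
    let ?V = "{z \<in> topspace (topo (prod_tgroup G ?X)). (fst z, fst (snd z)) \<in> U}"
    have "continuous_map (topo (prod_tgroup G ?X)) (topo (prod_tgroup G H)) (\<lambda>z. (fst z, fst (snd z)))"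
      unfolding T by (simp add: continuous_map_paired continuous_map_fst)
        (use continuous_map_compose[OF continuous_map_snd continuous_map_from_subtopology[OF continuous_map_fst]]
          in \<open>simp add: o_def\<close>)
    then have "openin (topo (prod_tgroup G ?X)) ?V"
      by (rule openin_continuous_map_preimage[OF _ U(1)])
    moreover have "\<one>\<^bsub>prod_tgroup G ?X\<^esub> \<in> ?V"
      using U(2) Y.one_closed unfolding Y.topspace_topo by (simp add: X)
    moreover have "?V \<inter> ?L \<subseteq> {\<one>\<^bsub>prod_tgroup G ?X\<^esub>}"
    proof
      fix z assume "z \<in> ?V \<inter> ?L"
      then obtain l h where z: "z = (l, h, i l)" "(l, h) \<in> L" "(l, h) \<in> U"
        by (cases z) (auto simp: mem_L)
      then have "l = \<one>\<^bsub>G\<^esub>" "h = \<one>\<^bsub>H\<^esub>" using U(3) by auto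
      then show "z \<in> {\<one>\<^bsub>prod_tgroup G ?X\<^esub>}" using z by (simp add: X)
    qed
    ultimately show ?thesis by blast
  qed
  moreover have "\<exists>C. compactin (topo (prod_tgroup G ?X)) C \<and> (\<forall>x\<in>carrier (prod_tgroup G ?X).
      \<exists>l\<in>?L. \<exists>c\<in>C. x = l \<otimes>\<^bsub>prod_tgroup G ?X\<^esub> c)"
  proof -
    obtain C where C: "compactin (topo (prod_tgroup G H)) C"
      "\<And>x. x \<in> carrier (prod_tgroup G H) \<Longrightarrow> \<exists>l\<in>L. \<exists>c\<in>C. x = l \<otimes>\<^bsub>prod_tgroup G H\<^esub> c"
      using cpsD(4)[OF cps] unfolding lattice_in_iff[OF cpsD(3)[OF cps]] by blast
    have CP: "C \<subseteq> carrier G \<times> carrier H" using P.compactin_subset_carrier[OF C(1)] by simp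
    have C12: "compactin (topo G) (fst ` C)" "compactin (topo H) (snd ` C)"
      using image_compactin[OF C(1)] continuous_map_fst continuous_map_snd by fastforce+
    have "compactin (topo (prod_tgroup H B)) (snd ` C \<times> carrier B)"
      using C12 B(2) by (simp add: compactin_Times compact_space_def B.topspace_topo)
    then have "compactin (topo (prod_tgroup H B)) ((snd ` C \<times> carrier B) \<inter> E)"
      by (rule compact_Int_closedin[OF _ closed])
    then have "compactin (topo ?X) ((snd ` C \<times> carrier B) \<inter> E)"
      by (simp add: X compactin_subtopology)
    then have "compactin (topo (prod_tgroup G ?X)) (fst ` C \<times> ((snd ` C \<times> carrier B) \<inter> E))"
      using C12 by (simp add: compactin_Times)
    moreover have "\<exists>l\<in>?L. \<exists>c\<in>fst ` C \<times> ((snd ` C \<times> carrier B) \<inter> E).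
        x = l \<otimes>\<^bsub>prod_tgroup G ?X\<^esub> c" if "x \<in> carrier (prod_tgroup G ?X)" for x
    proof -
      obtain a h b where x: "x = (a, h, b)" by (metis prod.exhaust)
      then have x: "x = (a, h, b)" "a \<in> carrier G" "(h, b) \<in> E" using that by (simp_all add: X)
      have hb: "h \<in> carrier H" "b \<in> carrier B" using x EQ by auto
      obtain l c where lc: "l \<in> L" "c \<in> C" "(a, h) = l \<otimes>\<^bsub>prod_tgroup G H\<^esub> c"
        using C(2)[of "(a, h)"] x hb by auto
      obtain l1 l2 c1 c2 where lc12: "l = (l1, l2)" "c = (c1, c2)" by (cases l, cases c)
      have carr: "l1 \<in> carrier G" "l2 \<in> carrier H" "c1 \<in> carrier G" "c2 \<in> carrier H"
        using lc lc12 LP CP by auto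
      have ah: "a = l1 \<otimes>\<^bsub>G\<^esub> c1" "h = l2 \<otimes>\<^bsub>H\<^esub> c2" using lc(3) lc12 by simp_all
      define d where "d = inv\<^bsub>B\<^esub> i l1 \<otimes>\<^bsub>B\<^esub> b"
      have d: "d \<in> carrier B" "b = i l1 \<otimes>\<^bsub>B\<^esub> d"
        using hb carr by (simp_all add: d_def B.cancel_inv)
      have iE: "(l2, i l1) \<in> E" using L_closed lc lc12 by simp
      have "inv\<^bsub>prod_tgroup H B\<^esub> (l2, i l1) \<otimes>\<^bsub>prod_tgroup H B\<^esub> (h, b) \<in> E"
        using subgroup.m_closed[OF E subgroup.m_inv_closed[OF E iE] x(3)] .
      moreover have "inv\<^bsub>prod_tgroup H B\<^esub> (l2, i l1) \<otimes>\<^bsub>prod_tgroup H B\<^esub> (h, b) = (c2, d)"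
        using carr by (simp add: inv_prod_tgroup[OF H.comm_group_axioms B.comm_group_axioms]
            ah d_def H.cancel_inv)
      ultimately have "(c2, d) \<in> E" by simp
      moreover have "(l1, l2, i l1) \<in> ?L" using lc lc12 by (simp add: mem_L)
      moreover have "x = (l1, l2, i l1) \<otimes>\<^bsub>prod_tgroup G ?X\<^esub> (c1, c2, d)"
        using x(1) ah d by (simp add: X)
      moreover have "(c1, c2, d) \<in> fst ` C \<times> ((snd ` C \<times> carrier B) \<inter> E)"
        using calculation(1) lc(2) lc12 d(1) by force
      ultimately show ?thesis by blast
    qed
    ultimately show ?thesis by blast
  qed
  ultimately have lattice: "lattice_in ?L (prod_tgroup G ?X)"
    using sub by (subst lattice_in_iff[OF Y.lcag_axioms]) blast
  have "topo ?X closure_of (snd ` ?L) = carrier ?X"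
  proof -
    have "topo ?X closure_of (snd ` ?L) = E \<inter> (topo (prod_tgroup H B) closure_of (E \<inter> S))"
      unfolding S X sub_tgroup_simps by (rule closure_of_subtopology)
    also have "E \<inter> S = S" using SE by blast
    also have "E \<inter> (topo (prod_tgroup H B) closure_of S) = carrier ?X"
      unfolding E_def[symmetric] X by simp
    finally show ?thesis .
  qed
  then show ?thesis unfolding cps_def
    using lattice inj_on_fst_extended_lattice G.lcag_axioms X.lcag_axioms by blast
qed

text \<open>If \<open>w\<close> and \<open>g\<close> are pulled back from continuous functions \<open>w'\<close> and \<open>g'\<close> on a compact group \<open>B\<close>,
  then their values at \<open>l\<close> are continuous functions of the second component of the extended
  star of \<open>l\<close>. So \<open>w\<close> becomes part of the weight and \<open>g\<close> becomes the deformation.\<close>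

theorem modulation_deformed_in_extension:
  fixes G :: "'g tgroup" and H :: "'h tgroup" and B :: "'b tgroup"
  assumes cps: "cps G H L" and B: "lcag B" "compact_space (topo B)"
    and i: "i \<in> hom G B" "continuous_map (topo G) (topo B) i"
    and w': "continuous_map (topo B) euclidean w'" and w: "\<And>x. x \<in> carrier G \<Longrightarrow> w x = w' (i x)"
    and g': "continuous_map (topo B) (topo G) g'" and g: "\<And>x. x \<in> carrier G \<Longrightarrow> g x = g' (i x)"
    and \<nu>: "weighted_model_set G H L \<nu>"
  shows "deformed_weighted_model_set G (extended_internal H L B i) (extended_lattice L i)
    (modulate G w g \<nu>)"
proof -
  interpret G: lcag G using cpsD[OF cps] by blast
  interpret B: lcag B by fact
  interpret H: lcag H using cpsD[OF cps] by blast
  let ?X = "extended_internal H L B i"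
  let ?L = "extended_lattice L i"
  define E where "E = carrier ?X"
  obtain f where f: "f \<in> Cc H" "\<nu> = deformed_comb G L f (\<lambda>_. \<one>\<^bsub>G\<^esub>)"
    using \<nu> by (auto simp: weighted_model_set_def)
  obtain K where K: "compactin (topo H) K" "\<And>h. h \<notin> K \<Longrightarrow> f h = 0"
    using f by (auto simp: Cc_def)
  have ext: "cps G ?X ?L" by (rule cps_extended[OF cps B i(1)])
  have T: "topo ?X = subtopology (prod_topology (topo H) (topo B)) E"
    by (simp add: E_def extended_internal_def)
  have closed: "closedin (prod_topology (topo H) (topo B)) E"
    by (simp add: E_def extended_internal_def)
  have EP: "E \<subseteq> carrier H \<times> carrier B"
    using closedin_subset[OF closed] by (simp add: H.topspace_topo B.topspace_topo)
  have cont: "continuous_map (topo ?X) (topo H) fst" "continuous_map (topo ?X) (topo B) snd"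
    unfolding T by (intro continuous_map_from_subtopology continuous_map_fst continuous_map_snd)+
  \<comment> \<open>Test functions vanish off the carrier, here the closed subgroup \<open>E\<close>.\<close>
  define f' where "f' = (\<lambda>z. if z \<in> E then f (fst z) * w' (snd z) else 0)"
  define p where "p = (\<lambda>z :: 'h \<times> 'b. g' (snd z))"
  have p: "continuous_map (topo ?X) (topo G) p"
    using continuous_map_compose[OF cont(2) g'] by (simp add: p_def o_def)
  have f': "f' \<in> Cc ?X"
  proof -
    have "continuous_map (topo ?X) euclidean (\<lambda>z. f (fst z) * w' (snd z))"
      using continuous_map_compose[OF cont(1), of euclidean f]
        continuous_map_compose[OF cont(2) w'] f
      by (intro continuous_map_complex_mult) (simp_all add: o_def Cc_def)
    then have "continuous_map (topo ?X) euclidean f'"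
      by (rule continuous_map_eq) (simp add: f'_def T)
    moreover have "compactin (prod_topology (topo H) (topo B)) ((K \<times> carrier B) \<inter> E)"
      using B(2) K by (intro compact_Int_closedin closed)
        (simp add: compactin_Times compact_space_def B.topspace_topo)
    then have "compactin (topo ?X) ((K \<times> carrier B) \<inter> E)" by (simp add: T compactin_subtopology)
    moreover have "f' z = 0" if "z \<notin> (K \<times> carrier B) \<inter> E" for z
      using that K EP by (cases z) (auto simp: f'_def)
    ultimately show ?thesis by (auto simp: Cc_def)
  qed
  have "continuous_map (topo G) euclidean w"
    by (rule continuous_map_eq[OF continuous_map_compose[OF i(2) w']])
      (simp add: w G.topspace_topo)
  moreover have "continuous_map (topo G) (topo G) g"
    by (rule continuous_map_eq[OF continuous_map_compose[OF i(2) g']])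
      (simp add: g G.topspace_topo)
  moreover have "compactin (topo G) (g' ` carrier B)"
    using image_compactin[OF _ g'] B(2) by (simp add: compact_space_def B.topspace_topo)
  moreover have "g ` carrier G \<subseteq> g' ` carrier B"
    using g i(1) by (auto simp: hom_def)
  ultimately have "modulate G w g \<nu> =
      (\<lambda>\<phi>\<in>Cc G. \<Sum>\<^sub>\<infinity>l\<in>fst ` L. f (star L l) * (w l * \<phi> (l \<otimes>\<^bsub>G\<^esub> g l)))"
    unfolding f(2) by (rule modulate_weighted_comb[OF cps])
  also have "\<dots> = deformed_comb G ?L f' p"
    unfolding deformed_comb_def fst_extended_lattice
  proof (intro restrict_ext infsum_cong)
    fix \<phi> l assume l: "l \<in> fst ` L"
    have "(l, extended_star L i l) \<in> ?L" using l by (auto simp: extended_lattice_def)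
    then have "extended_star L i l \<in> E"
      using subgroup.subset[OF cpsD(5)[OF ext]] by (auto simp: E_def)
    then show "f (star L l) * (w l * \<phi> (l \<otimes>\<^bsub>G\<^esub> g l)) =
        f' (star ?L l) * \<phi> (l \<otimes>\<^bsub>G\<^esub> p (star ?L l))"
      using l w g cps_star_closed[OF cps l]
      by (simp add: star_extended_lattice f'_def p_def) (simp add: extended_star_def)
  qed
  finally show ?thesis unfolding deformed_weighted_model_set_def
    using radon_measure_deformed_comb[OF ext f' p] ext f' p by auto
qed


section \<open>The uniform topology\<close>

definition uniformly_near :: "'g tgroup \<Rightarrow> 'k tgroup \<Rightarrow> 'k set \<Rightarrow> ('g \<Rightarrow> 'k) \<Rightarrow> ('g \<Rightarrow> 'k) \<Rightarrow> bool" where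
  "uniformly_near G K V a b \<longleftrightarrow> (\<forall>x\<in>carrier G. a x \<otimes>\<^bsub>K\<^esub> inv\<^bsub>K\<^esub> (b x) \<in> V)"

lemma topspace_uniform_topology:
  assumes "lcag K"
  shows "topspace (uniform_topology G K) = Cu G K"
proof
  interpret K: lcag K by fact
  show "topspace (uniform_topology G K) \<subseteq> Cu G K"
    using openin_topspace[of "uniform_topology G K"] unfolding openin_uniform_topology by blast
  have "openin (uniform_topology G K) (Cu G K)"
    unfolding openin_uniform_topology
    using K.topspace_topo openin_topspace[of "topo K"] K.one_closed
    by (auto intro!: exI[of _ "carrier K"])
  then show "Cu G K \<subseteq> topspace (uniform_topology G K)" by (rule openin_subset)
qed

lemma Cu_closed: "h \<in> Cu G K \<Longrightarrow> x \<in> carrier G \<Longrightarrow> h x \<in> carrier K"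
  by (auto simp: Cu_def)

lemma Cu_uniformly_continuous:
  assumes "h \<in> Cu G K" "openin (topo K) V" "\<one>\<^bsub>K\<^esub> \<in> V"
  obtains U where "openin (topo G) U" "\<one>\<^bsub>G\<^esub> \<in> U"
    "\<forall>x\<in>carrier G. \<forall>y\<in>carrier G. x \<otimes>\<^bsub>G\<^esub> inv\<^bsub>G\<^esub> y \<in> U \<longrightarrow> h x \<otimes>\<^bsub>K\<^esub> inv\<^bsub>K\<^esub> (h y) \<in> V"
proof -
  have "\<forall>V. openin (topo K) V \<and> \<one>\<^bsub>K\<^esub> \<in> V \<longrightarrow> (\<exists>U. openin (topo G) U \<and> \<one>\<^bsub>G\<^esub> \<in> U \<and>
      (\<forall>x\<in>carrier G. \<forall>y\<in>carrier G. x \<otimes>\<^bsub>G\<^esub> inv\<^bsub>G\<^esub> y \<in> U \<longrightarrow> h x \<otimes>\<^bsub>K\<^esub> inv\<^bsub>K\<^esub> (h y) \<in> V))"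
    using assms(1) by (simp add: Cu_def)
  then show ?thesis using assms(2,3) that by meson
qed

lemma Cu_eqI:
  assumes "a \<in> Cu G K" "b \<in> Cu G K" "\<And>x. x \<in> carrier G \<Longrightarrow> a x = b x"
  shows "a = b"
proof (rule PiE_ext)
  show "a \<in> carrier G \<rightarrow>\<^sub>E carrier K" "b \<in> carrier G \<rightarrow>\<^sub>E carrier K" using assms by (auto simp: Cu_def)
qed (use assms in simp)

lemma uniformly_near_sym:
  assumes "lcag K" "uniformly_near G K V a b" "\<And>x. x \<in> V \<Longrightarrow> inv\<^bsub>K\<^esub> x \<in> V"
    "a \<in> Cu G K" "b \<in> Cu G K"
  shows "uniformly_near G K V b a"
  unfolding uniformly_near_def
proof
  interpret K: lcag K by fact
  fix x assume x: "x \<in> carrier G"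
  then have "inv\<^bsub>K\<^esub> (a x \<otimes>\<^bsub>K\<^esub> inv\<^bsub>K\<^esub> (b x)) \<in> V"
    using assms(2,3) by (simp add: uniformly_near_def)
  then show "b x \<otimes>\<^bsub>K\<^esub> inv\<^bsub>K\<^esub> (a x) \<in> V"
    using Cu_closed[OF assms(4) x] Cu_closed[OF assms(5) x] by (simp add: K.inv_mult_group)
qed

lemma uniformly_near_trans:
  assumes "lcag K" "uniformly_near G K W a b" "uniformly_near G K W b c"
    "\<And>x y. x \<in> W \<Longrightarrow> y \<in> W \<Longrightarrow> x \<otimes>\<^bsub>K\<^esub> y \<in> V"
    "a \<in> Cu G K" "b \<in> Cu G K" "c \<in> Cu G K"
  shows "uniformly_near G K V a c"
  unfolding uniformly_near_def
proof
  interpret K: lcag K by fact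
  fix x assume x: "x \<in> carrier G"
  then have "(a x \<otimes>\<^bsub>K\<^esub> inv\<^bsub>K\<^esub> (b x)) \<otimes>\<^bsub>K\<^esub> (b x \<otimes>\<^bsub>K\<^esub> inv\<^bsub>K\<^esub> (c x)) \<in> V"
    using assms(2-4) by (simp add: uniformly_near_def)
  then show "a x \<otimes>\<^bsub>K\<^esub> inv\<^bsub>K\<^esub> (c x) \<in> V"
    using Cu_closed[OF assms(5) x] Cu_closed[OF assms(6) x] Cu_closed[OF assms(7) x]
    by (simp add: K.m_assoc K.cancel_inv)
qed

text \<open>The set of functions near \<open>h\<close> need not be open, but the set of those functions all of whose
  sufficiently near functions are near \<open>h\<close> is.\<close>

lemma uniform_neighbourhood:
  assumes K: "lcag K" and h: "h \<in> Cu G K" and V: "openin (topo K) V" "\<one>\<^bsub>K\<^esub> \<in> V"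
  obtains \<U> where "openin (uniform_topology G K) \<U>" "h \<in> \<U>" "\<U> \<subseteq> Cu G K"
    "\<And>k. k \<in> \<U> \<Longrightarrow> uniformly_near G K V k h"
proof -
  interpret K: lcag K by fact
  define \<U> where "\<U> = {k \<in> Cu G K. \<exists>W. openin (topo K) W \<and> \<one>\<^bsub>K\<^esub> \<in> W \<and>
    (\<forall>l\<in>Cu G K. uniformly_near G K W l k \<longrightarrow> uniformly_near G K V l h)}"
  show ?thesis
  proof
    show "openin (uniform_topology G K) \<U>"
      unfolding openin_uniform_topology
    proof (intro conjI ballI)
      show "\<U> \<subseteq> Cu G K" by (auto simp: \<U>_def)
      fix k assume "k \<in> \<U>"
      then obtain W where k: "k \<in> Cu G K" and W: "openin (topo K) W" "\<one>\<^bsub>K\<^esub> \<in> W"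
        "\<And>l. l \<in> Cu G K \<Longrightarrow> uniformly_near G K W l k \<Longrightarrow> uniformly_near G K V l h"
        unfolding \<U>_def by blast
      obtain W' where W': "openin (topo K) W'" "\<one>\<^bsub>K\<^esub> \<in> W'"
        "\<And>x y. x \<in> W' \<Longrightarrow> y \<in> W' \<Longrightarrow> x \<otimes>\<^bsub>K\<^esub> y \<in> W"
        using K.neighbourhood_halving[OF W(1,2)] by metis
      have "l \<in> \<U>" if l: "l \<in> Cu G K" "uniformly_near G K W' l k" for l
      proof -
        have "uniformly_near G K V m h" if m: "m \<in> Cu G K" "uniformly_near G K W' m l" for m
          by (rule W(3)[OF m(1) uniformly_near_trans[OF K m(2) l(2) W'(3) m(1) l(1) k]])
        then show ?thesis using l(1) W'(1,2) unfolding \<U>_def by blast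
      qed
      then have "{l \<in> Cu G K. \<forall>x\<in>carrier G. l x \<otimes>\<^bsub>K\<^esub> inv\<^bsub>K\<^esub> (k x) \<in> W'} \<subseteq> \<U>"
        by (auto simp: uniformly_near_def)
      then show "\<exists>V. openin (topo K) V \<and> \<one>\<^bsub>K\<^esub> \<in> V \<and>
          {l \<in> Cu G K. \<forall>x\<in>carrier G. l x \<otimes>\<^bsub>K\<^esub> inv\<^bsub>K\<^esub> (k x) \<in> V} \<subseteq> \<U>"
        using W'(1,2) by meson
    qed
    show "h \<in> \<U>" using h V by (auto simp: \<U>_def)
    show "\<U> \<subseteq> Cu G K" by (auto simp: \<U>_def)
    show "uniformly_near G K V k h" if k\<U>: "k \<in> \<U>" for k
    proof -
      obtain W where k: "k \<in> Cu G K" and W: "\<one>\<^bsub>K\<^esub> \<in> W"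
        "\<forall>l\<in>Cu G K. uniformly_near G K W l k \<longrightarrow> uniformly_near G K V l h"
        using k\<U> unfolding \<U>_def by blast
      have "uniformly_near G K W k k"
        using W(1) Cu_closed[OF k] by (simp add: uniformly_near_def)
      then show ?thesis using W(2) k by blast
    qed
  qed
qed

lemma continuous_map_evaluation:
  assumes K: "lcag K" and x: "x \<in> carrier G"
  shows "continuous_map (uniform_topology G K) (topo K) (\<lambda>h. h x)"
  unfolding continuous_map_def topspace_uniform_topology[OF K]
proof (intro conjI allI impI)
  interpret K: lcag K by fact
  show "(\<lambda>h. h x) \<in> Cu G K \<rightarrow> topspace (topo K)" using Cu_closed x by (fastforce simp: K.topspace_topo)
  fix N assume N: "openin (topo K) N"
  show "openin (uniform_topology G K) {h \<in> Cu G K. h x \<in> N}"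
    unfolding openin_uniform_topology
  proof (intro conjI ballI)
    fix h assume "h \<in> {h \<in> Cu G K. h x \<in> N}"
    then have h: "h x \<in> carrier K" "h x \<in> N" using Cu_closed x by fast+
    let ?V = "{v \<in> carrier K. v \<otimes>\<^bsub>K\<^esub> h x \<in> N}"
    have "openin (topo K) ?V" by (intro K.openin_preimage K.topology_intros h N)
    moreover have "\<one>\<^bsub>K\<^esub> \<in> ?V" using h by simp
    moreover have "k x \<in> N" if "k \<in> Cu G K" "k x \<otimes>\<^bsub>K\<^esub> inv\<^bsub>K\<^esub> (h x) \<in> ?V" for k
      using that h Cu_closed[OF that(1) x] by (simp add: K.m_assoc)
    then have "{k \<in> Cu G K. \<forall>x\<in>carrier G. k x \<otimes>\<^bsub>K\<^esub> inv\<^bsub>K\<^esub> (h x) \<in> ?V} \<subseteq> {h \<in> Cu G K. h x \<in> N}"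
      using x by blast
    ultimately show "\<exists>V. openin (topo K) V \<and> \<one>\<^bsub>K\<^esub> \<in> V \<and>
        {k \<in> Cu G K. \<forall>x\<in>carrier G. k x \<otimes>\<^bsub>K\<^esub> inv\<^bsub>K\<^esub> (h x) \<in> V} \<subseteq> {h \<in> Cu G K. h x \<in> N}"
      by meson
  qed auto
qed

lemma Hausdorff_uniform_topology:
  assumes K: "lcag K"
  shows "Hausdorff_space (uniform_topology G K)"
  unfolding Hausdorff_space_def topspace_uniform_topology[OF K]
proof (intro allI impI)
  interpret K: lcag K by fact
  fix a b assume ab: "a \<in> Cu G K \<and> b \<in> Cu G K \<and> a \<noteq> b"
  then obtain x where x: "x \<in> carrier G" "a x \<noteq> b x" using Cu_eqI by blast
  have "a x \<in> topspace (topo K)" "b x \<in> topspace (topo K)"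
    using ab x Cu_closed by (auto simp: K.topspace_topo)
  then obtain M N where MN: "openin (topo K) M" "openin (topo K) N" "a x \<in> M" "b x \<in> N" "disjnt M N"
    using K.Hausdorff x(2) unfolding Hausdorff_space_def by meson
  let ?ev = "\<lambda>N. {h \<in> Cu G K. h x \<in> N}"
  have "openin (uniform_topology G K) (?ev M)" "openin (uniform_topology G K) (?ev N)"
    using openin_continuous_map_preimage[OF continuous_map_evaluation[OF K x(1)] MN(1)]
      openin_continuous_map_preimage[OF continuous_map_evaluation[OF K x(1)] MN(2)]
    by (simp_all add: topspace_uniform_topology[OF K])
  moreover have "disjnt (?ev M) (?ev N)" using MN(5) by (auto simp: disjnt_def)
  ultimately show "\<exists>U V. openin (uniform_topology G K) U \<and> openin (uniform_topology G K) V \<and>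
      a \<in> U \<and> b \<in> V \<and> disjnt U V"
    using ab MN by blast
qed

section \<open>Compact groups from dense homomorphisms\<close>

text \<open>Projection along a compact factor is a closed map, and the preimage of a closed set is such a
  projection of a closed part of the graph.\<close>

lemma closed_graph_continuous:
  assumes Y: "compact_space Y" and f: "f \<in> topspace X \<rightarrow> topspace Y"
    and closed: "closedin (prod_topology X Y) ((\<lambda>x. (x, f x)) ` topspace X)"
  shows "continuous_map X Y f"
  unfolding continuous_map_closedin
proof (intro conjI allI impI ballI)
  show "f \<in> topspace X \<rightarrow> topspace Y" by fact
  fix C assume C: "closedin Y C"
  have "closedin X (fst ` (((\<lambda>x. (x, f x)) ` topspace X) \<inter> (topspace X \<times> C)))"
    using closed_map_fst[OF Y, of X] closedin_Int[OF closed] C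
    unfolding closed_map_def by (simp add: closedin_prod_Times_iff)
  moreover have "fst ` (((\<lambda>x. (x, f x)) ` topspace X) \<inter> (topspace X \<times> C)) =
      {x \<in> topspace X. f x \<in> C}" by force
  ultimately show "closedin X {x \<in> topspace X. f x \<in> C}" by simp
qed

text \<open>The closure of \<open>R\<close> is the graph of the function. It is total because its projection is closed and
  contains the dense domain of \<open>R\<close>. This serves to extend a map from a dense subset without a
  uniform structure on the target.\<close>

lemma continuous_map_of_closed_relation:
  assumes Y: "compact_space Y" and R: "R \<subseteq> topspace X \<times> topspace Y"
    and dense: "X closure_of (fst ` R) = topspace X"
    and single: "\<And>x y z. \<lbrakk>(x, y) \<in> prod_topology X Y closure_of R;
      (x, z) \<in> prod_topology X Y closure_of R\<rbrakk> \<Longrightarrow> y = z"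
  shows "\<exists>F. continuous_map X Y F \<and> (\<forall>x y. (x, y) \<in> R \<longrightarrow> F x = y)"
proof -
  define S where "S = prod_topology X Y closure_of R"
  have S: "closedin (prod_topology X Y) S" by (simp add: S_def)
  have RS: "R \<subseteq> S" unfolding S_def using R by (intro closure_of_subset) simp
  have SXY: "S \<subseteq> topspace X \<times> topspace Y" using closedin_subset[OF S] by simp
  have "closedin X (fst ` S)" using closed_map_fst[OF Y, of X] S unfolding closed_map_def by blast
  then have "topspace X \<subseteq> fst ` S"
    unfolding dense[symmetric] using RS by (intro closure_of_minimal image_mono)
  then have "\<forall>x\<in>topspace X. \<exists>y. (x, y) \<in> S" by force
  then obtain F where F: "\<And>x. x \<in> topspace X \<Longrightarrow> (x, F x) \<in> S" by metis
  have F_eq: "F x = y" if "(x, y) \<in> S" for x y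
    using single[of x "F x" y] F[of x] that SXY by (auto simp: S_def)
  have "S = (\<lambda>x. (x, F x)) ` topspace X" using F F_eq SXY by force
  then have "continuous_map X Y F"
    using S F SXY by (intro closed_graph_continuous[OF Y]) auto
  then show ?thesis using F_eq RS by blast
qed

text \<open>The group laws are equations between continuous maps, so they pass from the dense image to the
  whole space. Inverses exist because the closed relation \<open>x y = 1\<close> projects onto a closed set
  which contains the dense image.\<close>

lemma compact_group_of_dense_hom:
  assumes G: "comm_group G" and X: "compact_space X" "Hausdorff_space X"
    and j: "j \<in> carrier G \<rightarrow> topspace X" and dense: "X closure_of (j ` carrier G) = topspace X"
    and m: "continuous_map (prod_topology X X) X m"
    and hom: "\<And>s t. s \<in> carrier G \<Longrightarrow> t \<in> carrier G \<Longrightarrow> m (j s, j t) = j (s \<otimes>\<^bsub>G\<^esub> t)"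
    and A: "A = \<lparr>carrier = topspace X, mult = (\<lambda>x y. m (x, y)), one = j \<one>\<^bsub>G\<^esub>, topo = X\<rparr>"
  shows "lcag A" "j \<in> hom G A"
proof -
  interpret G: comm_group G by fact
  define D where "D = j ` carrier G"
  have D: "X closure_of D = topspace X" using dense by (simp add: D_def)
  have jX: "j t \<in> topspace X" if "t \<in> carrier G" for t using j that by blast
  have mX: "m (x, y) \<in> topspace X" if "x \<in> topspace X" "y \<in> topspace X" for x y
    using continuous_map_image_subset_topspace[OF m] that by auto
  have m2: "continuous_map Z X (\<lambda>z. m (f z, g z))"
    if "continuous_map Z X f" "continuous_map Z X g" for Z :: "'z topology" and f g
    using continuous_map_compose[OF continuous_map_pairedI[OF that] m] by (simp add: o_def)
  have proj: "continuous_map X X (\<lambda>x. x)" using continuous_map_id[of X] by (simp add: id_def)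
  have assoc: "m (m (x, y), z) = m (x, m (y, z))"
    if "x \<in> topspace X" "y \<in> topspace X" "z \<in> topspace X" for x y z
  proof -
    let ?P = "prod_topology X (prod_topology X X)"
    have p: "continuous_map ?P X fst" "continuous_map ?P X (\<lambda>z. fst (snd z))"
      "continuous_map ?P X (\<lambda>z. snd (snd z))"
      using continuous_map_compose[OF continuous_map_snd continuous_map_fst, of X X X]
        continuous_map_compose[OF continuous_map_snd continuous_map_snd, of X X X]
      by (simp_all add: o_def continuous_map_fst)
    have mem: "(x, y, z) \<in> ?P closure_of (D \<times> D \<times> D)" using that D by (simp add: closure_of_Times)
    have cont: "continuous_map ?P X (\<lambda>w. m (m (fst w, fst (snd w)), snd (snd w)))"
      "continuous_map ?P X (\<lambda>w. m (fst w, m (fst (snd w), snd (snd w))))"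
      by (intro m2 p)+
    have eq: "m (m (fst w, fst (snd w)), snd (snd w)) = m (fst w, m (fst (snd w), snd (snd w)))"
      if "w \<in> D \<times> D \<times> D" for w
      using that by (auto simp: D_def hom G.m_assoc)
    show ?thesis using forall_in_closure_of_eq[OF mem X(2) cont eq] by simp
  qed
  have comm: "m (x, y) = m (y, x)" if "x \<in> topspace X" "y \<in> topspace X" for x y
  proof -
    let ?P = "prod_topology X X"
    have mem: "(x, y) \<in> ?P closure_of (D \<times> D)" using that D by (simp add: closure_of_Times)
    have cont: "continuous_map ?P X (\<lambda>w. m (fst w, snd w))"
      "continuous_map ?P X (\<lambda>w. m (snd w, fst w))"
      by (intro m2 continuous_map_fst continuous_map_snd)+
    have eq: "m (fst w, snd w) = m (snd w, fst w)" if "w \<in> D \<times> D" for w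
      using that by (auto simp: D_def hom G.m_comm)
    show ?thesis using forall_in_closure_of_eq[OF mem X(2) cont eq] by simp
  qed
  have one: "m (j \<one>\<^bsub>G\<^esub>, x) = x" if "x \<in> topspace X" for x
  proof -
    have mem: "x \<in> X closure_of D" using that D by simp
    have cont: "continuous_map X X (\<lambda>w. m (j \<one>\<^bsub>G\<^esub>, w))"
      by (intro m2 proj) (simp add: jX)
    have eq: "m (j \<one>\<^bsub>G\<^esub>, w) = w" if "w \<in> D" for w
      using that by (auto simp: D_def hom)
    show ?thesis by (rule forall_in_closure_of_eq[OF mem X(2) cont proj eq])
  qed
  define Z where "Z = {z \<in> topspace (prod_topology X X). m z = j \<one>\<^bsub>G\<^esub>}"
  have Z: "closedin (prod_topology X X) Z"
    unfolding Z_def by (rule closedin_continuous_maps_eq[OF X(2) m]) (simp add: jX)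
  have inverse: "\<exists>y\<in>topspace X. m (x, y) = j \<one>\<^bsub>G\<^esub>" if "x \<in> topspace X" for x
  proof -
    have "closedin X (fst ` Z)" using closed_map_fst[OF X(1), of X] Z unfolding closed_map_def by blast
    moreover have "D \<subseteq> fst ` Z"
    proof
      fix d assume "d \<in> D"
      then obtain t where t: "t \<in> carrier G" "d = j t" by (auto simp: D_def)
      then have "(d, j (inv\<^bsub>G\<^esub> t)) \<in> Z" by (simp add: Z_def hom jX)
      then show "d \<in> fst ` Z" by force
    qed
    ultimately have "X closure_of D \<subseteq> fst ` Z" by (intro closure_of_minimal)
    then show ?thesis using that D by (force simp: Z_def)
  qed
  interpret A: comm_group A
  proof (rule comm_groupI)
    fix x assume "x \<in> carrier A"
    then show "\<exists>y\<in>carrier A. y \<otimes>\<^bsub>A\<^esub> x = \<one>\<^bsub>A\<^esub>"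
      using inverse comm by (fastforce simp: A)
  qed (auto simp: A mX jX assoc one intro: comm)
  have inv: "Z = (\<lambda>x. (x, inv\<^bsub>A\<^esub> x)) ` topspace X"
  proof -
    have "y = inv\<^bsub>A\<^esub> x" if "x \<in> topspace X" "y \<in> topspace X" "m (x, y) = j \<one>\<^bsub>G\<^esub>" for x y
      using A.inv_equality[of y x] that comm by (simp add: A)
    moreover have "m (x, inv\<^bsub>A\<^esub> x) = j \<one>\<^bsub>G\<^esub>" "inv\<^bsub>A\<^esub> x \<in> topspace X" if "x \<in> topspace X" for x
      using A.r_inv[of x] A.inv_closed[of x] that by (simp_all add: A)
    ultimately show ?thesis by (auto simp: Z_def)
  qed
  show "lcag A"
  proof
    show "continuous_map (prod_topology (topo A) (topo A)) (topo A) (\<lambda>(x, y). x \<otimes>\<^bsub>A\<^esub> y)"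
      using m by (simp add: A case_prod_beta')
    have "continuous_map X X (\<lambda>x. inv\<^bsub>A\<^esub> x)"
      using Z inv A.inv_closed by (intro closed_graph_continuous[OF X(1)]) (auto simp: A)
    then show "continuous_map (topo A) (topo A) (\<lambda>x. inv\<^bsub>A\<^esub> x)" by (simp add: A)
  qed (simp_all add: A X compact_imp_locally_compact_space)
  show "j \<in> hom G A" by (auto simp: hom_def A jX hom)
qed

section \<open>The hull of an almost periodic function\<close>

lemma translate_Cu:
  assumes G: "lcag G" and h: "h \<in> Cu G K" and t: "t \<in> carrier G"
  shows "translate G t h \<in> Cu G K"
proof -
  interpret G: lcag G by fact
  have sub: "translate G t h \<in> carrier G \<rightarrow>\<^sub>E carrier K"
    using Cu_closed[OF h] t by (auto simp: translate_def)
  have range: "h ` carrier G = translate G t h ` carrier G"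
  proof (intro equalityI subsetI)
    fix y assume "y \<in> h ` carrier G"
    then obtain x where "x \<in> carrier G" "y = h x" by blast
    then have "y = translate G t h (x \<otimes>\<^bsub>G\<^esub> t)" "x \<otimes>\<^bsub>G\<^esub> t \<in> carrier G"
      using t by (simp_all add: translate_def G.m_assoc)
    then show "y \<in> translate G t h ` carrier G" by blast
  qed (use t in \<open>auto simp: translate_def\<close>)
  have shift: "(x \<otimes>\<^bsub>G\<^esub> inv\<^bsub>G\<^esub> t) \<otimes>\<^bsub>G\<^esub> inv\<^bsub>G\<^esub> (y \<otimes>\<^bsub>G\<^esub> inv\<^bsub>G\<^esub> t) = x \<otimes>\<^bsub>G\<^esub> inv\<^bsub>G\<^esub> y"
    if "x \<in> carrier G" "y \<in> carrier G" for x y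
    using that t by (simp add: G.inv_mult_group G.m_assoc G.cancel_inv)
  have "\<exists>U. openin (topo G) U \<and> \<one>\<^bsub>G\<^esub> \<in> U \<and> (\<forall>x\<in>carrier G. \<forall>y\<in>carrier G.
      x \<otimes>\<^bsub>G\<^esub> inv\<^bsub>G\<^esub> y \<in> U \<longrightarrow> translate G t h x \<otimes>\<^bsub>K\<^esub> inv\<^bsub>K\<^esub> (translate G t h y) \<in> V)"
    if V: "openin (topo K) V" "\<one>\<^bsub>K\<^esub> \<in> V" for V
  proof -
    obtain U where U: "openin (topo G) U" "\<one>\<^bsub>G\<^esub> \<in> U" "\<forall>x\<in>carrier G. \<forall>y\<in>carrier G.
        x \<otimes>\<^bsub>G\<^esub> inv\<^bsub>G\<^esub> y \<in> U \<longrightarrow> h x \<otimes>\<^bsub>K\<^esub> inv\<^bsub>K\<^esub> (h y) \<in> V"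
      by (rule Cu_uniformly_continuous[OF h V])
    have "translate G t h x \<otimes>\<^bsub>K\<^esub> inv\<^bsub>K\<^esub> (translate G t h y) \<in> V"
      if xy: "x \<in> carrier G" "y \<in> carrier G" "x \<otimes>\<^bsub>G\<^esub> inv\<^bsub>G\<^esub> y \<in> U" for x y
      using U(3) xy t shift[OF xy(1,2)] by (simp add: translate_def)
    then show ?thesis using U(1,2) by blast
  qed
  then show ?thesis using h sub unfolding Cu_def by (simp flip: range)
qed

text \<open>The compact group is the hull, the closure of the translates. If two products \<open>s t\<close> and \<open>s' t'\<close>
  are formed from translates near \<open>a\<close> and \<open>b\<close>, then the corresponding translates differ by
  little, uniformly: first \<open>s\<close> is exchanged for \<open>s'\<close>, then \<open>t\<close> for \<open>t'\<close>, and each exchange only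
  translates a function that is uniformly small. So the multiplication of translates has a
  closure that is single-valued, and it extends continuously to the hull.\<close>

theorem almost_periodic_compactification:
  fixes G :: "'g tgroup" and K :: "'k tgroup"
  assumes G: "lcag G" and K: "lcag K" and ap: "almost_periodic G K h"
  obtains A :: "('g \<Rightarrow> 'k) tgroup" and j e where
    "lcag A" "compact_space (topo A)" "j \<in> hom G A" "continuous_map (topo G) (topo A) j"
    "topo A closure_of (j ` carrier G) = carrier A"
    "continuous_map (topo A) (topo K) e" "\<And>x. x \<in> carrier G \<Longrightarrow> e (j x) = h x"
proof -
  interpret G: lcag G by fact
  interpret K: lcag K by fact
  let ?U = "uniform_topology G K"
  let ?near = "uniformly_near G K"
  have h: "h \<in> Cu G K" using ap by (simp add: almost_periodic_def)
  define \<Omega> where "\<Omega> = ?U closure_of ((\<lambda>t. translate G t h) ` carrier G)"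
  define X where "X = subtopology ?U \<Omega>"
  \<comment> \<open>With the inverse, \<open>j t\<close> is \<open>x \<mapsto> h(x t)\<close>, and its value at \<open>1\<close> is \<open>h(t)\<close>.\<close>
  define j where "j = (\<lambda>t. translate G (inv\<^bsub>G\<^esub> t) h)"
  have top: "topspace ?U = Cu G K" by (rule topspace_uniform_topology[OF K])
  have \<Omega>: "\<Omega> \<subseteq> Cu G K" unfolding \<Omega>_def using closure_of_subset_topspace top by metis
  have topX: "topspace X = \<Omega>" using \<Omega> top by (auto simp: X_def)
  have X: "compact_space X" "Hausdorff_space X"
    using ap Hausdorff_uniform_topology[OF K, of G]
    by (auto simp: X_def \<Omega>_def almost_periodic_def compact_space_subtopology Hausdorff_space_subtopology)
  have j_apply: "j t x = h (x \<otimes>\<^bsub>G\<^esub> t)" if "t \<in> carrier G" "x \<in> carrier G" for t x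
    using that by (simp add: j_def translate_def)
  have j_Cu: "j t \<in> Cu G K" if "t \<in> carrier G" for t
    using that by (simp add: j_def translate_Cu[OF G h])
  have "(\<lambda>t. translate G t h) ` carrier G = j ` carrier G"
    by (auto simp: j_def image_iff) (metis G.inv_closed G.inv_inv)
  then have \<Omega>_eq: "\<Omega> = ?U closure_of (j ` carrier G)" by (simp add: \<Omega>_def)
  have j_range: "j ` carrier G \<subseteq> \<Omega>"
    unfolding \<Omega>_eq using j_Cu top by (intro closure_of_subset) auto
  have dense: "X closure_of (j ` carrier G) = topspace X"
  proof -
    have "X closure_of (j ` carrier G) = \<Omega> \<inter> ?U closure_of (\<Omega> \<inter> j ` carrier G)"
      unfolding X_def by (rule closure_of_subtopology)
    also have "\<Omega> \<inter> j ` carrier G = j ` carrier G" using j_range by blast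
    finally show ?thesis unfolding topX \<Omega>_eq[symmetric] by simp
  qed
  have j_mult: "j (s \<otimes>\<^bsub>G\<^esub> t) x = j s (x \<otimes>\<^bsub>G\<^esub> t)"
    if "s \<in> carrier G" "t \<in> carrier G" "x \<in> carrier G" for s t x
    using that by (simp add: j_apply G.m_ac)
  have near_mult: "?near V (j (s \<otimes>\<^bsub>G\<^esub> t)) (j (s' \<otimes>\<^bsub>G\<^esub> t))"
    if "?near V (j s) (j s')" "s \<in> carrier G" "s' \<in> carrier G" "t \<in> carrier G" for V s s' t
    using that by (simp add: uniformly_near_def j_mult)
  define R where "R = {((j s, j t), j (s \<otimes>\<^bsub>G\<^esub> t)) |s t. s \<in> carrier G \<and> t \<in> carrier G}"
  let ?P = "prod_topology (prod_topology X X) X"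
  \<comment> \<open>Every point of the closure of the relation is uniformly approximated by points of it.\<close>
  have approx: "\<exists>s\<in>carrier G. \<exists>t\<in>carrier G.
      ?near V (j s) a \<and> ?near V (j t) b \<and> ?near V (j (s \<otimes>\<^bsub>G\<^esub> t)) c"
    if abc: "((a, b), c) \<in> ?P closure_of R" and V: "openin (topo K) V" "\<one>\<^bsub>K\<^esub> \<in> V" for a b c V
  proof -
    have mem: "a \<in> \<Omega>" "b \<in> \<Omega>" "c \<in> \<Omega>" using abc topX by (auto simp: in_closure_of)
    then have "a \<in> Cu G K" "b \<in> Cu G K" "c \<in> Cu G K" using \<Omega> by auto
    then obtain \<A> \<B> \<C> where
      A: "openin ?U \<A>" "a \<in> \<A>" "\<And>k. k \<in> \<A> \<Longrightarrow> ?near V k a" and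
      B: "openin ?U \<B>" "b \<in> \<B>" "\<And>k. k \<in> \<B> \<Longrightarrow> ?near V k b" and
      C: "openin ?U \<C>" "c \<in> \<C>" "\<And>k. k \<in> \<C> \<Longrightarrow> ?near V k c"
      using uniform_neighbourhood[OF K _ V, of a G] uniform_neighbourhood[OF K _ V, of b G]
        uniform_neighbourhood[OF K _ V, of c G] by metis
    let ?N = "((\<A> \<inter> \<Omega>) \<times> (\<B> \<inter> \<Omega>)) \<times> (\<C> \<inter> \<Omega>)"
    have "openin ?P ?N"
      by (intro openin_prod_Times_iff[THEN iffD2] disjI2 conjI)
        (auto simp: X_def openin_subtopology_Int A B C)
    moreover have "((a, b), c) \<in> ?N" using A B C mem by simp
    ultimately have "\<exists>y. y \<in> R \<and> y \<in> ?N"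
      using abc[unfolded in_closure_of, THEN conjunct2, rule_format, of ?N] by blast
    then show ?thesis using A(3) B(3) C(3) unfolding R_def by blast
  qed
  have single: "c = d" if c: "(ab, c) \<in> ?P closure_of R" and d: "(ab, d) \<in> ?P closure_of R" for ab c d
  proof (rule ccontr)
    assume "c \<noteq> d"
    obtain a b where ab: "ab = (a, b)" by (cases ab)
    have Cu: "a \<in> Cu G K" "b \<in> Cu G K" "c \<in> Cu G K" "d \<in> Cu G K"
      using c d \<Omega> unfolding ab by (auto simp: in_closure_of topX)
    then obtain x where x: "x \<in> carrier G" "c x \<noteq> d x" using \<open>c \<noteq> d\<close> Cu_eqI by blast
    obtain V where V: "openin (topo K) V" "\<one>\<^bsub>K\<^esub> \<in> V" "c x \<otimes>\<^bsub>K\<^esub> inv\<^bsub>K\<^esub> d x \<notin> V"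
      using K.separate_in_neighbourhood[OF Cu_closed[OF Cu(3) x(1)] Cu_closed[OF Cu(4) x(1)] x(2)]
      by metis
    \<comment> \<open>The chain \<open>c\<close>, \<open>j(s t)\<close>, \<open>j(s' t)\<close>, \<open>j(s' t')\<close>, \<open>d\<close> has four steps; each costs at most \<open>V2\<close>, the two
      middle ones being sums of two steps through \<open>a\<close> and \<open>b\<close> that cost \<open>V3\<close>.\<close>
    obtain V1 where V1: "openin (topo K) V1" "\<one>\<^bsub>K\<^esub> \<in> V1" "\<And>x. x \<in> V1 \<Longrightarrow> inv\<^bsub>K\<^esub> x \<in> V1"
      "\<And>x y. x \<in> V1 \<Longrightarrow> y \<in> V1 \<Longrightarrow> x \<otimes>\<^bsub>K\<^esub> y \<in> V"
      using K.neighbourhood_halving[OF V(1,2)] by metis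
    obtain V2 where V2: "openin (topo K) V2" "\<one>\<^bsub>K\<^esub> \<in> V2" "\<And>x. x \<in> V2 \<Longrightarrow> inv\<^bsub>K\<^esub> x \<in> V2"
      "\<And>x y. x \<in> V2 \<Longrightarrow> y \<in> V2 \<Longrightarrow> x \<otimes>\<^bsub>K\<^esub> y \<in> V1"
      using K.neighbourhood_halving[OF V1(1,2)] by metis
    obtain V3 where V3: "openin (topo K) V3" "\<one>\<^bsub>K\<^esub> \<in> V3" "\<And>x. x \<in> V3 \<Longrightarrow> inv\<^bsub>K\<^esub> x \<in> V3"
      "\<And>x y. x \<in> V3 \<Longrightarrow> y \<in> V3 \<Longrightarrow> x \<otimes>\<^bsub>K\<^esub> y \<in> V2"
      using K.neighbourhood_halving[OF V2(1,2)] by metis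
    obtain s t where st: "s \<in> carrier G" "t \<in> carrier G" "?near V3 (j s) a" "?near V3 (j t) b"
      "?near V3 (j (s \<otimes>\<^bsub>G\<^esub> t)) c"
      using approx[OF c[unfolded ab] V3(1,2)] by blast
    obtain s' t' where st': "s' \<in> carrier G" "t' \<in> carrier G" "?near V3 (j s') a" "?near V3 (j t') b"
      "?near V3 (j (s' \<otimes>\<^bsub>G\<^esub> t')) d"
      using approx[OF d[unfolded ab] V3(1,2)] by blast
    note j_Cu' = j_Cu[OF st(1)] j_Cu[OF st(2)] j_Cu[OF st'(1)] j_Cu[OF st'(2)]
      j_Cu[OF G.m_closed[OF st(1,2)]] j_Cu[OF G.m_closed[OF st'(1,2)]]
      j_Cu[OF G.m_closed[OF st'(1) st(2)]]
    have "?near V2 (j s) (j s')"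
      by (rule uniformly_near_trans[OF K st(3) uniformly_near_sym[OF K st'(3) V3(3)] V3(4)])
        (use Cu j_Cu' in simp_all)
    then have 1: "?near V2 (j (s \<otimes>\<^bsub>G\<^esub> t)) (j (s' \<otimes>\<^bsub>G\<^esub> t))" using st st' by (intro near_mult)
    have "?near V2 (j t) (j t')"
      by (rule uniformly_near_trans[OF K st(4) uniformly_near_sym[OF K st'(4) V3(3)] V3(4)])
        (use Cu j_Cu' in simp_all)
    then have "?near V2 (j (t \<otimes>\<^bsub>G\<^esub> s')) (j (t' \<otimes>\<^bsub>G\<^esub> s'))" using st st' by (intro near_mult)
    then have 2: "?near V2 (j (s' \<otimes>\<^bsub>G\<^esub> t)) (j (s' \<otimes>\<^bsub>G\<^esub> t'))" using st st' by (simp add: G.m_comm)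
    have 3: "?near V1 (j (s \<otimes>\<^bsub>G\<^esub> t)) (j (s' \<otimes>\<^bsub>G\<^esub> t'))"
      by (rule uniformly_near_trans[OF K 1 2 V2(4)]) (use j_Cu' in simp_all)
    have "V3 \<subseteq> V2"
      using V3(4)[OF _ V3(2)] K.openin_subset_carrier[OF V3(1)] by (metis K.r_one subsetD subsetI)
    then have 3: "?near V2 c (j (s \<otimes>\<^bsub>G\<^esub> t))" "?near V2 (j (s' \<otimes>\<^bsub>G\<^esub> t')) d"
      using uniformly_near_sym[OF K st(5) V3(3)] st'(5) Cu j_Cu'
      by (auto simp: uniformly_near_def)
    have "?near V1 c (j (s' \<otimes>\<^bsub>G\<^esub> t))"
      by (rule uniformly_near_trans[OF K 3(1) 1 V2(4)]) (use Cu j_Cu' in simp_all)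
    moreover have "?near V1 (j (s' \<otimes>\<^bsub>G\<^esub> t)) d"
      by (rule uniformly_near_trans[OF K 2 3(2) V2(4)]) (use Cu j_Cu' in simp_all)
    ultimately have "?near V c d"
      by (rule uniformly_near_trans[OF K _ _ V1(4)]) (use Cu j_Cu' in simp_all)
    then show False using x(1) V(3) by (simp add: uniformly_near_def)
  qed
  have "fst ` R = j ` carrier G \<times> j ` carrier G" by (force simp: R_def)
  then have dense_R: "prod_topology X X closure_of (fst ` R) = topspace (prod_topology X X)"
    using dense by (simp add: closure_of_Times)
  have R: "R \<subseteq> topspace (prod_topology X X) \<times> topspace X"
    using j_range by (auto simp: R_def topX)
  have "\<exists>m. continuous_map (prod_topology X X) X m \<and> (\<forall>x y. (x, y) \<in> R \<longrightarrow> m x = y)"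
    by (rule continuous_map_of_closed_relation[OF X(1) R dense_R single])
  then obtain m where m: "continuous_map (prod_topology X X) X m"
    and m_R: "\<forall>x y. (x, y) \<in> R \<longrightarrow> m x = y"
    by blast
  have j_X: "j \<in> carrier G \<rightarrow> topspace X" using j_range topX by blast
  have m_j: "m (j s, j t) = j (s \<otimes>\<^bsub>G\<^esub> t)" if "s \<in> carrier G" "t \<in> carrier G" for s t
  proof -
    have "((j s, j t), j (s \<otimes>\<^bsub>G\<^esub> t)) \<in> R" using that by (auto simp: R_def)
    then show ?thesis using m_R by blast
  qed
  define A where "A = \<lparr>carrier = topspace X, mult = (\<lambda>x y. m (x, y)), one = j \<one>\<^bsub>G\<^esub>, topo = X\<rparr>"
  note A = compact_group_of_dense_hom[OF G.comm_group_axioms X j_X dense m m_j A_def]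
  have topo_A: "topo A = X" "carrier A = topspace X" by (simp_all add: A_def)
  have "continuous_map (topo G) ?U j"
    unfolding continuous_map_def top G.topspace_topo
  proof (intro conjI allI impI)
    show "j \<in> carrier G \<rightarrow> Cu G K" using j_Cu by blast
    fix N assume N: "openin ?U N"
    show "openin (topo G) {t \<in> carrier G. j t \<in> N}"
    proof (subst openin_subopen, intro ballI)
      fix t assume "t \<in> {t \<in> carrier G. j t \<in> N}"
      then have t: "t \<in> carrier G" "j t \<in> N" by auto
      then obtain V where V: "openin (topo K) V" "\<one>\<^bsub>K\<^esub> \<in> V"
        "{k \<in> Cu G K. \<forall>x\<in>carrier G. k x \<otimes>\<^bsub>K\<^esub> inv\<^bsub>K\<^esub> (j t x) \<in> V} \<subseteq> N"
        using N unfolding openin_uniform_topology by meson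
      obtain U where U: "openin (topo G) U" "\<one>\<^bsub>G\<^esub> \<in> U" "\<forall>x\<in>carrier G. \<forall>y\<in>carrier G.
          x \<otimes>\<^bsub>G\<^esub> inv\<^bsub>G\<^esub> y \<in> U \<longrightarrow> h x \<otimes>\<^bsub>K\<^esub> inv\<^bsub>K\<^esub> (h y) \<in> V"
        by (rule Cu_uniformly_continuous[OF h V(1,2)])
      let ?T = "{s \<in> carrier G. s \<otimes>\<^bsub>G\<^esub> inv\<^bsub>G\<^esub> t \<in> U}"
      have "openin (topo G) ?T" using t U by (intro G.openin_preimage G.topology_intros) auto
      moreover have "t \<in> ?T" using t U by simp
      moreover have "j s \<in> N" if s: "s \<in> ?T" for s
      proof -
        have "(x \<otimes>\<^bsub>G\<^esub> s) \<otimes>\<^bsub>G\<^esub> inv\<^bsub>G\<^esub> (x \<otimes>\<^bsub>G\<^esub> t) = s \<otimes>\<^bsub>G\<^esub> inv\<^bsub>G\<^esub> t" if "x \<in> carrier G" for x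
          using that s t by (simp add: G.inv_mult G.m_ac G.cancel_inv)
        then have "j s x \<otimes>\<^bsub>K\<^esub> inv\<^bsub>K\<^esub> (j t x) \<in> V" if "x \<in> carrier G" for x
          using U(3) that s t by (simp add: j_apply)
        then show ?thesis using V(3) j_Cu s by blast
      qed
      ultimately show "\<exists>T. openin (topo G) T \<and> t \<in> T \<and> T \<subseteq> {t \<in> carrier G. j t \<in> N}"
        by (intro exI[of _ ?T]) blast
    qed
  qed
  then have j_cont: "continuous_map (topo G) (topo A) j"
    using j_range unfolding topo_A X_def by (auto simp: continuous_map_in_subtopology G.topspace_topo)
  have "continuous_map (topo A) (topo K) (\<lambda>\<omega>. \<omega> \<one>\<^bsub>G\<^esub>)"
    unfolding topo_A X_def
    by (intro continuous_map_from_subtopology continuous_map_evaluation K G.one_closed)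
  moreover have "j x \<one>\<^bsub>G\<^esub> = h x" if "x \<in> carrier G" for x using that by (simp add: j_apply)
  ultimately show ?thesis
    using that A j_cont X(1) dense by (simp add: topo_A)
qed


section \<open>Moving groups to another type\<close>

text \<open>For \<open>e\<close> injective on the carrier, this is the group structure and the topology that make \<open>e\<close> an
  isomorphism and a homeomorphism onto its range.\<close>

definition image_tgroup :: "('a \<Rightarrow> 'b) \<Rightarrow> 'a tgroup \<Rightarrow> 'b tgroup" where
  "image_tgroup e A = (let u = inv_into (carrier A) e in
     \<lparr>carrier = e ` carrier A, mult = (\<lambda>x y. e (u x \<otimes>\<^bsub>A\<^esub> u y)), one = e \<one>\<^bsub>A\<^esub>,
      topo = quotient_topology (topo A) e\<rparr>)"

lemma image_tgroup:
  assumes A: "lcag A" and e: "inj_on e (carrier A)"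
  shows "lcag (image_tgroup e A)" "e \<in> hom A (image_tgroup e A)"
    "homeomorphic_map (topo A) (topo (image_tgroup e A)) e"
    "continuous_map (topo (image_tgroup e A)) (topo A) (inv_into (carrier A) e)"
    "carrier (image_tgroup e A) = e ` carrier A" "\<one>\<^bsub>image_tgroup e A\<^esub> = e \<one>\<^bsub>A\<^esub>"
proof -
  interpret A: lcag A by fact
  let ?I = "image_tgroup e A"
  define u where "u = inv_into (carrier A) e"
  have u: "u (e x) = x" if "x \<in> carrier A" for x using that e by (simp add: u_def)
  have I: "carrier ?I = e ` carrier A" "\<one>\<^bsub>?I\<^esub> = e \<one>\<^bsub>A\<^esub>" "topo ?I = quotient_topology (topo A) e"
    "x \<otimes>\<^bsub>?I\<^esub> y = e (u x \<otimes>\<^bsub>A\<^esub> u y)" for x y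
    by (simp_all add: image_tgroup_def Let_def u_def)
  show "carrier ?I = e ` carrier A" "\<one>\<^bsub>?I\<^esub> = e \<one>\<^bsub>A\<^esub>" by (fact I)+
  have q: "quotient_map (topo A) (topo ?I) e" unfolding I by (rule quotient_map_quotient_topology)
  show homeo: "homeomorphic_map (topo A) (topo ?I) e"
    using q e by (simp add: homeomorphic_map_def A.topspace_topo)
  have top: "topspace (topo ?I) = e ` carrier A"
    using quotient_imp_surjective_map[OF q] by (simp add: A.topspace_topo)
  have e_cont: "continuous_map (topo A) (topo ?I) e" by (rule quotient_imp_continuous_map[OF q])
  have "continuous_map (topo A) (topo A) (u \<circ> e)"
    by (rule continuous_map_eq[OF continuous_map_id]) (simp add: u A.topspace_topo)
  then have u_cont: "continuous_map (topo ?I) (topo A) u" by (rule continuous_compose_quotient_map[OF q])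
  then show "continuous_map (topo ?I) (topo A) (inv_into (carrier A) e)" by (simp add: u_def)
  show hom: "e \<in> hom A ?I" by (auto simp: hom_def I u)
  interpret I: comm_group ?I
  proof (rule comm_groupI)
    fix x assume "x \<in> carrier ?I"
    then obtain a where "a \<in> carrier A" "x = e a" by (auto simp: I)
    then show "\<exists>y\<in>carrier ?I. y \<otimes>\<^bsub>?I\<^esub> x = \<one>\<^bsub>?I\<^esub>"
      by (intro bexI[of _ "e (inv\<^bsub>A\<^esub> a)"]) (auto simp: I u)
  qed (auto simp: I u A.m_ac)
  have inv: "inv\<^bsub>?I\<^esub> x = e (inv\<^bsub>A\<^esub> u x)" if "x \<in> e ` carrier A" for x
    using that by (intro I.inv_equality) (auto simp: I u)
  show "lcag ?I"
  proof
    let ?P = "prod_topology (topo ?I) (topo ?I)"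
    have "continuous_map ?P (topo A) (\<lambda>z. u (fst z))" "continuous_map ?P (topo A) (\<lambda>z. u (snd z))"
      using continuous_map_compose[OF continuous_map_fst u_cont]
        continuous_map_compose[OF continuous_map_snd u_cont] by (simp_all add: o_def)
    then have "continuous_map ?P (topo A) (\<lambda>z. u (fst z) \<otimes>\<^bsub>A\<^esub> u (snd z))"
      by (rule A.topology_mult)
    then show "continuous_map ?P (topo ?I) (\<lambda>(x, y). x \<otimes>\<^bsub>?I\<^esub> y)"
      using continuous_map_compose[OF _ e_cont] by (fastforce simp: I(4) o_def case_prod_beta')
    have "continuous_map (topo ?I) (topo ?I) (\<lambda>x. e (inv\<^bsub>A\<^esub> u x))"
      using continuous_map_compose[OF A.topology_inv[OF u_cont] e_cont] by (simp add: o_def)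
    then show "continuous_map (topo ?I) (topo ?I) (\<lambda>x. inv\<^bsub>?I\<^esub> x)"
      by (rule continuous_map_eq) (simp add: inv top)
    have "topo A homeomorphic_space topo ?I"
      using homeo by (rule homeomorphic_map_imp_homeomorphic_space)
    then show "Hausdorff_space (topo ?I)" "locally_compact_space (topo ?I)"
      using A.Hausdorff A.locally_compact homeomorphic_Hausdorff_space
        homeomorphic_locally_compact_space by metis+
    show "topspace (topo ?I) = carrier ?I" by (rule trans[OF top I(1)[symmetric]])
  qed
qed

text \<open>In a Hausdorff space with a dense image of \<open>S\<close>, a point is determined by the traces of its
  neighbourhoods on \<open>S\<close>.\<close>

lemma inj_on_neighbourhood_traces:
  assumes X: "Hausdorff_space X" and dense: "X closure_of (j ` S) = topspace X"
  shows "inj_on (\<lambda>x. (\<lambda>V. {s \<in> S. j s \<in> V}) ` {V. openin X V \<and> x \<in> V}) (topspace X)"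
proof (rule inj_onI, rule ccontr)
  fix x y assume xy: "x \<in> topspace X" "y \<in> topspace X" "x \<noteq> y"
    and eq: "(\<lambda>V. {s \<in> S. j s \<in> V}) ` {V. openin X V \<and> x \<in> V} =
      (\<lambda>V. {s \<in> S. j s \<in> V}) ` {V. openin X V \<and> y \<in> V}"
  obtain U V where UV: "openin X U" "openin X V" "x \<in> U" "y \<in> V" "disjnt U V"
    using X xy unfolding Hausdorff_space_def by meson
  have "{s \<in> S. j s \<in> U} \<in> (\<lambda>V. {s \<in> S. j s \<in> V}) ` {V. openin X V \<and> y \<in> V}"
    unfolding eq[symmetric] using UV by blast
  then obtain W where W: "openin X W" "y \<in> W" "{s \<in> S. j s \<in> U} = {s \<in> S. j s \<in> W}" by auto
  have "y \<in> X closure_of (j ` S)" using dense xy by simp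
  then have "\<exists>z. z \<in> j ` S \<and> z \<in> W \<inter> V"
    using UV W openin_Int[of X W V]
    unfolding in_closure_of by (elim conjE allE[of _ "W \<inter> V"]) blast
  then obtain s where s: "s \<in> S" "j s \<in> W" "j s \<in> V" by blast
  then have "s \<in> {s \<in> S. j s \<in> U}" unfolding W(3) by simp
  then show False using s UV(5) by (auto simp: disjnt_def)
qed

text \<open>The hull, moved to sets of subsets of \<open>G\<close>, is one of the compact groups to which the universal
  property of the Bohr compactification applies.\<close>

theorem almost_periodic_extends_to_Bohr:
  fixes G :: "'g tgroup" and K :: "'k tgroup" and B :: "'b tgroup"
  assumes G: "lcag G" and K: "lcag K" and bohr: "bohr_compactification G B i"
    and ap: "almost_periodic G K h"
  shows "\<exists>h'. continuous_map (topo B) (topo K) h' \<and> (\<forall>x\<in>carrier G. h x = h' (i x))"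
proof -
  obtain A :: "('g \<Rightarrow> 'k) tgroup" and j e where
    A: "lcag A" "compact_space (topo A)" "j \<in> hom G A" "continuous_map (topo G) (topo A) j"
    "topo A closure_of (j ` carrier G) = carrier A"
    "continuous_map (topo A) (topo K) e" and e: "\<And>x. x \<in> carrier G \<Longrightarrow> e (j x) = h x"
    by (rule almost_periodic_compactification[OF G K ap]) (rule that)
  interpret A: lcag A by fact
  define c where "c = (\<lambda>x. (\<lambda>V. {s \<in> carrier G. j s \<in> V}) ` {V. openin (topo A) V \<and> x \<in> V})"
  have c: "inj_on c (carrier A)"
    using inj_on_neighbourhood_traces[OF A.Hausdorff] A(5) unfolding c_def A.topspace_topo by blast
  note C = image_tgroup[OF A(1) c]
  define C :: "'g set set tgroup" where "C = image_tgroup c A"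
  have "compact_space (topo C)"
    using A(2) homeomorphic_compact_space[OF homeomorphic_map_imp_homeomorphic_space[OF C(3)]]
    by (simp add: C_def)
  moreover have "c \<circ> j \<in> hom G C" using hom_compose[OF A(3) C(2)] by (simp add: C_def)
  moreover have "continuous_map (topo G) (topo C) (c \<circ> j)"
    using continuous_map_compose[OF A(4) homeomorphic_imp_continuous_map[OF C(3)]]
    by (simp add: C_def)
  moreover have "lcag C" using C(1) by (simp add: C_def)
  moreover have "\<forall>(K :: 'g set set tgroup) h. lcag K \<and> compact_space (topo K) \<and>
      h \<in> hom G K \<and> continuous_map (topo G) (topo K) h \<longrightarrow>
      (\<exists>k\<in>hom B K. continuous_map (topo B) (topo K) k \<and> (\<forall>x\<in>carrier G. k (i x) = h x))"
    using bohr unfolding bohr_compactification_def by (elim conjE)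
  note this[THEN spec, of C, THEN spec, of "c \<circ> j"]
  ultimately obtain k where k: "continuous_map (topo B) (topo C) k"
    "\<forall>x\<in>carrier G. k (i x) = (c \<circ> j) x"
    by blast
  let ?h = "e \<circ> (inv_into (carrier A) c \<circ> k)"
  have "continuous_map (topo B) (topo K) ?h"
    using k(1) C(4) A(6) unfolding C_def by (intro continuous_map_compose)
  moreover have "h x = ?h (i x)" if "x \<in> carrier G" for x
  proof -
    have "j x \<in> carrier A" using A(3) that by (auto simp: hom_def)
    then show ?thesis using k(2) that c e by simp
  qed
  ultimately show ?thesis by blast
qed

section \<open>Independence of the type of the internal group\<close>

lemma cps_image:
  assumes cps: "cps G H L" and e: "inj_on e (carrier H)"
  shows "cps G (image_tgroup e H) ((\<lambda>z. (fst z, e (snd z))) ` L)"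
proof -
  let ?I = "image_tgroup e H" and ?f = "\<lambda>z. (fst z, e (snd z))"
  interpret G: lcag G using cpsD[OF cps] by blast
  interpret H: lcag H using cpsD[OF cps] by blast
  interpret P: lcag "prod_tgroup G H" using cpsD[OF cps] by blast
  note I = image_tgroup[OF cpsD(2)[OF cps] e]
  interpret I: lcag ?I by (rule I)
  interpret Q: lcag "prod_tgroup G ?I" by (intro lcag_prod_tgroup) unfold_locales
  define u where "u = inv_into (carrier H) e"
  have u: "u (e h) = h" if "h \<in> carrier H" for h using that e by (simp add: u_def)
  have LP: "L \<subseteq> carrier G \<times> carrier H" using subgroup.subset[OF cpsD(5)[OF cps]] by simp
  have hom: "?f \<in> hom (prod_tgroup G H) (prod_tgroup G ?I)"
    using I(2) by (auto simp: hom_def)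
  interpret f: group_hom "prod_tgroup G H" "prod_tgroup G ?I" ?f
    using hom by unfold_locales
  have "continuous_map (prod_topology (topo G) (topo H)) (topo ?I) (e \<circ> snd)"
    by (rule continuous_map_compose[OF continuous_map_snd homeomorphic_imp_continuous_map[OF I(3)]])
  then have f_cont: "continuous_map (topo (prod_tgroup G H)) (topo (prod_tgroup G ?I)) ?f"
    by (simp add: continuous_map_paired continuous_map_fst o_def)
  have "continuous_map (prod_topology (topo G) (topo ?I)) (topo H) (u \<circ> snd)"
    unfolding u_def by (rule continuous_map_compose[OF continuous_map_snd I(4)])
  then have g_cont: "continuous_map (topo (prod_tgroup G ?I)) (topo (prod_tgroup G H))
      (\<lambda>z. (fst z, u (snd z)))"
    by (simp add: continuous_map_paired continuous_map_fst o_def)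
  obtain U C where U: "openin (topo (prod_tgroup G H)) U" "\<one>\<^bsub>prod_tgroup G H\<^esub> \<in> U"
      "U \<inter> L \<subseteq> {\<one>\<^bsub>prod_tgroup G H\<^esub>}"
    and C: "compactin (topo (prod_tgroup G H)) C"
      "\<forall>x\<in>carrier (prod_tgroup G H). \<exists>l\<in>L. \<exists>c\<in>C. x = l \<otimes>\<^bsub>prod_tgroup G H\<^esub> c"
    using cpsD(4)[OF cps] unfolding lattice_in_iff[OF cpsD(3)[OF cps]] by blast
  have "lattice_in (?f ` L) (prod_tgroup G ?I)"
    unfolding lattice_in_iff[OF Q.lcag_axioms]
  proof (intro conjI)
    show "subgroup (?f ` L) (prod_tgroup G ?I)"
      by (rule f.subgroup_img_is_subgroup[OF cpsD(5)[OF cps]])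
    let ?V = "{z \<in> topspace (topo (prod_tgroup G ?I)). (fst z, u (snd z)) \<in> U}"
    have "openin (topo (prod_tgroup G ?I)) ?V" by (rule openin_continuous_map_preimage[OF g_cont U(1)])
    moreover have "\<one>\<^bsub>prod_tgroup G ?I\<^esub> \<in> ?V"
      using U(2) Q.one_closed unfolding Q.topspace_topo by (simp add: I u)
    moreover have "?V \<inter> ?f ` L \<subseteq> {\<one>\<^bsub>prod_tgroup G ?I\<^esub>}"
    proof
      fix z assume "z \<in> ?V \<inter> ?f ` L"
      then obtain l h where z: "(l, h) \<in> L" "z = (l, e h)" "(l, u (e h)) \<in> U" by auto
      then have "(l, h) \<in> U \<inter> L" using LP u by auto
      then show "z \<in> {\<one>\<^bsub>prod_tgroup G ?I\<^esub>}" using U(3) z by (auto simp: I)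
    qed
    ultimately show "\<exists>U. openin (topo (prod_tgroup G ?I)) U \<and> \<one>\<^bsub>prod_tgroup G ?I\<^esub> \<in> U \<and>
        U \<inter> ?f ` L \<subseteq> {\<one>\<^bsub>prod_tgroup G ?I\<^esub>}" by blast
    have "\<exists>l\<in>?f ` L. \<exists>c\<in>?f ` C. y = l \<otimes>\<^bsub>prod_tgroup G ?I\<^esub> c"
      if y: "y \<in> carrier (prod_tgroup G ?I)" for y
    proof -
      obtain a b where ab: "y = (a, b)" by (cases y)
      then obtain h where h: "h \<in> carrier H" "b = e h" using y by (auto simp: I)
      then have ah: "a \<in> carrier G" "h \<in> carrier H" "y = ?f (a, h)" using y ab by auto
      then obtain l c where lc: "l \<in> L" "c \<in> C" "(a, h) = l \<otimes>\<^bsub>prod_tgroup G H\<^esub> c"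
        using C(2)[rule_format, of "(a, h)"] by auto
      have "?f (l \<otimes>\<^bsub>prod_tgroup G H\<^esub> c) = ?f l \<otimes>\<^bsub>prod_tgroup G ?I\<^esub> ?f c"
        using lc LP P.compactin_subset_carrier[OF C(1)] by (intro f.hom_mult) auto
      then show ?thesis using ah lc by auto
    qed
    moreover have "compactin (topo (prod_tgroup G ?I)) (?f ` C)" by (rule image_compactin[OF C(1) f_cont])
    ultimately show "\<exists>C. compactin (topo (prod_tgroup G ?I)) C \<and>
        (\<forall>x\<in>carrier (prod_tgroup G ?I). \<exists>l\<in>?f ` L. \<exists>c\<in>C. x = l \<otimes>\<^bsub>prod_tgroup G ?I\<^esub> c)"
      by blast
  qed
  moreover have "inj_on fst (?f ` L)"
    using cpsD(6)[OF cps] by (auto simp: inj_on_def)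
  moreover have "topo ?I closure_of (snd ` ?f ` L) = carrier ?I"
  proof -
    have "snd ` ?f ` L = e ` snd ` L" by force
    moreover have "snd ` L \<subseteq> topspace (topo H)" using LP by (auto simp: H.topspace_topo)
    ultimately show ?thesis
      using homeomorphic_map_closure_of[OF I(3)] cpsD(7)[OF cps] by (simp add: I)
  qed
  ultimately show ?thesis unfolding cps_def using G.lcag_axioms I(1) by blast
qed

text \<open>The weight is set to \<open>0\<close> off the new carrier, since the inverse of \<open>e\<close> is arbitrary there.\<close>

lemma deformed_comb_image:
  assumes cps: "cps G H L" and e: "inj_on e (carrier H)" and f: "f \<in> Cc H"
  shows "\<exists>f'\<in>Cc (image_tgroup e H). deformed_comb G ((\<lambda>z. (fst z, e (snd z))) ` L) f'
    (p \<circ> inv_into (carrier H) e) = deformed_comb G L f p"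
proof -
  let ?I = "image_tgroup e H" and ?L = "(\<lambda>z. (fst z, e (snd z))) ` L"
  let ?u = "inv_into (carrier H) e"
  interpret H: lcag H using cpsD[OF cps] by blast
  note I = image_tgroup[OF cpsD(2)[OF cps] e]
  interpret I: lcag ?I by (rule I)
  define f' where "f' = (\<lambda>y. if y \<in> carrier ?I then f (?u y) else 0)"
  obtain K where K: "compactin (topo H) K" "\<forall>h. h \<notin> K \<longrightarrow> f h = 0"
    using f by (auto simp: Cc_def)
  have "continuous_map (topo H) euclidean f" using f by (simp add: Cc_def)
  then have "continuous_map (topo ?I) euclidean f'"
    by (rule continuous_map_eq[OF continuous_map_compose[OF I(4)]])
      (simp add: f'_def I.topspace_topo)
  moreover have "f' y = 0" if "y \<notin> e ` K" for y
    using that K(2) by (auto simp: f'_def I(5) inv_into_f_f[OF e])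
  moreover have "compactin (topo ?I) (e ` K)"
    by (rule image_compactin[OF K(1) homeomorphic_imp_continuous_map[OF I(3)]])
  ultimately have "f' \<in> Cc ?I" by (auto simp: Cc_def)
  moreover have "deformed_comb G ?L f' (p \<circ> ?u) = deformed_comb G L f p"
  proof -
    have fst: "fst ` ?L = fst ` L" by force
    have star: "star ?L l = e (star L l)" "star L l \<in> carrier H" if "l \<in> fst ` L" for l
    proof -
      have "(l, e (star L l)) \<in> ?L" using star_mem[OF cpsD(6)[OF cps] that] by force
      then show "star ?L l = e (star L l)" by (rule star_eq[OF cpsD(6)[OF cps_image[OF cps e]]])
      show "star L l \<in> carrier H" using cps_star_closed[OF cps that] by simp
    qed
    show ?thesis unfolding deformed_comb_def fst
      by (intro restrict_ext infsum_cong) (simp add: star f'_def I(5) inv_into_f_f[OF e])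
  qed
  ultimately show ?thesis by blast
qed

text \<open>The internal group has the image of \<open>L\<close> as a dense subset, so that its points can be named by
  sets of subsets of \<open>G\<close>.\<close>

lemma cps_internal_injection:
  fixes G :: "'g tgroup" and H :: "'k tgroup"
  assumes cps: "cps G H L"
  obtains e :: "'k \<Rightarrow> 'g set set" where "inj_on e (carrier H)"
proof -
  interpret H: lcag H using cpsD[OF cps] by blast
  have "star L ` fst ` L = snd ` L" using star_eq[OF cpsD(6)[OF cps]] by force
  then have "topo H closure_of (star L ` fst ` L) = topspace (topo H)"
    using cpsD(7)[OF cps] by (simp add: H.topspace_topo)
  from inj_on_neighbourhood_traces[OF H.Hausdorff this] show ?thesis
    using that by (simp add: H.topspace_topo)
qed

lemma deformed_class_subset:
  "deformed_class TYPE('k) (G :: 'g tgroup) \<subseteq> deformed_class TYPE('g set set) G"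
proof
  fix \<nu> assume "\<nu> \<in> deformed_class TYPE('k) G"
  then obtain H :: "'k tgroup" and L f p where cps: "cps G H L" and \<nu>: "radon_measure G \<nu>"
    and f: "f \<in> Cc H" and p: "continuous_map (topo H) (topo G) p"
    and eq: "\<nu> = deformed_comb G L f p"
    unfolding deformed_class_def deformed_weighted_model_set_def by blast
  obtain e :: "'k \<Rightarrow> 'g set set" where e: "inj_on e (carrier H)"
    by (rule cps_internal_injection[OF cps])
  let ?I = "image_tgroup e H"
  note I = image_tgroup[OF cpsD(2)[OF cps] e]
  have "continuous_map (topo ?I) (topo G) (p \<circ> inv_into (carrier H) e)"
    by (rule continuous_map_compose[OF I(4) p])
  moreover obtain f' where "f' \<in> Cc ?I"
    "deformed_comb G ((\<lambda>z. (fst z, e (snd z))) ` L) f' (p \<circ> inv_into (carrier H) e) = \<nu>"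
    using deformed_comb_image[OF cps e f, of p] eq by blast
  ultimately have "deformed_weighted_model_set G ?I ((\<lambda>z. (fst z, e (snd z))) ` L) \<nu>"
    unfolding deformed_weighted_model_set_def using cps_image[OF cps e] \<nu> by blast
  then show "\<nu> \<in> deformed_class TYPE('g set set) G" unfolding deformed_class_def by blast
qed

lemma modulation_class_subset:
  "modulation_class TYPE('k) (G :: 'g tgroup) \<subseteq> modulation_class TYPE('g set set) G"
proof
  fix \<mu> assume "\<mu> \<in> modulation_class TYPE('k) G"
  then obtain H :: "'k tgroup" and L \<nu> f where cps: "cps G H L" and \<nu>: "radon_measure G \<nu>"
    and f: "f \<in> Cc H" and eq: "\<nu> = deformed_comb G L f (\<lambda>_. \<one>\<^bsub>G\<^esub>)"
    and \<mu>: "is_modulation G \<nu> \<mu>"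
    unfolding modulation_class_def weighted_model_set_def by blast
  obtain e :: "'k \<Rightarrow> 'g set set" where e: "inj_on e (carrier H)"
    by (rule cps_internal_injection[OF cps])
  obtain f' where "f' \<in> Cc (image_tgroup e H)"
    "deformed_comb G ((\<lambda>z. (fst z, e (snd z))) ` L) f' (\<lambda>_. \<one>\<^bsub>G\<^esub>) = \<nu>"
    using deformed_comb_image[OF cps e f, of "\<lambda>_. \<one>\<^bsub>G\<^esub>"] eq by (auto simp: comp_def)
  then have "weighted_model_set G (image_tgroup e H) ((\<lambda>z. (fst z, e (snd z))) ` L) \<nu>"
    unfolding weighted_model_set_def using cps_image[OF cps e] \<nu> by blast
  then show "\<mu> \<in> modulation_class TYPE('g set set) G" using \<mu> unfolding modulation_class_def by blast
qed


section \<open>Almost periodic functions from periodic functions\<close>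

text \<open>On the compact set \<open>C \<times> {1}\<close> the function \<open>F(c u) F(c)\<^sup>-\<^sup>1\<close> is trivial; the tube lemma makes the
  neighbourhood of \<open>1\<close> uniform in \<open>c \<in> C\<close>, and periodicity makes it uniform in all points.\<close>

lemma periodic_uniformly_continuous:
  assumes A: "lcag A" and K: "lcag K" and F: "continuous_map (topo A) (topo K) F"
    and L: "L \<subseteq> carrier A" and per: "\<forall>l\<in>L. \<forall>z\<in>carrier A. F (l \<otimes>\<^bsub>A\<^esub> z) = F z"
    and C: "compactin (topo A) C" "\<forall>x\<in>carrier A. \<exists>l\<in>L. \<exists>c\<in>C. x = l \<otimes>\<^bsub>A\<^esub> c"
    and V: "openin (topo K) V" "\<one>\<^bsub>K\<^esub> \<in> V"
  shows "\<exists>U. openin (topo A) U \<and> \<one>\<^bsub>A\<^esub> \<in> U \<and>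
    (\<forall>z\<in>carrier A. \<forall>u\<in>U. F (z \<otimes>\<^bsub>A\<^esub> u) \<otimes>\<^bsub>K\<^esub> inv\<^bsub>K\<^esub> F z \<in> V)"
proof -
  interpret A: lcag A by fact
  interpret K: lcag K by fact
  let ?T = "prod_topology (topo A) (topo A)"
  define W where "W = {w \<in> topspace ?T. F (fst w \<otimes>\<^bsub>A\<^esub> snd w) \<otimes>\<^bsub>K\<^esub> inv\<^bsub>K\<^esub> F (fst w) \<in> V}"
  have FK: "F z \<in> carrier K" if "z \<in> carrier A" for z
    using continuous_map_image_subset_topspace[OF F] that by (auto simp: A.topspace_topo K.topspace_topo)
  have "continuous_map ?T (topo K) (\<lambda>w. F (fst w \<otimes>\<^bsub>A\<^esub> snd w))" "continuous_map ?T (topo K) (\<lambda>w. F (fst w))"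
    using continuous_map_compose[OF A.topology_mult[OF continuous_map_fst continuous_map_snd] F]
      continuous_map_compose[OF continuous_map_fst F] by (simp_all add: o_def)
  then have "continuous_map ?T (topo K) (\<lambda>w. F (fst w \<otimes>\<^bsub>A\<^esub> snd w) \<otimes>\<^bsub>K\<^esub> inv\<^bsub>K\<^esub> F (fst w))"
    by (intro K.topology_mult K.topology_inv)
  then have "openin ?T W" unfolding W_def by (rule openin_continuous_map_preimage[OF _ V(1)])
  moreover have CA: "C \<subseteq> carrier A" by (rule A.compactin_subset_carrier[OF C(1)])
  then have "C \<times> {\<one>\<^bsub>A\<^esub>} \<subseteq> W" using V(2) FK by (auto simp: W_def A.topspace_topo)
  ultimately obtain M U where MU: "openin (topo A) U" "C \<subseteq> M" "\<one>\<^bsub>A\<^esub> \<in> U" "M \<times> U \<subseteq> W"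
    using tube_lemma_left[of "topo A" "topo A" W C "\<one>\<^bsub>A\<^esub>"] C(1) A.topspace_topo A.one_closed
    by metis
  have "F (z \<otimes>\<^bsub>A\<^esub> u) \<otimes>\<^bsub>K\<^esub> inv\<^bsub>K\<^esub> F z \<in> V" if z: "z \<in> carrier A" and u: "u \<in> U" for z u
  proof -
    obtain l c where lc: "l \<in> L" "c \<in> C" "z = l \<otimes>\<^bsub>A\<^esub> c" using C(2) z by blast
    have car: "l \<in> carrier A" "c \<in> carrier A" "u \<in> carrier A"
      using lc L CA u A.openin_subset_carrier[OF MU(1)] by auto
    have "(c, u) \<in> W" using MU lc u by blast
    then have "F (c \<otimes>\<^bsub>A\<^esub> u) \<otimes>\<^bsub>K\<^esub> inv\<^bsub>K\<^esub> F c \<in> V" by (simp add: W_def)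
    then show ?thesis using lc car by (simp add: A.m_assoc per)
  qed
  then show ?thesis using MU by blast
qed

text \<open>The translates of \<open>x \<mapsto> F(i(x))\<close> are among the functions \<open>x \<mapsto> F(i(x) z)\<close>. These depend
  continuously and periodically on \<open>z\<close>, so they form a compact set.\<close>

theorem almost_periodic_of_periodic:
  assumes G: "lcag G" and A: "lcag A" and K: "lcag K" and F: "continuous_map (topo A) (topo K) F"
    and L: "lattice_in L A" and per: "\<forall>l\<in>L. \<forall>z\<in>carrier A. F (l \<otimes>\<^bsub>A\<^esub> z) = F z"
    and i: "i \<in> hom G A" "continuous_map (topo G) (topo A) i"
  shows "almost_periodic G K (\<lambda>x\<in>carrier G. F (i x))"
proof -
  interpret G: lcag G by fact
  interpret A: lcag A by fact
  interpret K: lcag K by fact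
  interpret i: group_hom G A i using i(1) by unfold_locales
  have LA: "L \<subseteq> carrier A"
    using L subgroup.subset by (auto simp: lattice_in_def)
  obtain C where C: "compactin (topo A) C" "\<forall>x\<in>carrier A. \<exists>l\<in>L. \<exists>c\<in>C. x = l \<otimes>\<^bsub>A\<^esub> c"
    using L unfolding lattice_in_iff[OF A] by blast
  have CA: "C \<subseteq> carrier A" by (rule A.compactin_subset_carrier[OF C(1)])
  note unif = periodic_uniformly_continuous[OF A K F LA per C]
  have FK: "F z \<in> carrier K" if "z \<in> carrier A" for z
    using continuous_map_image_subset_topspace[OF F] that by (auto simp: A.topspace_topo K.topspace_topo)
  have range: "F z \<in> F ` C" if z: "z \<in> carrier A" for z
  proof -
    obtain l c where "l \<in> L" "c \<in> C" "z = l \<otimes>\<^bsub>A\<^esub> c" using C(2) z by blast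
    then show ?thesis using per CA by auto
  qed
  define \<Phi> where "\<Phi> z = (\<lambda>x\<in>carrier G. F (i x \<otimes>\<^bsub>A\<^esub> z))" for z
  have \<Phi>_Cu: "\<Phi> z \<in> Cu G K" if z: "z \<in> carrier A" for z
    unfolding Cu_def
  proof (intro CollectI conjI allI impI)
    show "\<Phi> z \<in> carrier G \<rightarrow>\<^sub>E carrier K" using z FK by (auto simp: \<Phi>_def)
    have compact: "compactin (topo K) (F ` C)" by (rule image_compactin[OF C(1) F])
    have "\<Phi> z ` carrier G \<subseteq> F ` C" using range z by (auto simp: \<Phi>_def)
    then have "topo K closure_of (\<Phi> z ` carrier G) \<subseteq> F ` C"
      using compactin_imp_closedin[OF K.Hausdorff compact] by (rule closure_of_minimal)
    then show "compactin (topo K) (topo K closure_of (\<Phi> z ` carrier G))"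
      by (rule closed_compactin[OF compact]) simp
    fix V assume V: "openin (topo K) V \<and> \<one>\<^bsub>K\<^esub> \<in> V"
    obtain U where U: "openin (topo A) U" "\<one>\<^bsub>A\<^esub> \<in> U"
      "\<forall>z\<in>carrier A. \<forall>u\<in>U. F (z \<otimes>\<^bsub>A\<^esub> u) \<otimes>\<^bsub>K\<^esub> inv\<^bsub>K\<^esub> F z \<in> V"
      using unif V by meson
    let ?U = "{x \<in> topspace (topo G). i x \<in> U}"
    have "openin (topo G) ?U" by (rule openin_continuous_map_preimage[OF i(2) U(1)])
    moreover have "\<one>\<^bsub>G\<^esub> \<in> ?U" using U(2) by (simp add: G.topspace_topo)
    moreover have "\<Phi> z x \<otimes>\<^bsub>K\<^esub> inv\<^bsub>K\<^esub> (\<Phi> z y) \<in> V"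
      if xy: "x \<in> carrier G" "y \<in> carrier G" "x \<otimes>\<^bsub>G\<^esub> inv\<^bsub>G\<^esub> y \<in> ?U" for x y
    proof -
      have "i x \<otimes>\<^bsub>A\<^esub> z = (i y \<otimes>\<^bsub>A\<^esub> z) \<otimes>\<^bsub>A\<^esub> i (x \<otimes>\<^bsub>G\<^esub> inv\<^bsub>G\<^esub> y)"
        using xy z by (simp add: A.m_ac A.cancel_inv)
      then show ?thesis using U(3) xy z by (simp add: \<Phi>_def del: i.hom_mult)
    qed
    ultimately show "\<exists>U. openin (topo G) U \<and> \<one>\<^bsub>G\<^esub> \<in> U \<and> (\<forall>x\<in>carrier G. \<forall>y\<in>carrier G.
        x \<otimes>\<^bsub>G\<^esub> inv\<^bsub>G\<^esub> y \<in> U \<longrightarrow> \<Phi> z x \<otimes>\<^bsub>K\<^esub> inv\<^bsub>K\<^esub> (\<Phi> z y) \<in> V)" by blast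
  qed
  let ?T = "uniform_topology G K"
  have top: "topspace ?T = Cu G K" by (rule topspace_uniform_topology[OF K])
  have "continuous_map (topo A) ?T \<Phi>"
    unfolding continuous_map_def top A.topspace_topo
  proof (intro conjI allI impI)
    show "\<Phi> \<in> carrier A \<rightarrow> Cu G K" using \<Phi>_Cu by blast
    fix N assume N: "openin ?T N"
    show "openin (topo A) {z \<in> carrier A. \<Phi> z \<in> N}"
    proof (subst openin_subopen, intro ballI)
      fix z assume "z \<in> {z \<in> carrier A. \<Phi> z \<in> N}"
      then have z: "z \<in> carrier A" "\<Phi> z \<in> N" by auto
      then obtain V where V: "openin (topo K) V" "\<one>\<^bsub>K\<^esub> \<in> V"
        "{k \<in> Cu G K. \<forall>x\<in>carrier G. k x \<otimes>\<^bsub>K\<^esub> inv\<^bsub>K\<^esub> (\<Phi> z x) \<in> V} \<subseteq> N"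
        using N unfolding openin_uniform_topology by meson
      obtain U where U: "openin (topo A) U" "\<one>\<^bsub>A\<^esub> \<in> U"
        "\<forall>z\<in>carrier A. \<forall>u\<in>U. F (z \<otimes>\<^bsub>A\<^esub> u) \<otimes>\<^bsub>K\<^esub> inv\<^bsub>K\<^esub> F z \<in> V"
        using unif[OF V(1,2)] by meson
      let ?S = "{y \<in> carrier A. inv\<^bsub>A\<^esub> z \<otimes>\<^bsub>A\<^esub> y \<in> U}"
      have "openin (topo A) ?S" using z U by (intro A.openin_preimage A.topology_intros) auto
      moreover have "z \<in> ?S" using z U by simp
      moreover have "\<Phi> y \<in> N" if y: "y \<in> ?S" for y
      proof -
        have "i x \<otimes>\<^bsub>A\<^esub> y = (i x \<otimes>\<^bsub>A\<^esub> z) \<otimes>\<^bsub>A\<^esub> (inv\<^bsub>A\<^esub> z \<otimes>\<^bsub>A\<^esub> y)" if "x \<in> carrier G" for x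
          using that y z by (simp add: A.m_assoc A.cancel_inv)
        then have "\<Phi> y x \<otimes>\<^bsub>K\<^esub> inv\<^bsub>K\<^esub> (\<Phi> z x) \<in> V" if "x \<in> carrier G" for x
          using U(3) that y z by (simp add: \<Phi>_def)
        then show ?thesis using V(3) \<Phi>_Cu y by blast
      qed
      ultimately show "\<exists>T. openin (topo A) T \<and> z \<in> T \<and> T \<subseteq> {z \<in> carrier A. \<Phi> z \<in> N}"
        by (intro exI[of _ ?S]) blast
    qed
  qed
  then have compact: "compactin ?T (\<Phi> ` C)" by (rule image_compactin[OF C(1)])
  have \<Phi>_range: "\<Phi> z \<in> \<Phi> ` C" if z: "z \<in> carrier A" for z
  proof -
    obtain l c where lc: "l \<in> L" "c \<in> C" "z = l \<otimes>\<^bsub>A\<^esub> c" using C(2) z by blast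
    then have lc': "l \<in> carrier A" "c \<in> carrier A" using LA CA by auto
    have "\<Phi> z = \<Phi> c" unfolding \<Phi>_def
    proof (rule restrict_ext)
      fix x assume x: "x \<in> carrier G"
      have "i x \<otimes>\<^bsub>A\<^esub> z = l \<otimes>\<^bsub>A\<^esub> (i x \<otimes>\<^bsub>A\<^esub> c)" using lc lc' x by (simp add: A.m_lcomm)
      then show "F (i x \<otimes>\<^bsub>A\<^esub> z) = F (i x \<otimes>\<^bsub>A\<^esub> c)" using per lc lc' x by simp
    qed
    then show ?thesis using lc by blast
  qed
  define h where "h = (\<lambda>x\<in>carrier G. F (i x))"
  have "h = \<Phi> \<one>\<^bsub>A\<^esub>" unfolding h_def \<Phi>_def by (rule restrict_ext) simp
  then have "h \<in> Cu G K" using \<Phi>_Cu by simp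
  moreover have "translate G t h = \<Phi> (i (inv\<^bsub>G\<^esub> t))" if "t \<in> carrier G" for t
    unfolding translate_def \<Phi>_def using that by (intro restrict_ext) (simp add: h_def)
  then have "(\<lambda>t. translate G t h) ` carrier G \<subseteq> \<Phi> ` C"
    using \<Phi>_range by (auto simp del: i.hom_inv)
  then have "?T closure_of ((\<lambda>t. translate G t h) ` carrier G) \<subseteq> \<Phi> ` C"
    using compactin_imp_closedin[OF Hausdorff_uniform_topology[OF K] compact]
    by (rule closure_of_minimal)
  then have "compactin ?T (?T closure_of ((\<lambda>t. translate G t h) ` carrier G))"
    by (rule closed_compactin[OF compact]) simp
  ultimately show ?thesis unfolding almost_periodic_def h_def by blast
qed

section \<open>Deformations in Euclidean space as modulations\<close>

text \<open>Since \<open>\<pi>\<^sup>G\<close> is one-to-one on the lattice, the compact set \<open>K\<close> embeds into the torus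
  \<open>(G \<times> H) / L\<close> by \<open>h \<mapsto> (1, h\<^sup>-\<^sup>1) L\<close>. By Tietze's theorem the deformation, transported to the image
  of \<open>K\<close>, extends to the whole torus. The points \<open>(l, 1)\<close> and \<open>(1, (l\<^sup>\<star>)\<^sup>-\<^sup>1)\<close> agree in the torus, so
  the extension recovers \<open>p(l\<^sup>\<star>)\<close> at \<open>(l, 1)\<close>.\<close>

theorem periodic_extension:
  fixes p :: "'h \<Rightarrow> 'e::euclidean_space" and H :: "'h tgroup"
  assumes cps: "cps G H L" and K: "compactin (topo H) K"
    and p: "continuous_map (topo H) euclidean p"
  obtains F where "continuous_map (topo (prod_tgroup G H)) euclidean F"
    "\<forall>l\<in>L. \<forall>z\<in>carrier (prod_tgroup G H). F (l \<otimes>\<^bsub>prod_tgroup G H\<^esub> z) = F z"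
    "\<And>l. l \<in> fst ` L \<Longrightarrow> star L l \<in> K \<Longrightarrow> F (l, \<one>\<^bsub>H\<^esub>) = p (star L l)"
proof -
  let ?A = "prod_tgroup G H"
  interpret G: lcag G using cpsD[OF cps] by blast
  interpret H: lcag H using cpsD[OF cps] by blast
  interpret A: lcag ?A using cpsD[OF cps] by blast
  have sub: "subgroup L ?A" and lat: "lattice_in L ?A" using cpsD[OF cps] by auto
  have LA: "L \<subseteq> carrier ?A" by (rule subgroup.subset[OF sub])
  let ?q = "\<lambda>z. L #>\<^bsub>?A\<^esub> z"
  define Q where "Q = quotient_topology (topo ?A) ?q"
  have "compact_space Q" using lat by (simp add: lattice_in_def Q_def)
  moreover have Haus: "Hausdorff_space Q" unfolding Q_def
    by (rule Hausdorff_quotient[OF A.lcag_axioms sub lattice_closed[OF A.lcag_axioms lat]])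
  ultimately have normal: "normal_space Q" using compact_Hausdorff_or_regular_imp_normal_space by blast
  have q: "continuous_map (topo ?A) Q ?q"
    unfolding Q_def by (rule quotient_imp_continuous_map[OF quotient_map_quotient_topology])
  have KH: "K \<subseteq> carrier H" by (rule H.compactin_subset_carrier[OF K])
  have inv: "inv\<^bsub>?A\<^esub> (g, h) = (inv\<^bsub>G\<^esub> g, inv\<^bsub>H\<^esub> h)" if "g \<in> carrier G" "h \<in> carrier H" for g h
    using that by (rule inv_prod_tgroup[OF G.comm_group_axioms H.comm_group_axioms])
  define s where "s = (\<lambda>h. ?q (\<one>\<^bsub>G\<^esub>, inv\<^bsub>H\<^esub> h))"
  have "continuous_map (topo H) (topo ?A) (\<lambda>h. (\<one>\<^bsub>G\<^esub>, inv\<^bsub>H\<^esub> h))"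
    by (simp add: continuous_map_paired G.topspace_topo H.continuous_inv)
  from continuous_map_compose[OF this q] have s: "continuous_map (topo H) Q s"
    by (simp add: s_def o_def)
  have inj: "h = k" if hk: "h \<in> K" "k \<in> K" "s h = s k" for h k
  proof -
    have car: "h \<in> carrier H" "k \<in> carrier H" using hk KH by auto
    have "(\<one>\<^bsub>G\<^esub>, inv\<^bsub>H\<^esub> h) \<otimes>\<^bsub>?A\<^esub> inv\<^bsub>?A\<^esub> (\<one>\<^bsub>G\<^esub>, inv\<^bsub>H\<^esub> k) \<in> L"
      using A.coset_eq_iff[OF sub, of "(\<one>\<^bsub>G\<^esub>, inv\<^bsub>H\<^esub> h)" "(\<one>\<^bsub>G\<^esub>, inv\<^bsub>H\<^esub> k)"] hk(3) car
      by (simp add: s_def)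
    then have "(\<one>\<^bsub>G\<^esub>, inv\<^bsub>H\<^esub> h \<otimes>\<^bsub>H\<^esub> k) \<in> L" using car by (simp add: inv)
    moreover have "(\<one>\<^bsub>G\<^esub>, \<one>\<^bsub>H\<^esub>) \<in> L" using subgroup.one_closed[OF sub] by simp
    ultimately have "inv\<^bsub>H\<^esub> h \<otimes>\<^bsub>H\<^esub> k = \<one>\<^bsub>H\<^esub>"
      using inj_onD[OF cpsD(6)[OF cps], of "(\<one>\<^bsub>G\<^esub>, inv\<^bsub>H\<^esub> h \<otimes>\<^bsub>H\<^esub> k)" "(\<one>\<^bsub>G\<^esub>, \<one>\<^bsub>H\<^esub>)"] by simp
    then show ?thesis using H.inv_solve_left'[of "\<one>\<^bsub>H\<^esub>" h k] car by simp
  qed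
  have top_K: "topspace (subtopology (topo H) K) = K" using KH by (auto simp: H.topspace_topo)
  have "embedding_map (subtopology (topo H) K) Q s"
    using K inj by (intro continuous_imp_embedding_map continuous_map_from_subtopology s Haus)
      (auto simp: compact_space_subtopology top_K inj_on_def)
  then obtain r where r: "homeomorphic_maps (subtopology (topo H) K) (subtopology Q (s ` K)) s r"
    unfolding embedding_map_def homeomorphic_map_maps top_K by blast
  have r_cont: "continuous_map (subtopology Q (s ` K)) (topo H) r"
    using r continuous_map_into_fulltopology unfolding homeomorphic_maps_def by blast
  have r_s: "r (s h) = h" if "h \<in> K" for h
    using r that unfolding homeomorphic_maps_def top_K by blast
  have "closedin Q (s ` K)"
    by (rule compactin_imp_closedin[OF Haus image_compactin[OF K s]])
  moreover have "continuous_map (subtopology Q (s ` K)) euclidean (\<lambda>y. p (r y) \<bullet> b)" for b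
  proof -
    have "continuous_map euclidean euclidean (\<lambda>v. v \<bullet> b)"
      by (simp add: continuous_intros)
    from continuous_map_compose[OF continuous_map_compose[OF r_cont p] this]
    show ?thesis by (simp add: o_def)
  qed
  ultimately have "\<forall>b. \<exists>g :: _ \<Rightarrow> real. continuous_map Q euclidean g \<and>
      (\<forall>y\<in>s ` K. g y = p (r y) \<bullet> b)"
    using normal unfolding normal_space_iff_Tietze by meson
  then obtain g where g: "\<And>b. continuous_map Q euclideanreal (g b)"
    "\<And>b y. y \<in> s ` K \<Longrightarrow> g b y = p (r y) \<bullet> b"
    by metis
  define P where "P = (\<lambda>y. \<Sum>b\<in>Basis. g b y *\<^sub>R b)"
  have P: "continuous_map Q euclidean P"
    using g(1) unfolding P_def continuous_map_atin
    by (auto intro!: tendsto_sum tendsto_scaleR tendsto_const)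
  have P_s: "P (s h) = p h" if "h \<in> K" for h
  proof -
    have "P (s h) = (\<Sum>b\<in>Basis. (p h \<bullet> b) *\<^sub>R b)" using g(2) r_s that by (simp add: P_def)
    then show ?thesis by (simp add: euclidean_representation)
  qed
  show ?thesis
  proof
    show "continuous_map (topo ?A) euclidean (P \<circ> ?q)" by (rule continuous_map_compose[OF q P])
    show "\<forall>l\<in>L. \<forall>z\<in>carrier ?A. (P \<circ> ?q) (l \<otimes>\<^bsub>?A\<^esub> z) = (P \<circ> ?q) z"
    proof (intro ballI)
      fix l z assume lz: "l \<in> L" "z \<in> carrier ?A"
      have l: "l \<in> carrier ?A" using lz LA by blast
      have "l \<otimes>\<^bsub>?A\<^esub> z \<otimes>\<^bsub>?A\<^esub> inv\<^bsub>?A\<^esub> z = l"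
        using A.m_assoc[OF l lz(2) A.inv_closed[OF lz(2)]] A.r_inv[OF lz(2)] A.r_one[OF l] by simp
      then have "?q (l \<otimes>\<^bsub>?A\<^esub> z) = ?q z"
        using A.coset_eq_iff[OF sub A.m_closed[OF l lz(2)] lz(2)] lz(1) by simp
      then show "(P \<circ> ?q) (l \<otimes>\<^bsub>?A\<^esub> z) = (P \<circ> ?q) z" by simp
    qed
    show "(P \<circ> ?q) (l, \<one>\<^bsub>H\<^esub>) = p (star L l)" if l: "l \<in> fst ` L" "star L l \<in> K" for l
    proof -
      have car: "l \<in> carrier G" "star L l \<in> carrier H" using cps_star_closed[OF cps l(1)] by auto
      have "(l, \<one>\<^bsub>H\<^esub>) \<otimes>\<^bsub>?A\<^esub> inv\<^bsub>?A\<^esub> (\<one>\<^bsub>G\<^esub>, inv\<^bsub>H\<^esub> star L l) = (l, star L l)"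
        using car by (simp add: inv)
      then have "?q (l, \<one>\<^bsub>H\<^esub>) = s (star L l)"
        using A.coset_eq_iff[OF sub, of "(l, \<one>\<^bsub>H\<^esub>)" "(\<one>\<^bsub>G\<^esub>, inv\<^bsub>H\<^esub> star L l)"] car
          star_mem[OF cpsD(6)[OF cps] l(1)] by (simp add: s_def)
      then show ?thesis using P_s[OF l(2)] by simp
    qed
  qed
qed

lemma additive_tgroup_simps [simp]:
  "carrier (additive_tgroup :: 'a::topological_ab_group_add tgroup) = UNIV"
  "\<one>\<^bsub>additive_tgroup :: 'a tgroup\<^esub> = 0"
  "x \<otimes>\<^bsub>additive_tgroup :: 'a tgroup\<^esub> y = x + y"
  "topo (additive_tgroup :: 'a tgroup) = euclidean"
  by (simp_all add: additive_tgroup_def)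

text \<open>Off the support of the weight the deformation and the modulation may differ, because the
  corresponding points carry no mass.\<close>

theorem deformed_is_modulation:
  fixes \<nu> :: "('e::euclidean_space \<Rightarrow> complex) \<Rightarrow> complex" and H :: "'h tgroup"
  assumes \<nu>: "deformed_weighted_model_set additive_tgroup H L \<nu>"
  shows "\<exists>\<nu>'. weighted_model_set additive_tgroup H L \<nu>' \<and> is_modulation additive_tgroup \<nu>' \<nu>"
proof -
  let ?G = "additive_tgroup :: 'e tgroup"
  obtain f p where cps: "cps ?G H L" and f: "f \<in> Cc H"
    and p: "continuous_map (topo H) (topo ?G) p" and eq: "\<nu> = deformed_comb ?G L f p"
    using \<nu> unfolding deformed_weighted_model_set_def by blast
  interpret G: lcag ?G by (rule lcag_additive_tgroup)
  interpret H: lcag H using cpsD[OF cps] by blast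
  let ?A = "prod_tgroup ?G H"
  obtain K where K: "compactin (topo H) K" "\<forall>h. h \<notin> K \<longrightarrow> f h = 0"
    using f by (auto simp: Cc_def)
  have p': "continuous_map (topo H) euclidean p" using p by simp
  obtain F where F: "continuous_map (topo ?A) euclidean F"
    and per: "\<forall>l\<in>L. \<forall>z\<in>carrier ?A. F (l \<otimes>\<^bsub>?A\<^esub> z) = F z"
    and F_p: "\<And>l. l \<in> fst ` L \<Longrightarrow> star L l \<in> K \<Longrightarrow> F (l, \<one>\<^bsub>H\<^esub>) = p (star L l)"
    by (rule periodic_extension[OF cps K(1) p']) (rule that)
  let ?i = "\<lambda>x. (x, \<one>\<^bsub>H\<^esub>)"
  have i: "?i \<in> hom ?G ?A" "continuous_map (topo ?G) (topo ?A) ?i"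
    by (auto simp: hom_def continuous_map_paired H.topspace_topo)
  define g where "g = (\<lambda>x\<in>carrier ?G. F (?i x))"
  define w :: "'e \<Rightarrow> complex" where "w = (\<lambda>x\<in>carrier ?G. 1)"
  have ap_g: "almost_periodic ?G ?G g"
    unfolding g_def using F per
    by (intro almost_periodic_of_periodic[OF G.lcag_axioms cpsD(3)[OF cps] G.lcag_axioms _ cpsD(4)[OF cps] _ i])
      simp_all
  have ap_w: "almost_periodic ?G (additive_tgroup :: complex tgroup) w"
    unfolding w_def
    by (rule almost_periodic_of_periodic[OF G.lcag_axioms cpsD(3)[OF cps] lcag_additive_tgroup
          _ cpsD(4)[OF cps] _ i]) simp_all
  let ?\<nu> = "deformed_comb ?G L f (\<lambda>_. \<one>\<^bsub>?G\<^esub>)"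
  have radon: "radon_measure ?G ?\<nu>"
    by (rule radon_measure_deformed_comb[OF cps f]) simp
  have w: "continuous_map (topo ?G) euclidean w" by (simp add: w_def)
  have "F \<circ> ?i = g" by (simp add: g_def fun_eq_iff)
  then have g: "continuous_map (topo ?G) (topo ?G) g"
    using continuous_map_compose[OF i(2) F] by simp
  have g_compact: "compactin (topo ?G) (topo ?G closure_of (g ` carrier ?G))"
    using ap_g by (simp add: almost_periodic_def Cu_def)
  have g_range: "g ` carrier ?G \<subseteq> topo ?G closure_of (g ` carrier ?G)"
    by (rule closure_of_subset) simp
  have "modulate ?G w g ?\<nu> =
      (\<lambda>\<phi>\<in>Cc ?G. \<Sum>\<^sub>\<infinity>l\<in>fst ` L. f (star L l) * (w l * \<phi> (l \<otimes>\<^bsub>?G\<^esub> g l)))"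
    by (rule modulate_weighted_comb[OF cps w g g_compact g_range])
  also have "\<dots> = deformed_comb ?G L f p"
    unfolding deformed_comb_def
  proof (intro restrict_ext infsum_cong)
    fix \<phi> l assume l: "l \<in> fst ` L"
    show "f (star L l) * (w l * \<phi> (l \<otimes>\<^bsub>?G\<^esub> g l)) = f (star L l) * \<phi> (l \<otimes>\<^bsub>?G\<^esub> p (star L l))"
    proof (cases "star L l \<in> K")
      case True
      then show ?thesis using F_p[OF l] by (simp add: w_def g_def)
    qed (use K(2) in simp)
  qed
  finally have "\<nu> = modulate ?G w g ?\<nu>" using eq by simp
  then have "is_modulation ?G ?\<nu> \<nu>" unfolding is_modulation_def using radon ap_w ap_g by blast
  moreover have "weighted_model_set ?G H L ?\<nu>"
    unfolding weighted_model_set_def using cps radon f by blast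
  ultimately show ?thesis by blast
qed

section \<open>Modulations and deformations\<close>

theorem modulation_deformed_in_Bohr_extension:
  fixes G :: "'g tgroup" and H :: "'h tgroup" and B :: "'b tgroup"
  assumes cps: "cps G H L" and bohr: "bohr_compactification G B i"
    and \<nu>: "weighted_model_set G H L \<nu>" and \<mu>: "is_modulation G \<nu> \<mu>"
  shows "deformed_weighted_model_set G (extended_internal H L B i) (extended_lattice L i) \<mu>"
proof -
  have G: "lcag G" using cpsD[OF cps] by blast
  obtain w g where w: "almost_periodic G (additive_tgroup :: complex tgroup) w"
    and g: "almost_periodic G G g" and eq: "\<mu> = modulate G w g \<nu>"
    using \<mu> unfolding is_modulation_def by blast
  obtain w' where w': "continuous_map (topo B) (topo (additive_tgroup :: complex tgroup)) w'"
    "\<forall>x\<in>carrier G. w x = w' (i x)"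
    using almost_periodic_extends_to_Bohr[OF G lcag_additive_tgroup bohr w] by blast
  obtain g' where g': "continuous_map (topo B) (topo G) g'" "\<forall>x\<in>carrier G. g x = g' (i x)"
    using almost_periodic_extends_to_Bohr[OF G G bohr g] by blast
  have B: "lcag B" "compact_space (topo B)" "i \<in> hom G B" "continuous_map (topo G) (topo B) i"
    using bohr unfolding bohr_compactification_def by auto
  show ?thesis unfolding eq
    using w' g' by (intro modulation_deformed_in_extension[OF cps B _ _ _ _ \<nu>]) simp_all
qed

text \<open>For given \<open>w\<close> and \<open>g\<close> the product of their hulls serves instead of the Bohr compactification.\<close>

theorem modulation_is_deformed:
  fixes G :: "'g tgroup" and H :: "'h tgroup"
  assumes \<nu>: "weighted_model_set G H L \<nu>" and \<mu>: "is_modulation G \<nu> \<mu>"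
  shows "\<exists>(H' :: ('h \<times> ('g \<Rightarrow> complex) \<times> ('g \<Rightarrow> 'g)) tgroup) L'.
    deformed_weighted_model_set G H' L' \<mu>"
proof -
  have cps: "cps G H L" using \<nu> by (simp add: weighted_model_set_def)
  have G: "lcag G" using cpsD[OF cps] by blast
  obtain w g where w: "almost_periodic G (additive_tgroup :: complex tgroup) w"
    and g: "almost_periodic G G g" and eq: "\<mu> = modulate G w g \<nu>"
    using \<mu> unfolding is_modulation_def by blast
  obtain A :: "('g \<Rightarrow> complex) tgroup" and j d where A: "lcag A" "compact_space (topo A)" "j \<in> hom G A" "continuous_map (topo G) (topo A) j"
    "topo A closure_of (j ` carrier G) = carrier A" "continuous_map (topo A) (topo (additive_tgroup :: complex tgroup)) d"
    and d: "\<And>x. x \<in> carrier G \<Longrightarrow> d (j x) = w x"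
    by (rule almost_periodic_compactification[OF G lcag_additive_tgroup w]) (rule that)
  obtain B :: "('g \<Rightarrow> 'g) tgroup" and k e where B: "lcag B" "compact_space (topo B)" "k \<in> hom G B" "continuous_map (topo G) (topo B) k"
    "topo B closure_of (k ` carrier G) = carrier B" "continuous_map (topo B) (topo G) e"
    and e: "\<And>x. x \<in> carrier G \<Longrightarrow> e (k x) = g x"
    by (rule almost_periodic_compactification[OF G G g]) (rule that)
  let ?P = "prod_tgroup A B" and ?i = "\<lambda>x. (j x, k x)"
  have P: "lcag ?P" "compact_space (topo ?P)"
    using A B by (simp_all add: lcag_prod_tgroup compact_space_prod_topology)
  have i: "?i \<in> hom G ?P" "continuous_map (topo G) (topo ?P) ?i"
    using A B by (auto simp: hom_def continuous_map_paired)
  have d': "continuous_map (topo ?P) euclidean (d \<circ> fst)"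
    using continuous_map_compose[OF continuous_map_fst A(6)] by simp
  have e': "continuous_map (topo ?P) (topo G) (e \<circ> snd)"
    using continuous_map_compose[OF continuous_map_snd B(6)] by simp
  have "deformed_weighted_model_set G (extended_internal H L ?P ?i) (extended_lattice L ?i) \<mu>"
    unfolding eq
    by (rule modulation_deformed_in_extension[OF cps P i d' _ e' _ \<nu>]) (simp_all add: d e)
  then show ?thesis by blast
qed

(* HOL cannot quantify existentially over types, so the classes over all schemes are taken over
   internal groups carried by the type  (real ^ 'd) set set.  The last two conjuncts, with a free
   type variable 'k, say that internal groups on any other type yield no further measures. *)
theorem theorem8p5:
  shows "(\<forall>(G :: 'g tgroup) (H\<^sub>0 :: 'h tgroup) \<L>\<^sub>0 (B :: 'b tgroup) i \<nu> \<mu>.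
            cps G H\<^sub>0 \<L>\<^sub>0 \<longrightarrow> bohr_compactification G B i \<longrightarrow>
            weighted_model_set G H\<^sub>0 \<L>\<^sub>0 \<nu> \<longrightarrow> is_modulation G \<nu> \<mu> \<longrightarrow>
            deformed_weighted_model_set G
              (extended_internal H\<^sub>0 \<L>\<^sub>0 B i) (extended_lattice \<L>\<^sub>0 i) \<mu>)
       \<and> deformed_class TYPE((real ^ 'd) set set) (additive_tgroup :: (real ^ 'd) tgroup)
           = modulation_class TYPE((real ^ 'd) set set) additive_tgroup
       \<and> deformed_class TYPE('k) (additive_tgroup :: (real ^ 'd) tgroup)
           \<subseteq> deformed_class TYPE((real ^ 'd) set set) additive_tgroup
       \<and> modulation_class TYPE('k) (additive_tgroup :: (real ^ 'd) tgroup)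
           \<subseteq> modulation_class TYPE((real ^ 'd) set set) additive_tgroup"
proof (intro conjI)
  show "\<forall>(G :: 'g tgroup) (H\<^sub>0 :: 'h tgroup) \<L>\<^sub>0 (B :: 'b tgroup) i \<nu> \<mu>.
      cps G H\<^sub>0 \<L>\<^sub>0 \<longrightarrow> bohr_compactification G B i \<longrightarrow>
      weighted_model_set G H\<^sub>0 \<L>\<^sub>0 \<nu> \<longrightarrow> is_modulation G \<nu> \<mu> \<longrightarrow>
      deformed_weighted_model_set G
        (extended_internal H\<^sub>0 \<L>\<^sub>0 B i) (extended_lattice \<L>\<^sub>0 i) \<mu>"
    by (intro allI impI modulation_deformed_in_Bohr_extension)
  let ?G = "additive_tgroup :: (real ^ 'd) tgroup"
  let ?T = "TYPE((real ^ 'd) set set)"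
  show "deformed_class ?T ?G = modulation_class ?T ?G"
  proof
    show "deformed_class ?T ?G \<subseteq> modulation_class ?T ?G"
      using deformed_is_modulation unfolding deformed_class_def modulation_class_def by blast
    show "modulation_class ?T ?G \<subseteq> deformed_class ?T ?G"
    proof
      fix \<mu> assume "\<mu> \<in> modulation_class ?T ?G"
      then have "\<mu> \<in> deformed_class TYPE((real ^ 'd) set set \<times> (real ^ 'd \<Rightarrow> complex) \<times>
          (real ^ 'd \<Rightarrow> real ^ 'd)) ?G"
        using modulation_is_deformed unfolding deformed_class_def modulation_class_def by blast
      then show "\<mu> \<in> deformed_class ?T ?G" using deformed_class_subset by blast
    qed
  qed
qed (rule deformed_class_subset modulation_class_subset)+


end
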